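(* Let $N=\mathbb{R}^3$ and let $V(p)=v\times p$ be an infinitesimal rotation with $v\in\mathbb{R}^3$ a unit length eigenvector of the rotational part of the monodromy $h=Ap+a$. Then the flux functional $E_V$ becomes $$E_{-2}=\tfrac12\int_I\big(|\gamma-(\gamma,v)v|^2\,d\gamma,\,v\big).$$ The vector $\tfrac12\int_I|\gamma-(\gamma,v)v|^2\,d\gamma$ is called the volume vector of $\gamma$ and $E_{-2}$ is called the volume functional. Indeed, for a closed curve $E_{-2}$ measures the volume of the solid torus of revolution generated by rotating the curve $\gamma\in\mathcal{M}$ around the axis $\mathbb{R}v$. The variational and symplectic gradients of $E_{-2}$ are given by $$G_{-2}=\gamma'\times(v\times\gamma)\qquad\text{and}\qquad Y_{-2}\equiv v\times\gamma\mod C^\infty(\mathcal{M},\mathbb{R})T .$$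
   Context: Let $M\cong\mathbb{R}$ be an oriented 1-manifold with a fixed translation $\tau\in\mathrm{Diff}(M)$, $M/\tau\cong S^1$, and $I\subset M$ a fundamental domain for $\tau$. Let $h(p)=Ap+a$ be an orientation preserving Euclidean motion ($A\in SO(3)$, $a\in\mathbb{R}^3$), and let $\mathcal{M}$ be the manifold of smooth immersions $\gamma\colon M\to\mathbb{R}^3$ with monodromy $h$, that is, $\gamma\circ\tau=h\circ\gamma$; $T_\gamma\mathcal{M}$ consists of the smooth $\xi\colon M\to\mathbb{R}^3$ with $\xi\circ\tau=A\xi$. That $v$ is an eigenvector of $A$ expresses that $V$ is $h$-related to itself; the origin of $\mathbb{R}^3$ is chosen to lie on the axis $\mathbb{R}v$. Let $dx$ be the arclength 1-form of $\gamma$, $(\ )'$ the arclength derivative, $T=\gamma'$. Set $\langle\xi,\eta\rangle_\gamma=\int_I(\xi,\eta)dx$ and $\sigma_\gamma(\xi,\eta)=\int_I\det(T,\xi,\eta)dx=\langle T\times\xi,\eta\rangle$. The variational gradient $G_E$ of $E\colon\mathcal{M}\to\mathbb{R}$ is defined by $\langle G_E,-\rangle=dE$, and a symplectic gradient $Y_E$ by $\sigma(Y_E,-)=dE$; the latter is determined only up to adding function multiples of $T$, which is the meaning of "$\mathrm{mod}\ C^\infty(\mathcal{M},\mathbb{R})T$". Flux functional: for a volume preserving vector field $V$ and an $h$-invariant primitive $\alpha_V$ of the closed 2-form $i_V\det$, $E_V(\gamma)=\int_I\gamma^*\alpha_V$. For the infinitesimal rotation $V(p)=v\times p$ the primitive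 used is $\alpha_V=\frac12|p-(p,v)v|^2(v,dp)$.
   Formalization: Sign corrected: E_{-2} has gradients −γ'×(v×γ) and −v×γ mod T; the printed ones belong to −E_{-2}, the flux of the true primitive −α_V. V is assumed h-related to itself (Av=v, a∥v). Volume is 2π|E_{-2}|, for h=id and a simple closed meridian curve off the axis. *)

theory Defs
  imports "HOL-Analysis.Analysis"
begin

unbundle cross3_syntax

section \<open>Smooth maps\<close>

text \<open>For open \<open>S\<close> in a Euclidean space this is \<open>C\<^sup>\<infinity>\<close>: all iterated directional derivatives exist
  and are differentiable.\<close>

primrec higher_differentiable_on ::
    "'a::real_normed_vector set \<Rightarrow> ('a \<Rightarrow> 'b::real_normed_vector) \<Rightarrow> nat \<Rightarrow> bool" where
  "higher_differentiable_on S f 0 \<longleftrightarrow> continuous_on S f"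
| "higher_differentiable_on S f (Suc n) \<longleftrightarrow>
     (\<forall>x\<in>S. f differentiable (at x)) \<and>
     (\<forall>h. higher_differentiable_on S (\<lambda>x. frechet_derivative f (at x) h) n)"

definition smooth_on :: "'a::real_normed_vector set \<Rightarrow> ('a \<Rightarrow> 'b::real_normed_vector) \<Rightarrow> bool" where
  "smooth_on S f \<longleftrightarrow> (\<forall>n. higher_differentiable_on S f n)"

definition diffeomorphism :: "(real \<Rightarrow> real) \<Rightarrow> bool" where
  "diffeomorphism \<phi> \<longleftrightarrow> bij \<phi> \<and> smooth_on UNIV \<phi> \<and> smooth_on UNIV (inv \<phi>)"


section \<open>The parameter manifold\<close>

text \<open>The oriented 1-manifold \<open>M \<cong> \<real>\<close> is represented by the type \<^typ>\<open>real\<close> with its standard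
  orientation, through an arbitrary oriented global chart.  That \<open>\<tau>\<close> is a translation with
  \<open>M/\<tau> \<cong> S\<^sup>1\<close> means that some global coordinate \<open>\<phi>\<close>, not necessarily the chart and not necessarily
  orientation preserving, turns \<open>\<tau>\<close> into the unit shift; \<open>exp (2 \<pi> \<i> \<phi>)\<close> then identifies \<open>M/\<tau>\<close>
  with \<open>S\<^sup>1\<close>.  Every diffeomorphism of the line without fixed points is of this kind.\<close>

definition translation :: "(real \<Rightarrow> real) \<Rightarrow> bool" where
  "translation \<tau> \<longleftrightarrow> (\<exists>\<phi>. diffeomorphism \<phi> \<and> (\<forall>t. \<phi> (\<tau> t) = \<phi> t + 1))"

definition same_orbit :: "(real \<Rightarrow> real) \<Rightarrow> real \<Rightarrow> real \<Rightarrow> bool" where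
  "same_orbit \<tau> s t \<longleftrightarrow> (\<exists>n. t = (\<tau> ^^ n) s \<or> s = (\<tau> ^^ n) t)"

text \<open>No choice is made about which end points belong to \<open>I\<close>.\<close>

definition fundamental_domain :: "(real \<Rightarrow> real) \<Rightarrow> real set \<Rightarrow> bool" where
  "fundamental_domain \<tau> I \<longleftrightarrow>
     is_interval I \<and>
     (\<forall>t. \<exists>s\<in>I. same_orbit \<tau> s t) \<and>
     (\<forall>n>0. interior I \<inter> (\<tau> ^^ n) ` interior I = {})"


section \<open>Curves with monodromy \<open>h(p) = A p + a\<close>\<close>

definition curve_space :: "(real \<Rightarrow> real) \<Rightarrow> real^3^3 \<Rightarrow> real^3 \<Rightarrow> (real \<Rightarrow> real^3) set" where
  "curve_space \<tau> A a =
     {\<gamma>. smooth_on UNIV \<gamma> \<and> (\<forall>t. vector_derivative \<gamma> (at t) \<noteq> 0) \<and>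
         (\<forall>t. \<gamma> (\<tau> t) = A *v \<gamma> t + a)}"

text \<open>The tangent space of the curve space is the same at all its points.\<close>

definition tangent_space :: "(real \<Rightarrow> real) \<Rightarrow> real^3^3 \<Rightarrow> (real \<Rightarrow> real^3) set" where
  "tangent_space \<tau> A = {\<xi>. smooth_on UNIV \<xi> \<and> (\<forall>t. \<xi> (\<tau> t) = A *v \<xi> t)}"

text \<open>The arclength form of \<open>\<gamma>\<close> is \<open>dx = speed \<gamma> t dt\<close>.\<close>

definition speed :: "(real \<Rightarrow> real^3) \<Rightarrow> real \<Rightarrow> real" where
  "speed \<gamma> t = norm (vector_derivative \<gamma> (at t))"

definition arclength_deriv :: "(real \<Rightarrow> real^3) \<Rightarrow> (real \<Rightarrow> real^3) \<Rightarrow> real \<Rightarrow> real^3" where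
  "arclength_deriv \<gamma> f t = vector_derivative f (at t) /\<^sub>R speed \<gamma> t"

definition unit_tangent :: "(real \<Rightarrow> real^3) \<Rightarrow> real \<Rightarrow> real^3" where
  "unit_tangent \<gamma> = arclength_deriv \<gamma> \<gamma>"

definition L2_product ::
    "real set \<Rightarrow> (real \<Rightarrow> real^3) \<Rightarrow> (real \<Rightarrow> real^3) \<Rightarrow> (real \<Rightarrow> real^3) \<Rightarrow> real" where
  "L2_product I \<gamma> \<xi> \<eta> = integral I (\<lambda>t. (\<xi> t \<bullet> \<eta> t) * speed \<gamma> t)"

definition symplectic_form ::
    "real set \<Rightarrow> (real \<Rightarrow> real^3) \<Rightarrow> (real \<Rightarrow> real^3) \<Rightarrow> (real \<Rightarrow> real^3) \<Rightarrow> real" where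
  "symplectic_form I \<gamma> \<xi> \<eta> =
     integral I (\<lambda>t. det (vector [unit_tangent \<gamma> t, \<xi> t, \<eta> t] :: real^3^3) * speed \<gamma> t)"


section \<open>Differentials and gradients\<close>

text \<open>\<open>L\<close> is the differential at \<open>\<gamma>\<close> of the functional \<open>E\<close> on the space of curves \<open>\<M>\<close>: along every
  smooth path \<open>s \<mapsto> \<Gamma> (s, \<cdot>)\<close> in \<open>\<M>\<close> through \<open>\<gamma>\<close> with velocity \<open>\<xi>\<close> at \<open>s = 0\<close>, the derivative of
  \<open>E\<close> exists and is \<open>L \<xi>\<close>.\<close>

definition has_differential ::
    "((real \<Rightarrow> real^3) \<Rightarrow> real) \<Rightarrow> ((real \<Rightarrow> real^3) \<Rightarrow> real) \<Rightarrow>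
     (real \<Rightarrow> real^3) set \<Rightarrow> (real \<Rightarrow> real^3) \<Rightarrow> bool" where
  "has_differential E L \<M> \<gamma> \<longleftrightarrow>
     (\<forall>\<Gamma> :: real \<times> real \<Rightarrow> real^3. \<forall>\<epsilon>>0.
        smooth_on (fst -` {-\<epsilon><..<\<epsilon>}) \<Gamma> \<and>
        (\<forall>s\<in>{-\<epsilon><..<\<epsilon>}. (\<lambda>t. \<Gamma> (s, t)) \<in> \<M>) \<and>
        (\<lambda>t. \<Gamma> (0, t)) = \<gamma> \<longrightarrow>
        ((\<lambda>s. E (\<lambda>t. \<Gamma> (s, t))) has_real_derivative
           L (\<lambda>t. vector_derivative (\<lambda>s. \<Gamma> (s, t)) (at 0))) (at 0))"

definition variational_gradient ::
    "(real \<Rightarrow> real) \<Rightarrow> real set \<Rightarrow> real^3^3 \<Rightarrow> real^3 \<Rightarrow>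
     ((real \<Rightarrow> real^3) \<Rightarrow> real) \<Rightarrow> (real \<Rightarrow> real^3) \<Rightarrow> (real \<Rightarrow> real^3) \<Rightarrow> bool" where
  "variational_gradient \<tau> I A a E \<gamma> G \<longleftrightarrow>
     G \<in> tangent_space \<tau> A \<and>
     has_differential E (\<lambda>\<xi>. L2_product I \<gamma> G \<xi>) (curve_space \<tau> A a) \<gamma>"

definition symplectic_gradient ::
    "(real \<Rightarrow> real) \<Rightarrow> real set \<Rightarrow> real^3^3 \<Rightarrow> real^3 \<Rightarrow>
     ((real \<Rightarrow> real^3) \<Rightarrow> real) \<Rightarrow> (real \<Rightarrow> real^3) \<Rightarrow> (real \<Rightarrow> real^3) \<Rightarrow> bool" where
  "symplectic_gradient \<tau> I A a E \<gamma> Y \<longleftrightarrow>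
     Y \<in> tangent_space \<tau> A \<and>
     has_differential E (\<lambda>\<xi>. symplectic_form I \<gamma> Y \<xi>) (curve_space \<tau> A a) \<gamma>"

text \<open>Congruence modulo function multiples of \<open>T\<close>.  The functions are those on \<open>M/\<tau>\<close>, as \<open>f T\<close> has to
  be tangent to the curve space.\<close>

definition cong_mod_tangent ::
    "(real \<Rightarrow> real) \<Rightarrow> (real \<Rightarrow> real^3) \<Rightarrow> (real \<Rightarrow> real^3) \<Rightarrow> (real \<Rightarrow> real^3) \<Rightarrow> bool" where
  "cong_mod_tangent \<tau> \<gamma> Y X \<longleftrightarrow>
     (\<exists>f :: real \<Rightarrow> real. smooth_on UNIV f \<and> (\<forall>t. f (\<tau> t) = f t) \<and>
        Y = (\<lambda>t. X t + f t *\<^sub>R unit_tangent \<gamma> t))"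


section \<open>Flux functionals\<close>

text \<open>A 1-form on \<open>\<real>\<^sup>3\<close> is a function of the point and the tangent vector.\<close>

definition smooth_one_form :: "(real^3 \<Rightarrow> real^3 \<Rightarrow> real) \<Rightarrow> bool" where
  "smooth_one_form \<alpha> \<longleftrightarrow> (\<forall>p. linear (\<alpha> p)) \<and> (\<forall>X. smooth_on UNIV (\<lambda>p. \<alpha> p X))"

definition exterior_deriv :: "(real^3 \<Rightarrow> real^3 \<Rightarrow> real) \<Rightarrow> real^3 \<Rightarrow> real^3 \<Rightarrow> real^3 \<Rightarrow> real" where
  "exterior_deriv \<alpha> p X Y =
     frechet_derivative (\<lambda>q. \<alpha> q Y) (at p) X - frechet_derivative (\<lambda>q. \<alpha> q X) (at p) Y"

definition invariant_primitive ::
    "real^3^3 \<Rightarrow> real^3 \<Rightarrow> (real^3 \<Rightarrow> real^3) \<Rightarrow> (real^3 \<Rightarrow> real^3 \<Rightarrow> real) \<Rightarrow> bool" where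
  "invariant_primitive A a V \<alpha> \<longleftrightarrow>
     smooth_one_form \<alpha> \<and>
     (\<forall>p X. \<alpha> (A *v p + a) (A *v X) = \<alpha> p X) \<and>
     (\<forall>p X Y. exterior_deriv \<alpha> p X Y = det (vector [V p, X, Y] :: real^3^3))"

definition flux_functional ::
    "real set \<Rightarrow> (real^3 \<Rightarrow> real^3 \<Rightarrow> real) \<Rightarrow> (real \<Rightarrow> real^3) \<Rightarrow> real" where
  "flux_functional I \<alpha> \<gamma> = integral I (\<lambda>t. \<alpha> (\<gamma> t) (vector_derivative \<gamma> (at t)))"


section \<open>The volume functional\<close>

text \<open>The exterior derivative of the following form is
  \<open>- det (v \<times> p, \<cdot>, \<cdot>)\<close>.  For \<open>v = e\<^sub>3\<close> the form is \<open>\<alpha> = (x\<^sup>2 + y\<^sup>2) dz / 2\<close>, with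
  \<open>d\<alpha> = x dx \<and> dz + y dy \<and> dz\<close>, and the vector field is \<open>V = (-y, x, 0)\<close>, with
  \<open>i\<^sub>V det = x dz \<and> dx - y dy \<and> dz\<close>.  Hence the negative of this form is a primitive of
  \<open>i\<^sub>V det\<close>.\<close>

definition rotation_form :: "real^3 \<Rightarrow> real^3 \<Rightarrow> real^3 \<Rightarrow> real" where
  "rotation_form v p X = 1/2 * (norm (p - (p \<bullet> v) *\<^sub>R v))\<^sup>2 * (v \<bullet> X)"

definition volume_vector :: "real set \<Rightarrow> real^3 \<Rightarrow> (real \<Rightarrow> real^3) \<Rightarrow> real^3" where
  "volume_vector I v \<gamma> =
     (1/2) *\<^sub>R integral I (\<lambda>t. (norm (\<gamma> t - (\<gamma> t \<bullet> v) *\<^sub>R v))\<^sup>2 *\<^sub>R vector_derivative \<gamma> (at t))"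

definition volume_functional :: "real set \<Rightarrow> real^3 \<Rightarrow> (real \<Rightarrow> real^3) \<Rightarrow> real" where
  "volume_functional I v \<gamma> =
     1/2 * integral I (\<lambda>t. ((norm (\<gamma> t - (\<gamma> t \<bullet> v) *\<^sub>R v))\<^sup>2 *\<^sub>R vector_derivative \<gamma> (at t)) \<bullet> v)"

text \<open>For a unit vector \<open>v\<close>, the fibres of \<open>meridian v\<close> are the orbits of the rotations around the axis
  \<open>\<real>v\<close>: the real part is the distance from the axis, the imaginary part the height.\<close>

definition meridian :: "real^3 \<Rightarrow> real^3 \<Rightarrow> complex" where
  "meridian v p = Complex (norm (p - (p \<bullet> v) *\<^sub>R v)) (p \<bullet> v)"

text \<open>A curve, closed up by \<open>\<tau>\<close>, sweeps out an embedded torus when rotated around \<open>\<real>v\<close>.\<close>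

definition sweeps_torus :: "(real \<Rightarrow> real) \<Rightarrow> real^3 \<Rightarrow> (real \<Rightarrow> real^3) \<Rightarrow> bool" where
  "sweeps_torus \<tau> v \<gamma> \<longleftrightarrow>
     (\<forall>t. 0 < Re (meridian v (\<gamma> t))) \<and>
     (\<forall>s t. meridian v (\<gamma> s) = meridian v (\<gamma> t) \<longrightarrow> same_orbit \<tau> s t)"

definition solid_of_revolution :: "real^3 \<Rightarrow> (real \<Rightarrow> real^3) \<Rightarrow> (real^3) set" where
  "solid_of_revolution v \<gamma> =
     {p. meridian v p \<in> range (meridian v \<circ> \<gamma>) \<union> inside (range (meridian v \<circ> \<gamma>))}"

end

theory Submission
  imports Defs "HOL-Complex_Analysis.Winding_Numbers"
begin

text \<open>At \<open>p = 0\<close> the commutation of \<open>A\<close> with \<open>V(p) = v \<times> p\<close> says that \<open>a\<close> is parallel to \<open>v\<close>, and then it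
excludes \<open>A v = - v\<close>.  So \<open>h\<close> is a screw motion along \<open>\<real>v\<close>.  It preserves \<open>v\<close> and the distance
\<open>\<rho>(p)\<^sup>2 = |p|\<^sup>2 - (p, v)\<^sup>2\<close> from the axis, hence also the form \<open>\<rho>\<^sup>2 (v, dp) / 2\<close>.  Its exterior derivative is
\<open>- i\<^sub>V det\<close>, so the primitive of \<open>i\<^sub>V det\<close> is the negative of this form, and all signs below follow.

\<^emph>\<open>Gradients.\<close>  Along a variation with velocity \<open>\<xi>\<close>, one differentiates \<open>\<integral> \<rho>\<^sup>2 (\<gamma>', v) / 2\<close> under the
integral, exchanges the partial derivatives and integrates the term with \<open>\<xi>'\<close> by parts.  The boundary
terms cancel because \<open>\<rho>\<^sup>2 (\<xi>, v)\<close> is \<open>\<tau>\<close>-invariant, and \<open>- \<integral> (\<gamma>' \<times> (v \<times> \<gamma>), \<xi>)\<close> is left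
(\<open>first_variation_volume\<close>).  Conversely every tangent field \<open>\<xi>\<close> is the velocity of the variation
\<open>\<gamma> + s \<xi>\<close>, whose curves are immersed for small \<open>s\<close> because \<open>|\<xi>'| / |\<gamma>'|\<close> is \<open>\<tau>\<close>-invariant and hence bounded.
So the differential determines the gradient (\<open>variational_gradient_iff\<close>).  Since
\<open>\<sigma>(Y, -) = \<langle>T \<times> Y, -\<rangle>\<close>, a symplectic gradient is determined up to the kernel of \<open>T \<times> -\<close>, which
consists of the multiples of \<open>T\<close> (\<open>symplectic_gradient_iff\<close>).

\<^emph>\<open>Volume.\<close>  The meridian map pushes the Lebesgue measure of \<open>\<real>\<^sup>3\<close> forward to \<open>2 \<pi> x dx dy\<close> on the half
plane \<open>x > 0\<close> (\<open>emeasure_meridian_vimage\<close>).  So the volume of the solid is \<open>2 \<pi> \<integral> x dx dy\<close> over the region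
enclosed by the meridian curve \<open>m\<close>, and what is needed is Green's formula for the primitive \<open>x\<^sup>2 dy / 2\<close> of
\<open>x dx dy\<close>.  The curve \<open>m\<close> is simple and closed but may fail to be immersed.  Therefore the proof does not
describe the region near its boundary: by the Jordan curve theorem its indicator is almost everywhere
plus or minus the winding number, that is, a Cauchy integral over \<open>m\<close>.  Fubini's theorem then
reduces the area integral to the integral along \<open>m\<close> of the Cauchy transform of \<open>x\<close> over a large disc.
This transform is \<open>\<pi> x\<^sup>2\<close> minus a polynomial in \<open>x + \<i> y\<close> (\<open>Cauchy_transform_Re\<close>), and the integral of the
polynomial along a closed curve vanishes (\<open>weighted_area_of_winding_number\<close>).\<close>

section \<open>Smooth maps\<close>

lemma higher_differentiable_on_cong:
  assumes "open S" "\<And>x. x \<in> S \<Longrightarrow> f x = g x" "higher_differentiable_on S f n"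
  shows "higher_differentiable_on S g n"
  using assms(2,3)
proof (induction n arbitrary: f g)
  case 0
  then show ?case by (simp cong: continuous_on_cong)
next
  case (Suc n)
  have g: "(g has_derivative frechet_derivative f (at x)) (at x)" if "x \<in> S" for x
  proof (rule has_derivative_transform_within_open[OF _ assms(1) that Suc.prems(1)])
    show "(f has_derivative frechet_derivative f (at x)) (at x)"
      using Suc.prems(2) that frechet_derivative_works[of f "at x"] by simp
  qed
  have "higher_differentiable_on S (\<lambda>x. frechet_derivative g (at x) h) n" for h
  proof (rule Suc.IH)
    show "higher_differentiable_on S (\<lambda>x. frechet_derivative f (at x) h) n"
      using Suc.prems(2) by simp
    show "frechet_derivative f (at x) h = frechet_derivative g (at x) h" if "x \<in> S" for x
      by (rule fun_cong[OF frechet_derivative_at[OF g[OF that]]])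
  qed
  then show ?case using g by (auto simp: differentiable_def)
qed

text \<open>In the recursive definition the derivative appears as \<open>frechet_derivative\<close>.  This rule accepts any
explicit formula for it, which makes the closure properties below inductions on the order.\<close>
lemma higher_differentiable_on_SucI:
  assumes "open S" and D: "\<And>x. x \<in> S \<Longrightarrow> (f has_derivative f' x) (at x)"
    and "\<And>h. higher_differentiable_on S (\<lambda>x. f' x h) n"
  shows "higher_differentiable_on S f (Suc n)"
proof -
  have "higher_differentiable_on S (\<lambda>x. frechet_derivative f (at x) h) n" for h
  proof (rule higher_differentiable_on_cong[OF assms(1) _ assms(3)])
    show "f' x h = frechet_derivative f (at x) h" if "x \<in> S" for x
      by (rule fun_cong[OF frechet_derivative_at[OF D[OF that]]])
  qed
  then show ?thesis using D by (auto simp: differentiable_def)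
qed

lemma higher_differentiable_on_SucD:
  assumes "higher_differentiable_on S f (Suc n)"
  shows "\<And>x. x \<in> S \<Longrightarrow> (f has_derivative frechet_derivative f (at x)) (at x)"
    and "\<And>h. higher_differentiable_on S (\<lambda>x. frechet_derivative f (at x) h) n"
  using assms by (auto simp: frechet_derivative_works)

lemma higher_differentiable_on_Suc_imp:
  "higher_differentiable_on S f (Suc n) \<Longrightarrow> higher_differentiable_on S f n"
proof (induction n arbitrary: f)
  case 0
  then show ?case
    by (auto intro!: continuous_at_imp_continuous_on differentiable_imp_continuous_within)
next
  case (Suc n)
  then show ?case by auto
qed

lemma higher_differentiable_on_const:
  "higher_differentiable_on S (\<lambda>x. c) n"
  by (induction n arbitrary: c) auto

lemma higher_differentiable_on_bounded_linear:
  assumes "bounded_linear L" "open S" "higher_differentiable_on S f n"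
  shows "higher_differentiable_on S (\<lambda>x. L (f x)) n"
  using assms(3)
proof (induction n arbitrary: f)
  case 0
  then show ?case using assms(1) by (auto intro: bounded_linear.continuous_on)
next
  case (Suc n)
  note D = higher_differentiable_on_SucD[OF Suc.prems]
  show ?case
    using D Suc.IH
    by (intro higher_differentiable_on_SucI[OF assms(2)
         bounded_linear.has_derivative[OF assms(1)]]) auto
qed

lemma higher_differentiable_on_add:
  assumes "open S" "higher_differentiable_on S f n" "higher_differentiable_on S g n"
  shows "higher_differentiable_on S (\<lambda>x. f x + g x) n"
  using assms(2,3)
proof (induction n arbitrary: f g)
  case 0
  then show ?case by (auto intro: continuous_on_add)
next
  case (Suc n)
  note D = higher_differentiable_on_SucD[OF Suc.prems(1)] higher_differentiable_on_SucD[OF Suc.prems(2)]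
  show ?case
    using D Suc.IH by (intro higher_differentiable_on_SucI[OF assms(1) has_derivative_add]) auto
qed

lemma higher_differentiable_on_bounded_bilinear:
  assumes "bounded_bilinear B" "open S" "higher_differentiable_on S f n" "higher_differentiable_on S g n"
  shows "higher_differentiable_on S (\<lambda>x. B (f x) (g x)) n"
  using assms(3,4)
proof (induction n arbitrary: f g)
  case 0
  then show ?case using assms(1) by (auto intro: bounded_bilinear.continuous_on)
next
  case (Suc n)
  note D = higher_differentiable_on_SucD[OF Suc.prems(1)] higher_differentiable_on_SucD[OF Suc.prems(2)]
  show ?case
    using D Suc.IH Suc.prems[THEN higher_differentiable_on_Suc_imp]
    by (intro higher_differentiable_on_SucI[OF assms(2) bounded_bilinear.FDERIV[OF assms(1)]]
         higher_differentiable_on_add assms(2)) auto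
qed

text \<open>The derivative of \<open>1 / f\<close> is a polynomial in \<open>f'\<close> and \<open>1 / f\<close> itself, so the induction hypothesis covers it.
The same works for the square root, whose derivative involves \<open>1 / \<surd>f\<close>.\<close>
lemma higher_differentiable_on_inverse:
  fixes f :: "'a::real_normed_vector \<Rightarrow> real"
  assumes "open S" "higher_differentiable_on S f n" "\<And>x. x \<in> S \<Longrightarrow> f x \<noteq> 0"
  shows "higher_differentiable_on S (\<lambda>x. inverse (f x)) n"
  using assms(2)
proof (induction n)
  case 0
  then show ?case using assms(3) by (auto intro: continuous_on_inverse)
next
  case (Suc n)
  note D = higher_differentiable_on_SucD[OF Suc.prems]
  have IH: "higher_differentiable_on S (\<lambda>x. inverse (f x)) n"
    by (rule Suc.IH[OF higher_differentiable_on_Suc_imp[OF Suc.prems]])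
  show ?case
  proof (rule higher_differentiable_on_SucI[OF assms(1)])
    show "((\<lambda>x. inverse (f x)) has_derivative
       (\<lambda>h. (-1) *\<^sub>R (inverse (f x) * frechet_derivative f (at x) h * inverse (f x)))) (at x)" if "x \<in> S" for x
      using Deriv.has_derivative_inverse[OF assms(3)[OF that] D(1)[OF that]] by simp
  qed (intro higher_differentiable_on_bounded_linear[OF bounded_linear_scaleR_right]
         higher_differentiable_on_bounded_bilinear[OF bounded_bilinear_mult] assms(1) D(2) IH)
qed

lemma higher_differentiable_on_sqrt:
  fixes f :: "'a::real_normed_vector \<Rightarrow> real"
  assumes "open S" "higher_differentiable_on S f n" "\<And>x. x \<in> S \<Longrightarrow> 0 < f x"
  shows "higher_differentiable_on S (\<lambda>x. sqrt (f x)) n"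
  using assms(2)
proof (induction n)
  case 0
  then show ?case by (auto intro: continuous_on_real_sqrt)
next
  case (Suc n)
  note D = higher_differentiable_on_SucD[OF Suc.prems]
  have IH: "higher_differentiable_on S (\<lambda>x. inverse (sqrt (f x))) n"
    using assms(3) by (intro higher_differentiable_on_inverse assms(1)
      Suc.IH[OF higher_differentiable_on_Suc_imp[OF Suc.prems]]) force
  show ?case
  proof (rule higher_differentiable_on_SucI[OF assms(1)])
    show "((\<lambda>x. sqrt (f x)) has_derivative
       (\<lambda>h. (1/2) *\<^sub>R (frechet_derivative f (at x) h * inverse (sqrt (f x))))) (at x)" if "x \<in> S" for x
      using has_derivative_real_sqrt[OF assms(3)[OF that] D(1)[OF that]]
      by (simp add: field_simps)
  qed (intro higher_differentiable_on_bounded_linear[OF bounded_linear_scaleR_right]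
         higher_differentiable_on_bounded_bilinear[OF bounded_bilinear_mult] assms(1) D(2) IH)
qed

lemma higher_differentiable_on_compose_linear:
  assumes L: "bounded_linear L" "open S" "open T" "L ` S \<subseteq> T" and f: "higher_differentiable_on T f n"
  shows "higher_differentiable_on S (\<lambda>x. f (L x)) n"
  using f
proof (induction n arbitrary: f)
  case 0
  then show ?case using L
    by (auto intro: continuous_on_compose2[where g=f] linear_continuous_on)
next
  case (Suc n)
  note D = higher_differentiable_on_SucD[OF Suc.prems]
  show ?case
  proof (rule higher_differentiable_on_SucI[OF \<open>open S\<close>])
    show "((\<lambda>x. f (L x)) has_derivative (\<lambda>h. frechet_derivative f (at (L x)) (L h))) (at x)"
      if "x \<in> S" for x
      using that L by (intro has_derivative_compose[OF bounded_linear_imp_has_derivative[OF L(1)] D(1)]) auto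
  qed (rule Suc.IH[OF D(2)])
qed

lemma smooth_on_cong:
  "open S \<Longrightarrow> (\<And>x. x \<in> S \<Longrightarrow> f x = g x) \<Longrightarrow> smooth_on S f \<Longrightarrow> smooth_on S g"
  unfolding smooth_on_def by (blast intro: higher_differentiable_on_cong)

lemma smooth_on_const: "smooth_on S (\<lambda>x. c)"
  unfolding smooth_on_def by (blast intro: higher_differentiable_on_const)

lemma smooth_on_bounded_linear:
  "bounded_linear L \<Longrightarrow> open S \<Longrightarrow> smooth_on S f \<Longrightarrow> smooth_on S (\<lambda>x. L (f x))"
  unfolding smooth_on_def by (blast intro: higher_differentiable_on_bounded_linear)

lemma smooth_on_add:
  "open S \<Longrightarrow> smooth_on S f \<Longrightarrow> smooth_on S g \<Longrightarrow> smooth_on S (\<lambda>x. f x + g x)"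
  unfolding smooth_on_def by (blast intro: higher_differentiable_on_add)

lemma smooth_on_bounded_bilinear:
  "bounded_bilinear B \<Longrightarrow> open S \<Longrightarrow> smooth_on S f \<Longrightarrow> smooth_on S g \<Longrightarrow> smooth_on S (\<lambda>x. B (f x) (g x))"
  unfolding smooth_on_def by (blast intro: higher_differentiable_on_bounded_bilinear)

lemma smooth_on_inverse:
  fixes f :: "'a::real_normed_vector \<Rightarrow> real"
  shows "open S \<Longrightarrow> smooth_on S f \<Longrightarrow> (\<And>x. x \<in> S \<Longrightarrow> f x \<noteq> 0) \<Longrightarrow> smooth_on S (\<lambda>x. inverse (f x))"
  unfolding smooth_on_def by (blast intro: higher_differentiable_on_inverse)

lemma smooth_on_sqrt:
  fixes f :: "'a::real_normed_vector \<Rightarrow> real"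
  shows "open S \<Longrightarrow> smooth_on S f \<Longrightarrow> (\<And>x. x \<in> S \<Longrightarrow> 0 < f x) \<Longrightarrow> smooth_on S (\<lambda>x. sqrt (f x))"
  unfolding smooth_on_def by (blast intro: higher_differentiable_on_sqrt)

lemma smooth_on_compose_linear:
  "bounded_linear L \<Longrightarrow> open S \<Longrightarrow> open T \<Longrightarrow> L ` S \<subseteq> T \<Longrightarrow> smooth_on T f \<Longrightarrow> smooth_on S (\<lambda>x. f (L x))"
  unfolding smooth_on_def by (blast intro: higher_differentiable_on_compose_linear)

lemma smooth_on_linear: "bounded_linear L \<Longrightarrow> smooth_on UNIV L"
  unfolding smooth_on_def
proof
  fix n assume L: "bounded_linear L"
  show "higher_differentiable_on UNIV L n"
  proof (cases n)
    case 0
    then show ?thesis using L by (simp add: linear_continuous_on)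
  next
    case (Suc m)
    then show ?thesis
      using higher_differentiable_on_SucI[OF open_UNIV bounded_linear_imp_has_derivative[OF L]]
      by (simp add: higher_differentiable_on_const)
  qed
qed

lemma smooth_on_minus: "open S \<Longrightarrow> smooth_on S f \<Longrightarrow> smooth_on S (\<lambda>x. - f x)"
  by (rule smooth_on_bounded_linear[OF bounded_linear_minus[OF bounded_linear_ident]])

lemma smooth_on_diff:
  "open S \<Longrightarrow> smooth_on S f \<Longrightarrow> smooth_on S g \<Longrightarrow> smooth_on S (\<lambda>x. f x - g x)"
  using smooth_on_add[OF _ _ smooth_on_minus, of S f g] by simp

lemmas smooth_on_scaleR = smooth_on_bounded_bilinear[OF bounded_bilinear_scaleR]
lemmas smooth_on_mult = smooth_on_bounded_bilinear[OF bounded_bilinear_mult]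
lemmas smooth_on_inner = smooth_on_bounded_bilinear[OF bounded_bilinear_inner]
lemmas smooth_on_cross = smooth_on_bounded_bilinear[OF
  bilinear_conv_bounded_bilinear[THEN iffD1, OF bilinear_cross]]

lemma smooth_on_has_derivative:
  "smooth_on S f \<Longrightarrow> x \<in> S \<Longrightarrow> (f has_derivative frechet_derivative f (at x)) (at x)"
  unfolding smooth_on_def using higher_differentiable_on_SucD(1)[of S f 0 x] by blast

lemma smooth_on_frechet_derivative:
  "smooth_on S f \<Longrightarrow> smooth_on S (\<lambda>x. frechet_derivative f (at x) h)"
  unfolding smooth_on_def using higher_differentiable_on_SucD(2)[of S f] by blast

lemma smooth_on_continuous_on: "smooth_on S f \<Longrightarrow> continuous_on S f"
  unfolding smooth_on_def by (metis higher_differentiable_on.simps(1))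

lemma smooth_on_has_vector_derivative:
  fixes f :: "real \<Rightarrow> 'b::real_normed_vector"
  shows "smooth_on S f \<Longrightarrow> x \<in> S \<Longrightarrow> (f has_vector_derivative vector_derivative f (at x)) (at x)"
  using smooth_on_has_derivative differentiableI vector_derivative_works by blast

lemma smooth_on_vector_derivative:
  fixes f :: "real \<Rightarrow> 'b::real_normed_vector"
  assumes "open S" "smooth_on S f"
  shows "smooth_on S (\<lambda>x. vector_derivative f (at x))"
proof (rule smooth_on_cong[OF \<open>open S\<close> _ smooth_on_frechet_derivative[OF assms(2), of 1]])
  fix x assume "x \<in> S"
  have "(f has_derivative (\<lambda>h. h *\<^sub>R vector_derivative f (at x))) (at x)"
    using smooth_on_has_vector_derivative[OF assms(2) \<open>x \<in> S\<close>] by (simp add: has_vector_derivative_def)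
  from frechet_derivative_at[OF this, symmetric]
  show "frechet_derivative f (at x) 1 = vector_derivative f (at x)" by simp
qed

section \<open>Fundamental domains of a translation\<close>

lemma diffeomorphism_has_nonzero_derivative:
  assumes "diffeomorphism \<phi>"
  obtains d where "(\<phi> has_real_derivative d) (at t)" "d \<noteq> 0"
proof -
  have D: "\<exists>d. (f has_real_derivative d) (at x)" if "smooth_on UNIV f" for f x
    using smooth_on_has_vector_derivative[OF that]
    by (auto simp: has_real_derivative_iff_has_vector_derivative)
  obtain d e where d: "(\<phi> has_real_derivative d) (at t)"
    and e: "(inv \<phi> has_real_derivative e) (at (\<phi> t))"
    using D assms unfolding diffeomorphism_def by meson
  have "((\<lambda>x. inv \<phi> (\<phi> x)) has_real_derivative e * d) (at t)"
    by (rule DERIV_chain2[OF e d])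
  moreover have "(\<lambda>x. inv \<phi> (\<phi> x)) = (\<lambda>x. x)"
    using assms by (auto simp: diffeomorphism_def bij_def inv_f_f)
  ultimately have "e * d = 1" using DERIV_unique[OF _ DERIV_ident] by metis
  then have "d \<noteq> 0" by auto
  with d show ?thesis by (rule that)
qed

lemma diffeomorphism_continuous_on:
  "diffeomorphism \<phi> \<Longrightarrow> continuous_on S \<phi>" "diffeomorphism \<phi> \<Longrightarrow> continuous_on S (inv \<phi>)"
  unfolding diffeomorphism_def using smooth_on_continuous_on continuous_on_subset by blast+

lemma diffeomorphism_monotone:
  assumes "diffeomorphism \<phi>"
  shows "strict_mono \<phi> \<or> strict_antimono_on UNIV \<phi>"
  using injective_eq_monotone_map[of UNIV \<phi>] diffeomorphism_continuous_on[OF assms] assms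
  by (simp add: diffeomorphism_def bij_def)

text \<open>The coordinate \<open>\<phi>\<close> may reverse the orientation, but then it does so twice in \<open>\<tau> = \<phi>\<^sup>-\<^sup>1 \<circ> (\<phi> + 1)\<close>.
Positivity is what makes the unit tangent of a curve, and not only its tangent line, equivariant.\<close>
lemma translation_has_pos_derivative:
  assumes "translation \<tau>"
  obtains d where "(\<tau> has_real_derivative d) (at t)" "d > 0"
proof -
  obtain \<phi> where \<phi>: "diffeomorphism \<phi>" "\<And>t. \<phi> (\<tau> t) = \<phi> t + 1"
    using assms by (auto simp: translation_def)
  have bij: "bij \<phi>" using \<phi> by (simp add: diffeomorphism_def)
  have \<tau>: "\<tau> = (\<lambda>t. inv \<phi> (\<phi> t + 1))"
    using bij \<phi>(2) by (metis bij_def inv_f_f)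
  have mono: "strict_mono \<tau>"
    using diffeomorphism_monotone[OF \<phi>(1)]
  proof
    assume m: "strict_mono \<phi>"
    show ?thesis
    proof (rule strict_monoI)
      fix x y :: real assume "x < y"
      then have "\<phi> (\<tau> x) < \<phi> (\<tau> y)" using m \<phi>(2) by (simp add: strict_mono_less)
      then show "\<tau> x < \<tau> y" using m by (simp add: strict_mono_less)
    qed
  next
    assume m: "strict_antimono_on UNIV \<phi>"
    have less: "\<phi> x < \<phi> y \<longleftrightarrow> y < x" for x y
      using m unfolding monotone_on_def by (metis UNIV_I linorder_less_linear order_less_asym)
    show ?thesis
    proof (rule strict_monoI)
      fix x y :: real assume "x < y"
      then have "\<phi> (\<tau> y) < \<phi> (\<tau> x)" using \<phi>(2) less by simp
      then show "\<tau> x < \<tau> y" using less by simp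
    qed
  qed
  have "smooth_on UNIV (inv \<phi>)" using \<phi>(1) by (simp add: diffeomorphism_def)
  then obtain e where e: "(inv \<phi> has_real_derivative e) (at (\<phi> t + 1))"
    using smooth_on_has_vector_derivative
    by (metis UNIV_I has_real_derivative_iff_has_vector_derivative)
  obtain c where c: "(\<phi> has_real_derivative c) (at t)" "c \<noteq> 0"
    using diffeomorphism_has_nonzero_derivative[OF \<phi>(1)] .
  have "((\<lambda>t. \<phi> t + 1) has_real_derivative c) (at t)"
    using c(1) by (auto intro!: derivative_eq_intros)
  then have d: "(\<tau> has_real_derivative e * c) (at t)"
    unfolding \<tau> by (rule DERIV_chain2[of "inv \<phi>" e "\<lambda>t. \<phi> t + 1" t, OF e])
  obtain f where f: "(\<phi> has_real_derivative f) (at (\<tau> t))"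
    using diffeomorphism_has_nonzero_derivative[OF \<phi>(1)] .
  have "((\<lambda>t. \<phi> (\<tau> t)) has_real_derivative f * (e * c)) (at t)"
    by (rule DERIV_chain2[OF f d])
  then have "((\<lambda>t. \<phi> t + 1) has_real_derivative f * (e * c)) (at t)"
    using \<phi>(2) by simp
  with \<open>((\<lambda>t. \<phi> t + 1) has_real_derivative c) (at t)\<close> have "f * (e * c) = c"
    by (rule DERIV_unique[rotated])
  then have "e * c \<noteq> 0" using c(2) by auto
  moreover have "0 \<le> e * c"
    using mono_on_imp_deriv_nonneg[of UNIV \<tau> "e * c" t] d mono
    by (simp add: strict_mono_mono)
  ultimately have "0 < e * c" by linarith
  with d show ?thesis by (rule that)
qed

lemma translation_funpow:
  assumes "\<And>t. \<phi> (\<tau> t) = \<phi> t + (1::real)"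
  shows "\<phi> ((\<tau> ^^ n) t) = \<phi> t + n"
  by (induction n) (auto simp: assms)

lemma same_orbit_coordinate:
  assumes "\<And>t. \<phi> (\<tau> t) = \<phi> t + (1::real)" "same_orbit \<tau> s t"
  shows "\<phi> t - \<phi> s \<in> \<int>"
  using assms(2) translation_funpow[of \<phi> \<tau>, OF assms(1)] by (auto simp: same_orbit_def)

lemma Ints_abs_less_1_eq_0: "(x::real) \<in> \<int> \<Longrightarrow> \<bar>x\<bar> < 1 \<Longrightarrow> x = 0"
  by (auto elim!: Ints_cases)

text \<open>In the coordinate \<open>\<phi>\<close> the set \<open>I\<close> becomes an interval \<open>J\<close>.  Disjointness of the translates of the
interior bounds the length of \<open>J\<close> by 1, and since the translates cover the line, the length is at least 1.
When \<open>\<tau>\<close> moves points to the left, the roles of the two ends are exchanged.\<close>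
lemma fundamental_domain_interval:
  assumes "translation \<tau>" "fundamental_domain \<tau> I"
  obtains lo hi where "lo < hi" "hi = \<tau> lo \<or> lo = \<tau> hi" "{lo<..<hi} \<subseteq> I" "I \<subseteq> {lo..hi}"
    "\<And>s t. s \<in> {lo..<hi} \<Longrightarrow> t \<in> {lo..<hi} \<Longrightarrow> same_orbit \<tau> s t \<Longrightarrow> s = t"
proof -
  obtain \<phi> where \<phi>: "diffeomorphism \<phi>" "\<And>t. \<phi> (\<tau> t) = \<phi> t + 1"
    using assms by (auto simp: translation_def)
  have bij: "bij \<phi>" using \<phi> by (simp add: diffeomorphism_def)
  have inv [simp]: "inv \<phi> (\<phi> x) = x" "\<phi> (inv \<phi> x) = x" for x
    using bij by (auto simp: bij_def inv_f_f surj_f_inv_f)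
  have I: "is_interval I" "\<And>t. \<exists>s\<in>I. same_orbit \<tau> s t"
    "\<And>n. n > 0 \<Longrightarrow> interior I \<inter> (\<tau> ^^ n) ` interior I = {}"
    using assms(2) by (auto simp: fundamental_domain_def)
  define J where "J = \<phi> ` I"
  have J_iff: "x \<in> J \<longleftrightarrow> inv \<phi> x \<in> I" for x
    unfolding J_def by (metis imageE image_eqI inv)
  have J: "is_interval J"
    unfolding J_def using I(1) diffeomorphism_continuous_on(1)[OF \<phi>(1)]
    by (simp add: is_interval_connected_1 connected_continuous_image)
  have sub: "{x<..<y} \<subseteq> J" if "x \<in> J" "y \<in> J" for x y
    using J that unfolding is_interval_1 by (meson greaterThanLessThan_iff less_imp_le subsetI)
  have len: "y \<le> x + 1" if "x \<in> J" "y \<in> J" for x y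
  proof (rule ccontr)
    assume "\<not> y \<le> x + 1"
    (* With this choice both p and p + 1 lie strictly between x and y. *)
    define p where "p = (x + y - 1) / 2"
    have p: "x < p" "p + 1 < y" using \<open>\<not> y \<le> x + 1\<close> by (auto simp: p_def field_simps)
    have "open (\<phi> -` {x<..<y})"
      using diffeomorphism_continuous_on(1)[OF \<phi>(1), of UNIV] by (intro open_vimage) auto
    moreover have "\<phi> -` {x<..<y} \<subseteq> I" using sub[OF that] J_iff by fastforce
    ultimately have int: "\<phi> -` {x<..<y} \<subseteq> interior I" by (rule interior_maximal[rotated])
    have "inv \<phi> p \<in> interior I" "inv \<phi> (p + 1) \<in> interior I"
      using p by (auto intro!: subsetD[OF int])
    moreover have "\<tau> (inv \<phi> p) = inv \<phi> (p + 1)" by (metis \<phi>(2) inv)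
    ultimately have "inv \<phi> (p + 1) \<in> interior I \<inter> \<tau> ` interior I"
      by (metis IntI image_eqI)
    moreover have "interior I \<inter> \<tau> ` interior I = {}" using I(3)[of 1] by simp
    ultimately show False by blast
  qed
  obtain j where j: "j \<in> J" using I(2)[of 0] by (auto simp: J_def)
  have bdd: "bdd_below J" "bdd_above J"
    using len[OF j] len[OF _ j] by (force intro: bdd_belowI[of _ "j - 1"] bdd_aboveI[of _ "j + 1"])+
  define c d where "c = Inf J" and "d = Sup J"
  have J_sub: "J \<subseteq> {c..d}"
    unfolding c_def d_def using bdd by (auto intro: cInf_lower cSup_upper)
  have "x \<in> J" if x: "c < x" "x < d" for x
  proof -
    have "J \<noteq> {}" using j by blast
    then obtain y z where "y \<in> J" "y < x" "z \<in> J" "x < z"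
      using cInf_less_iff[OF \<open>J \<noteq> {}\<close> bdd(1)] less_cSup_iff[OF \<open>J \<noteq> {}\<close> bdd(2)] x
      unfolding c_def d_def by blast
    then show ?thesis using sub[of y z] by auto
  qed
  then have sub_J: "{c<..<d} \<subseteq> J" by auto
  have "d \<le> c + 1"
  proof -
    have "J \<noteq> {}" using j by blast
    have "d - 1 \<le> x" if "x \<in> J" for x
      using cSup_least[OF \<open>J \<noteq> {}\<close> len[OF that]] by (simp add: d_def)
    then have "d - 1 \<le> c" unfolding c_def using j by (intro cInf_greatest) auto
    then show ?thesis by simp
  qed
  moreover have "\<not> d < c + 1"
  proof
    assume less: "d < c + 1"
    (* The midpoint of the gap between J and its translate by 1 belongs to no translate of J. *)
    define x where "x = (d + c + 1) / 2"
    obtain s where s: "s \<in> I" "same_orbit \<tau> s (inv \<phi> x)" using I(2) by blast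
    have "\<phi> s \<in> J" using s by (simp add: J_def)
    then have "\<phi> s \<in> {c..d}" using J_sub by blast
    then have "0 < x - \<phi> s" "x - \<phi> s < 1" using less by (auto simp: x_def field_simps)
    moreover have "x - \<phi> s \<in> \<int>" using same_orbit_coordinate[of \<phi> \<tau>, OF \<phi>(2) s(2)] by simp
    ultimately show False using Ints_abs_less_1_eq_0[of "x - \<phi> s"] by simp
  qed
  ultimately have d: "d = c + 1" by simp
  define p where "p = inv \<phi> c"
  have p: "\<phi> p = c" "\<phi> (\<tau> p) = d" by (auto simp: p_def \<phi>(2) d)
  have orbit: "s = t" if "same_orbit \<tau> s t" "\<bar>\<phi> t - \<phi> s\<bar> < 1" for s t
    using Ints_abs_less_1_eq_0[OF same_orbit_coordinate[of \<phi> \<tau>, OF \<phi>(2) that(1)] that(2)]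
    by (metis eq_iff_diff_eq_0 inv(1))
  show ?thesis
    using diffeomorphism_monotone[OF \<phi>(1)]
  proof
    assume m: "strict_mono \<phi>"
    note less = strict_mono_less[OF m] and le = strict_mono_less_eq[OF m]
    show ?thesis
    proof (rule that[of p "\<tau> p"])
      show "p < \<tau> p" using p d less by (metis less_add_one)
      show "{p<..<\<tau> p} \<subseteq> I"
      proof
        fix x assume "x \<in> {p<..<\<tau> p}"
        then have "\<phi> x \<in> {c<..<d}" using p less by (metis greaterThanLessThan_iff)
        then show "x \<in> I" using sub_J J_iff by fastforce
      qed
      show "I \<subseteq> {p..\<tau> p}"
      proof
        fix x assume "x \<in> I"
        then have "\<phi> x \<in> {c..d}" using J_sub J_def by blast
        then show "x \<in> {p..\<tau> p}" using p le by (metis atLeastAtMost_iff)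
      qed
      fix s t assume "s \<in> {p..<\<tau> p}" "t \<in> {p..<\<tau> p}" "same_orbit \<tau> s t"
      moreover from this have "\<phi> s \<in> {c..<d}" "\<phi> t \<in> {c..<d}"
        using p less le by (metis atLeastLessThan_iff)+
      ultimately show "s = t" using orbit d by (simp add: abs_less_iff)
    qed simp
  next
    assume m: "strict_antimono_on UNIV \<phi>"
    have less: "\<phi> x < \<phi> y \<longleftrightarrow> y < x" for x y
      using m unfolding monotone_on_def by (metis UNIV_I linorder_less_linear order_less_asym)
    then have le: "\<phi> x \<le> \<phi> y \<longleftrightarrow> y \<le> x" for x y by (meson linorder_not_less)
    show ?thesis
    proof (rule that[of "\<tau> p" p])
      show "\<tau> p < p" using p d less by (metis less_add_one)
      show "{\<tau> p<..<p} \<subseteq> I"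
      proof
        fix x assume "x \<in> {\<tau> p<..<p}"
        then have "\<phi> x \<in> {c<..<d}" using p less by (metis greaterThanLessThan_iff)
        then show "x \<in> I" using sub_J J_iff by fastforce
      qed
      show "I \<subseteq> {\<tau> p..p}"
      proof
        fix x assume "x \<in> I"
        then have "\<phi> x \<in> {c..d}" using J_sub J_def by blast
        then show "x \<in> {\<tau> p..p}" using p le by (metis atLeastAtMost_iff)
      qed
      fix s t assume "s \<in> {\<tau> p..<p}" "t \<in> {\<tau> p..<p}" "same_orbit \<tau> s t"
      moreover from this have "\<phi> s \<in> {c<..d}" "\<phi> t \<in> {c<..d}"
        using p less le by (metis atLeastLessThan_iff greaterThanAtMost_iff)+
      ultimately show "s = t" using orbit d by (simp add: abs_less_iff)
    qed simp
  qed
qed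

text \<open>Transports statements from \<open>I\<close>, where compactness is available, to the whole line.\<close>
lemma orbit_invariant_extends:
  assumes "fundamental_domain \<tau> I" "\<And>t. P (\<tau> t) \<longleftrightarrow> P t" "\<And>s. s \<in> I \<Longrightarrow> P s"
  shows "P t"
proof -
  have *: "P ((\<tau> ^^ n) s) \<longleftrightarrow> P s" for n s by (induction n) (auto simp: assms(2))
  obtain s where "s \<in> I" "same_orbit \<tau> s t"
    using assms(1) unfolding fundamental_domain_def by blast
  then show ?thesis using * assms(3) by (auto simp: same_orbit_def)
qed

section \<open>Screw motions along an axis\<close>

text \<open>With \<open>A v = c v\<close>, the hypothesis and the equivariance of the cross product under rotations give
\<open>c (v \<times> w) = v \<times> w\<close> for all \<open>w\<close>.\<close>
lemma commuting_motion_fixes_axis: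
  fixes A :: "real^3^3" and a v :: "real^3"
  assumes "rotation_matrix A" "norm v = 1" "\<exists>c. A *v v = c *\<^sub>R v"
    and comm: "\<And>p. A *v (v \<times> p) = v \<times> (A *v p + a)"
  shows "A *v v = v" "a = (a \<bullet> v) *\<^sub>R v"
proof -
  obtain c where c: "A *v v = c *\<^sub>R v" using assms by blast
  have vv: "v \<bullet> v = 1" using assms(2) by (simp add: dot_square_norm)
  have va: "v \<times> a = 0" using comm[of 0] by simp
  have orth: "transpose A ** A = mat 1" "A ** transpose A = mat 1"
    using assms(1) by (auto simp: rotation_matrix_def orthogonal_matrix_def)
  have "(c - 1) *\<^sub>R (v \<times> w) = 0" for w
  proof -
    obtain u where w: "A *v u = w"
      by (metis matrix_vector_mul_assoc matrix_vector_mul_lid orth(2))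
    have "c *\<^sub>R (v \<times> w) = (A *v v) \<times> (A *v u)"
      by (simp add: c cross_mult_left w)
    also have "\<dots> = A *v (v \<times> u)" by (rule cross_rotation_matrix[OF assms(1)])
    also have "\<dots> = v \<times> w" by (simp add: comm cross_add_right va w)
    finally show ?thesis by (simp add: algebra_simps)
  qed
  moreover obtain w where "w \<noteq> 0" "orthogonal v w"
    using orthogonal_to_vector_exists[of v] by auto
  then have "v \<times> w \<noteq> 0"
    using norm_cross_dot[of v w] assms(2) by (auto simp: orthogonal_def)
  ultimately have "c = 1" by (metis eq_iff_diff_eq_0 scaleR_eq_0_iff)
  then show "A *v v = v" using c by simp
  have "v \<times> (v \<times> a) = 0" using va by simp
  then show "a = (a \<bullet> v) *\<^sub>R v" by (simp add: Lagrange vv inner_commute)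
qed

lemma integral_eq_on_interval:
  fixes f :: "real \<Rightarrow> 'b::banach"
  assumes "{lo<..<hi} \<subseteq> I" "I \<subseteq> {lo..hi}"
  shows "integral I f = integral {lo..hi} f"
proof (rule integral_spike_set)
  have "{x \<in> I - {lo..hi}. f x \<noteq> 0} = {}" using assms(2) by blast
  then show "negligible {x \<in> I - {lo..hi}. f x \<noteq> 0}" by (simp only: negligible_empty)
  have "{x \<in> {lo..hi} - I. f x \<noteq> 0} \<subseteq> {lo, hi}"
    using assms(1) by (auto simp: subset_iff) (metis less_le)
  then show "negligible {x \<in> {lo..hi} - I. f x \<noteq> 0}"
    by (rule negligible_subset[rotated]) (simp add: negligible_finite)
qed

lemma norm_offset_square:
  assumes "norm v = 1"
  shows "(norm (p - (p \<bullet> v) *\<^sub>R v))\<^sup>2 = p \<bullet> p - (p \<bullet> v)\<^sup>2"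
proof -
  have "v \<bullet> v = 1" using assms by (simp add: dot_square_norm)
  then show ?thesis
    unfolding dot_square_norm[symmetric]
    by (simp add: inner_diff_left inner_diff_right inner_commute power2_eq_square algebra_simps)
qed

text \<open>The motion \<open>h\<close> is reduced to its normal form, a screw motion along \<open>\<real>v\<close>.  Integrals over \<open>I\<close> are taken
over \<open>{lo..hi}\<close>; \<open>\<tau>\<close> maps one of its ends to the other, in an unspecified direction.\<close>
locale axial_motion =
  fixes \<tau> :: "real \<Rightarrow> real" and I :: "real set" and A :: "real^3^3" and a v :: "real^3"
    and lo hi :: real
  assumes translation: "translation \<tau>" and fundamental_domain: "fundamental_domain \<tau> I"
    and rotation: "rotation_matrix A" and norm_v: "norm v = 1"
    and A_v: "A *v v = v" and a_axial: "a = (a \<bullet> v) *\<^sub>R v"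
    and lo_less_hi: "lo < hi" and ends: "hi = \<tau> lo \<or> lo = \<tau> hi"
    and inner_interval: "{lo<..<hi} \<subseteq> I" and outer_interval: "I \<subseteq> {lo..hi}"
begin

lemma inner_A [simp]: "(A *v x) \<bullet> (A *v y) = x \<bullet> y"
proof -
  have "orthogonal_transformation ((*v) A)"
    using rotation by (simp add: orthogonal_transformation_matrix rotation_matrix_def)
  then show ?thesis by (simp add: orthogonal_transformation_def)
qed

lemma norm_A [simp]: "norm (A *v x) = norm x"
  by (simp add: norm_eq_sqrt_inner)

lemma A_eq_0_iff [simp]: "A *v x = 0 \<longleftrightarrow> x = 0"
  using norm_A[of x] by (metis norm_eq_zero)

lemma inner_v_A [simp]: "v \<bullet> (A *v x) = v \<bullet> x" "(A *v x) \<bullet> v = x \<bullet> v"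
  using inner_A[of v x] by (simp_all add: A_v inner_commute)

lemma cross_A: "(A *v x) \<times> (A *v y) = A *v (x \<times> y)"
  by (rule cross_rotation_matrix[OF rotation])

lemma cross_v_motion: "v \<times> (A *v p + a) = A *v (v \<times> p)"
proof -
  have "v \<times> a = 0" by (subst a_axial) (simp add: cross_mult_right)
  then show ?thesis using cross_A[of v p] by (simp add: A_v cross_add_right)
qed

lemma integral_I: "integral I f = integral {lo..hi} f" for f :: "real \<Rightarrow> 'b::banach"
  by (rule integral_eq_on_interval[OF inner_interval outer_interval])

lemma offset_motion:
  "(norm (A *v p + a - ((A *v p + a) \<bullet> v) *\<^sub>R v))\<^sup>2 = (norm (p - (p \<bullet> v) *\<^sub>R v))\<^sup>2"
proof -
  have "A *v p + a - ((A *v p + a) \<bullet> v) *\<^sub>R v = A *v p + (a - (a \<bullet> v) *\<^sub>R v) - (p \<bullet> v) *\<^sub>R v"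
    by (simp add: inner_add_left algebra_simps)
  also have "a - (a \<bullet> v) *\<^sub>R v = 0" using a_axial by simp
  also have "A *v p + 0 - (p \<bullet> v) *\<^sub>R v = A *v (p - (p \<bullet> v) *\<^sub>R v)"
    by (simp add: matrix_vector_mult_diff_distrib scaleR_matrix_vector_assoc[symmetric]
       matrix_vector_mult_scaleR A_v)
  finally show ?thesis by simp
qed

lemma rotation_form_eq: "rotation_form v p X = 1/2 * (p \<bullet> p - (p \<bullet> v)\<^sup>2) * (v \<bullet> X)"
  by (simp add: rotation_form_def norm_offset_square[OF norm_v])

lemma rotation_form_has_derivative:
  "((\<lambda>q. - rotation_form v q Y) has_derivative (\<lambda>X. - ((p \<bullet> X - (p \<bullet> v) * (X \<bullet> v)) * (v \<bullet> Y)))) (at p)"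
  unfolding rotation_form_eq power2_eq_square
  by (auto intro!: derivative_eq_intros simp: algebra_simps inner_commute)

text \<open>Both \<open>\<rho>\<^sup>2\<close> and \<open>(v, -)\<close> are invariant under the screw motion.  The exterior derivative comes out as
\<open>(v, X) (p, Y) - (v, Y) (p, X)\<close>, which is \<open>(v \<times> p, X \<times> Y)\<close> by Lagrange's identity.\<close>
lemma invariant_primitive_rotation_form:
  "invariant_primitive A a (\<lambda>p. v \<times> p) (\<lambda>p X. - rotation_form v p X)"
  unfolding invariant_primitive_def
proof (intro conjI allI)
  show "smooth_one_form (\<lambda>p X. - rotation_form v p X)"
    unfolding smooth_one_form_def
  proof (intro conjI allI)
    show "linear (\<lambda>X. - rotation_form v p X)" for p
      by (auto simp: rotation_form_def algebra_simps inner_add_right intro!: linearI)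
    have id: "smooth_on UNIV (\<lambda>p::real^3. p)" by (rule smooth_on_linear[OF bounded_linear_ident])
    have pv: "smooth_on UNIV (\<lambda>p. p \<bullet> v)" by (rule smooth_on_linear[OF bounded_linear_inner_left])
    show "smooth_on UNIV (\<lambda>p. - rotation_form v p X)" for X
      unfolding rotation_form_eq power2_eq_square
      by (intro smooth_on_minus smooth_on_mult smooth_on_diff smooth_on_inner smooth_on_const open_UNIV id pv)
  qed
  show "- rotation_form v (A *v p + a) (A *v X) = - rotation_form v p X" for p X
    by (simp add: rotation_form_def offset_motion)
  fix p X Y
  have fd: "frechet_derivative (\<lambda>q. - rotation_form v q Y) (at p) =
     (\<lambda>X. - ((p \<bullet> X - (p \<bullet> v) * (X \<bullet> v)) * (v \<bullet> Y)))" for Y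
    by (rule frechet_derivative_at[OF rotation_form_has_derivative, symmetric])
  have "exterior_deriv (\<lambda>p X. - rotation_form v p X) p X Y =
     (v \<bullet> X) * (p \<bullet> Y) - (v \<bullet> Y) * (p \<bullet> X)"
    by (simp add: exterior_deriv_def fd algebra_simps inner_commute)
  also have "\<dots> = (v \<times> p) \<bullet> (X \<times> Y)"
    by (simp add: cross3_simps)
  finally show "exterior_deriv (\<lambda>p X. - rotation_form v p X) p X Y = det (vector [v \<times> p, X, Y] :: real^3^3)"
    by (simp add: dot_cross_det)
qed

lemma flux_eq_volume_functional: "flux_functional I (rotation_form v) \<gamma> = volume_functional I v \<gamma>"
  unfolding flux_functional_def rotation_form_def volume_functional_def
  by (simp add: inner_commute mult.assoc flip: integral_mult_right)

lemma flux_uminus_eq_volume_functional: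
  "flux_functional I (\<lambda>p X. - rotation_form v p X) \<gamma> = - volume_functional I v \<gamma>"
  using flux_eq_volume_functional[of \<gamma>] by (simp add: flux_functional_def)

lemma curve_smooth: "\<gamma> \<in> curve_space \<tau> A a \<Longrightarrow> smooth_on UNIV \<gamma>"
  and curve_motion: "\<gamma> \<in> curve_space \<tau> A a \<Longrightarrow> \<gamma> (\<tau> t) = A *v \<gamma> t + a"
  and curve_immersed: "\<gamma> \<in> curve_space \<tau> A a \<Longrightarrow> vector_derivative \<gamma> (at t) \<noteq> 0"
  by (auto simp: curve_space_def)

lemma tangent_smooth: "\<xi> \<in> tangent_space \<tau> A \<Longrightarrow> smooth_on UNIV \<xi>"
  and tangent_motion: "\<xi> \<in> tangent_space \<tau> A \<Longrightarrow> \<xi> (\<tau> t) = A *v \<xi> t"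
  by (auto simp: tangent_space_def)

lemma smooth_has_vector_derivative: "smooth_on UNIV f \<Longrightarrow> (f has_vector_derivative vector_derivative f (at t)) (at t)"
  for f :: "real \<Rightarrow> 'b::real_normed_vector"
  by (rule smooth_on_has_vector_derivative) auto

lemma smooth_continuous_derivative:
  "smooth_on UNIV f \<Longrightarrow> continuous_on S f"
  "smooth_on UNIV f \<Longrightarrow> continuous_on S (\<lambda>t. vector_derivative f (at t))"
  for f :: "real \<Rightarrow> 'b::real_normed_vector"
  using smooth_on_continuous_on[of UNIV f] smooth_on_continuous_on[OF smooth_on_vector_derivative[OF open_UNIV], of f]
    continuous_on_subset[OF _ subset_UNIV] by blast+

lemma volume_functional_eq_volume_vector:
  assumes "\<gamma> \<in> curve_space \<tau> A a"
  shows "volume_functional I v \<gamma> = volume_vector I v \<gamma> \<bullet> v"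
proof -
  let ?f = "\<lambda>t. (norm (\<gamma> t - (\<gamma> t \<bullet> v) *\<^sub>R v))\<^sup>2 *\<^sub>R vector_derivative \<gamma> (at t)"
  have "continuous_on {lo..hi} ?f"
    by (intro continuous_intros smooth_continuous_derivative curve_smooth[OF assms])
  then have "?f integrable_on {lo..hi}" by (rule integrable_continuous_real)
  then have "integral {lo..hi} (\<lambda>t. ?f t \<bullet> v) = integral {lo..hi} ?f \<bullet> v"
    using integral_linear[OF _ bounded_linear_inner_left, of ?f "{lo..hi}" v] by (simp add: o_def)
  then show ?thesis by (simp add: volume_functional_def volume_vector_def integral_I)
qed

lemma equivariant_derivative:
  assumes "smooth_on UNIV f" "\<And>t. f (\<tau> t) = A *v f t + b" "(\<tau> has_real_derivative d) (at t)"
  shows "d *\<^sub>R vector_derivative f (at (\<tau> t)) = A *v vector_derivative f (at t)"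
proof -
  have "((\<lambda>t. f (\<tau> t)) has_vector_derivative d *\<^sub>R vector_derivative f (at (\<tau> t))) (at t)"
    using vector_diff_chain_at[OF _ smooth_has_vector_derivative[OF assms(1)], of \<tau> d t] assms(3)
    by (simp add: o_def has_real_derivative_iff_has_vector_derivative)
  moreover have "((\<lambda>t. A *v f t + b) has_vector_derivative A *v vector_derivative f (at t)) (at t)"
    using bounded_linear.has_vector_derivative[OF matrix_vector_mul_bounded_linear smooth_has_vector_derivative[OF assms(1)]]
    by (auto intro!: derivative_eq_intros)
  ultimately show ?thesis
    using vector_derivative_unique_at by (metis (no_types, lifting) assms(2) ext)
qed

lemma speed_pos: "\<gamma> \<in> curve_space \<tau> A a \<Longrightarrow> 0 < speed \<gamma> t"
  using curve_immersed by (simp add: speed_def)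

lemma unit_tangent_smooth:
  assumes "\<gamma> \<in> curve_space \<tau> A a" shows "smooth_on UNIV (unit_tangent \<gamma>)"
proof -
  let ?d = "\<lambda>t. vector_derivative \<gamma> (at t)"
  have d: "smooth_on UNIV ?d"
    by (intro smooth_on_vector_derivative open_UNIV curve_smooth[OF assms])
  have "smooth_on UNIV (\<lambda>t. inverse (sqrt (?d t \<bullet> ?d t)) *\<^sub>R ?d t)"
    using curve_immersed[OF assms]
    by (intro smooth_on_scaleR smooth_on_inverse smooth_on_sqrt smooth_on_inner d open_UNIV) auto
  then show ?thesis
    by (simp add: unit_tangent_def arclength_deriv_def[abs_def] speed_def norm_eq_sqrt_inner)
qed

text \<open>The chain rule introduces the factor \<open>\<tau>'\<close>, which cancels in the normalised tangent because it is positive.\<close>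
lemma unit_tangent_motion:
  assumes "\<gamma> \<in> curve_space \<tau> A a" shows "unit_tangent \<gamma> (\<tau> t) = A *v unit_tangent \<gamma> t"
proof -
  obtain d where d: "(\<tau> has_real_derivative d) (at t)" "d > 0"
    using translation_has_pos_derivative[OF translation] .
  have *: "vector_derivative \<gamma> (at (\<tau> t)) = inverse d *\<^sub>R (A *v vector_derivative \<gamma> (at t))"
    using d(2) by (simp flip: equivariant_derivative[OF curve_smooth[OF assms] curve_motion[OF assms] d(1)])
  show ?thesis
    using d(2) by (simp add: unit_tangent_def arclength_deriv_def speed_def * matrix_vector_mult_scaleR)
qed

lemma unit_tangent_tangent: "\<gamma> \<in> curve_space \<tau> A a \<Longrightarrow> unit_tangent \<gamma> \<in> tangent_space \<tau> A"
  by (simp add: tangent_space_def unit_tangent_smooth unit_tangent_motion)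

lemma unit_tangent_scale: "\<gamma> \<in> curve_space \<tau> A a \<Longrightarrow>
    speed \<gamma> t *\<^sub>R unit_tangent \<gamma> t = vector_derivative \<gamma> (at t)"
  using speed_pos[of \<gamma> t] by (simp add: unit_tangent_def arclength_deriv_def)

lemma unit_tangent_unit: "\<gamma> \<in> curve_space \<tau> A a \<Longrightarrow> unit_tangent \<gamma> t \<bullet> unit_tangent \<gamma> t = 1"
  using speed_pos[of \<gamma> t] by (simp add: unit_tangent_def arclength_deriv_def speed_def dot_square_norm
     power2_eq_square)

lemma tangent_cross: "X \<in> tangent_space \<tau> A \<Longrightarrow> Y \<in> tangent_space \<tau> A \<Longrightarrow>
    (\<lambda>t. X t \<times> Y t) \<in> tangent_space \<tau> A"
  by (auto simp: tangent_space_def cross_A intro: smooth_on_cross)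

lemma tangent_minus: "X \<in> tangent_space \<tau> A \<Longrightarrow> (\<lambda>t. - X t) \<in> tangent_space \<tau> A"
  using matrix_vector_mult_scaleR[of A "-1"] by (auto simp: tangent_space_def intro: smooth_on_minus)

lemma tangent_diff: "X \<in> tangent_space \<tau> A \<Longrightarrow> Y \<in> tangent_space \<tau> A \<Longrightarrow>
    (\<lambda>t. X t - Y t) \<in> tangent_space \<tau> A"
  by (auto simp: tangent_space_def matrix_vector_mult_diff_distrib intro: smooth_on_diff)

lemma tangent_add: "X \<in> tangent_space \<tau> A \<Longrightarrow> Y \<in> tangent_space \<tau> A \<Longrightarrow>
    (\<lambda>t. X t + Y t) \<in> tangent_space \<tau> A"
  by (auto simp: tangent_space_def matrix_vector_right_distrib intro: smooth_on_add)

lemma tangent_scale: "smooth_on UNIV f \<Longrightarrow> (\<And>t. f (\<tau> t) = f t) \<Longrightarrow> X \<in> tangent_space \<tau> A \<Longrightarrow>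
    (\<lambda>t. f t *\<^sub>R X t) \<in> tangent_space \<tau> A"
  by (auto simp: tangent_space_def matrix_vector_mult_scaleR intro: smooth_on_scaleR)

lemma rotation_field_tangent: "\<gamma> \<in> curve_space \<tau> A a \<Longrightarrow> (\<lambda>t. v \<times> \<gamma> t) \<in> tangent_space \<tau> A"
  by (auto simp: tangent_space_def curve_motion cross_v_motion
      intro: smooth_on_cross smooth_on_const curve_smooth)

end

section \<open>The first variation of the volume functional\<close>

lemma smooth_on_strip_partials:
  assumes "\<epsilon> > 0" "smooth_on (fst -` {-\<epsilon><..<\<epsilon>}) \<Gamma>" "s \<in> {-\<epsilon><..<\<epsilon>}"
  shows "((\<lambda>s. \<Gamma> (s, t)) has_vector_derivative frechet_derivative \<Gamma> (at (s, t)) (1, 0)) (at s)"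
    and "((\<lambda>t. \<Gamma> (s, t)) has_vector_derivative frechet_derivative \<Gamma> (at (s, t)) (0, 1)) (at t)"
proof -
  have D: "(\<Gamma> has_derivative frechet_derivative \<Gamma> (at (s, t))) (at (s, t))"
    using assms by (intro smooth_on_has_derivative) auto
  note lin = bounded_linear.linear[OF has_derivative_bounded_linear[OF D]]
  have "((\<lambda>s. \<Gamma> (s, t)) has_derivative (\<lambda>h. frechet_derivative \<Gamma> (at (s, t)) (h, 0))) (at s)"
    by (rule has_derivative_compose[of "\<lambda>s. (s, t)" "\<lambda>h. (h, 0)" s UNIV,
        OF has_derivative_Pair[OF has_derivative_ident has_derivative_const] D])
  moreover have "(\<lambda>h. frechet_derivative \<Gamma> (at (s, t)) (h, 0)) = (\<lambda>h. h *\<^sub>R frechet_derivative \<Gamma> (at (s, t)) (1, 0))"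
  proof
    fix h :: real
    have "(h, 0::real) = h *\<^sub>R (1, 0)" by simp
    then show "frechet_derivative \<Gamma> (at (s, t)) (h, 0) = h *\<^sub>R frechet_derivative \<Gamma> (at (s, t)) (1, 0)"
      using linear_scale[OF lin] by (simp only:)
  qed
  ultimately show "((\<lambda>s. \<Gamma> (s, t)) has_vector_derivative frechet_derivative \<Gamma> (at (s, t)) (1, 0)) (at s)"
    unfolding has_vector_derivative_def by (simp only:)
  have "((\<lambda>t. \<Gamma> (s, t)) has_derivative (\<lambda>h. frechet_derivative \<Gamma> (at (s, t)) (0, h))) (at t)"
    by (rule has_derivative_compose[of "\<lambda>t. (s, t)" "\<lambda>h. (0, h)" t UNIV,
        OF has_derivative_Pair[OF has_derivative_const has_derivative_ident] D])
  moreover have "(\<lambda>h. frechet_derivative \<Gamma> (at (s, t)) (0, h)) = (\<lambda>h. h *\<^sub>R frechet_derivative \<Gamma> (at (s, t)) (0, 1))"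
  proof
    fix h :: real
    have "(0::real, h) = h *\<^sub>R (0, 1)" by simp
    then show "frechet_derivative \<Gamma> (at (s, t)) (0, h) = h *\<^sub>R frechet_derivative \<Gamma> (at (s, t)) (0, 1)"
      using linear_scale[OF lin] by (simp only:)
  qed
  ultimately show "((\<lambda>t. \<Gamma> (s, t)) has_vector_derivative frechet_derivative \<Gamma> (at (s, t)) (0, 1)) (at t)"
    unfolding has_vector_derivative_def by (simp only:)
qed

text \<open>Symmetry of the second derivative is needed only for one slice, and it follows from differentiation
under the integral: \<open>\<Gamma>(s, x) - \<Gamma>(s, lo)\<close> is the integral of \<open>\<partial>\<^sub>t \<Gamma>\<close>, so its \<open>s\<close>-derivative is the integral of
\<open>\<partial>\<^sub>s \<partial>\<^sub>t \<Gamma>\<close>, and this can be differentiated in \<open>x\<close>.\<close>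
lemma mixed_partials_commute:
  fixes \<Gamma> :: "real \<times> real \<Rightarrow> 'b::banach"
  defines "\<Gamma>s \<equiv> \<lambda>x. frechet_derivative \<Gamma> (at x) (1, 0)"
    and "\<Gamma>t \<equiv> \<lambda>x. frechet_derivative \<Gamma> (at x) (0, 1)"
  assumes "\<epsilon> > 0" and smooth: "smooth_on (fst -` {-\<epsilon><..<\<epsilon>}) \<Gamma>" and s: "s \<in> {-\<epsilon><..<\<epsilon>}"
    and t: "t \<in> {lo..hi}"
  shows "((\<lambda>t. \<Gamma>s (s, t)) has_vector_derivative frechet_derivative \<Gamma>t (at (s, t)) (1, 0)) (at t within {lo..hi})"
proof -
  let ?S = "fst -` {-\<epsilon><..<\<epsilon>} :: (real \<times> real) set" and ?U = "{-\<epsilon><..<\<epsilon>}"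
  define \<Gamma>ts where "\<Gamma>ts = (\<lambda>x. frechet_derivative \<Gamma>t (at x) (1, 0))"
  have smooth_t: "smooth_on ?S \<Gamma>t" unfolding \<Gamma>t_def by (rule smooth_on_frechet_derivative[OF smooth])
  have smooth_ts: "smooth_on ?S \<Gamma>ts"
    unfolding \<Gamma>ts_def by (rule smooth_on_frechet_derivative[OF smooth_t])
  have slice: "continuous_on T (\<lambda>t. f (s, t))" if "smooth_on ?S f" "s \<in> ?U"
    for f :: "real \<times> real \<Rightarrow> 'b" and s T
    by (rule continuous_on_compose2[OF smooth_on_continuous_on[OF that(1)]])
       (use that(2) in \<open>auto intro!: continuous_intros\<close>)
  have "\<Gamma>s (s, x) = \<Gamma>s (s, lo) + integral {lo..x} (\<lambda>y. \<Gamma>ts (s, y))" if "x \<in> {lo..hi}" for x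
  proof -
    have ftc: "integral {lo..x} (\<lambda>y. \<Gamma>t (s', y)) = \<Gamma> (s', x) - \<Gamma> (s', lo)" if "s' \<in> ?U" for s'
      using smooth_on_strip_partials(2)[OF assms(3) smooth that] \<open>x \<in> {lo..hi}\<close>
      by (intro integral_unique fundamental_theorem_of_calculus)
         (auto simp: \<Gamma>t_def intro: has_vector_derivative_at_within)
    have "((\<lambda>s. integral (cbox lo x) (\<lambda>y. \<Gamma>t (s, y))) has_vector_derivative
        integral (cbox lo x) (\<lambda>y. \<Gamma>ts (s, y))) (at s within ?U)"
    proof (rule leibniz_rule_vector_derivative)
      show "((\<lambda>s. \<Gamma>t (s, y)) has_vector_derivative \<Gamma>ts (s', y)) (at s' within ?U)" if "s' \<in> ?U" for s' y
        using smooth_on_strip_partials(1)[OF assms(3) smooth_t that] unfolding \<Gamma>ts_def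
        by (rule has_vector_derivative_at_within)
      show "(\<lambda>y. \<Gamma>t (s', y)) integrable_on cbox lo x" if "s' \<in> ?U" for s'
        by (intro integrable_continuous slice[OF smooth_t that])
      show "continuous_on (Sigma ?U (\<lambda>_. cbox lo x)) (\<lambda>(s, y). \<Gamma>ts (s, y))"
        unfolding case_prod_unfold prod.collapse
        by (rule continuous_on_subset[OF smooth_on_continuous_on[OF smooth_ts]]) auto
    qed (use s in auto)
    then have "((\<lambda>s. integral {lo..x} (\<lambda>y. \<Gamma>t (s, y))) has_vector_derivative
        integral {lo..x} (\<lambda>y. \<Gamma>ts (s, y))) (at s)"
      using s by (simp add: at_within_open[of s ?U])
    then have "((\<lambda>s. \<Gamma> (s, x) - \<Gamma> (s, lo)) has_vector_derivative
        integral {lo..x} (\<lambda>y. \<Gamma>ts (s, y))) (at s)"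
      by (rule has_vector_derivative_transform_within_open[where S="?U"]) (use s ftc in auto)
    moreover have "((\<lambda>s. \<Gamma> (s, x) - \<Gamma> (s, lo)) has_vector_derivative \<Gamma>s (s, x) - \<Gamma>s (s, lo)) (at s)"
      unfolding \<Gamma>s_def by (intro has_vector_derivative_diff smooth_on_strip_partials(1)[OF assms(3) smooth s])
    ultimately have "integral {lo..x} (\<lambda>y. \<Gamma>ts (s, y)) = \<Gamma>s (s, x) - \<Gamma>s (s, lo)"
      by (rule vector_derivative_unique_at)
    then show ?thesis by simp
  qed
  note eq = this
  have "((\<lambda>x. \<Gamma>s (s, lo) + integral {lo..x} (\<lambda>y. \<Gamma>ts (s, y))) has_vector_derivative 0 + \<Gamma>ts (s, t))
      (at t within {lo..hi})"
    by (intro has_vector_derivative_add has_vector_derivative_const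
        integral_has_vector_derivative[OF slice[OF smooth_ts s] t])
  then show ?thesis
    unfolding add_0_left fun_cong[OF \<Gamma>ts_def, symmetric]
    by (rule has_vector_derivative_transform[OF t eq, rotated])
qed

context axial_motion
begin

text \<open>After the integration by parts the integrand is \<open>(\<gamma>, \<xi>) (\<gamma>', v) - (\<gamma>, \<gamma>') (\<xi>, v)\<close>, which is
\<open>- (\<gamma>' \<times> (v \<times> \<gamma>), \<xi>)\<close> by Lagrange's identity.\<close>
lemma first_variation_volume:
  assumes \<gamma>: "\<gamma> \<in> curve_space \<tau> A a"
  shows "has_differential (volume_functional I v)
    (\<lambda>\<xi>. L2_product I \<gamma> (\<lambda>t. - (unit_tangent \<gamma> t \<times> (v \<times> \<gamma> t))) \<xi>) (curve_space \<tau> A a) \<gamma>"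
  unfolding has_differential_def
proof (intro allI impI, elim conjE)
  fix \<Gamma> :: "real \<times> real \<Rightarrow> real^3" and \<epsilon> :: real
  let ?S = "fst -` {-\<epsilon><..<\<epsilon>} :: (real \<times> real) set" and ?U = "{-\<epsilon><..<\<epsilon>}"
  assume \<epsilon>: "\<epsilon> > 0" and smooth: "smooth_on ?S \<Gamma>"
    and curves: "\<forall>s\<in>?U. (\<lambda>t. \<Gamma> (s, t)) \<in> curve_space \<tau> A a" and \<Gamma>0: "(\<lambda>t. \<Gamma> (0, t)) = \<gamma>"
  have s0: "0 \<in> ?U" using \<epsilon> by simp
  define \<Gamma>s \<Gamma>t \<Gamma>ts where "\<Gamma>s = (\<lambda>x. frechet_derivative \<Gamma> (at x) (1, 0))"
    and "\<Gamma>t = (\<lambda>x. frechet_derivative \<Gamma> (at x) (0, 1))"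
    and "\<Gamma>ts = (\<lambda>x. frechet_derivative \<Gamma>t (at x) (1, 0))"
  have smooth_s: "smooth_on ?S \<Gamma>s" and smooth_t: "smooth_on ?S \<Gamma>t"
    unfolding \<Gamma>s_def \<Gamma>t_def by (rule smooth_on_frechet_derivative[OF smooth])+
  have smooth_ts: "smooth_on ?S \<Gamma>ts"
    unfolding \<Gamma>ts_def by (rule smooth_on_frechet_derivative[OF smooth_t])
  have Ds: "((\<lambda>s. \<Gamma> (s, t)) has_vector_derivative \<Gamma>s (s, t)) (at s)"
    and Dt: "((\<lambda>t. \<Gamma> (s, t)) has_vector_derivative \<Gamma>t (s, t)) (at t)"
    and Dts: "((\<lambda>s. \<Gamma>t (s, t)) has_vector_derivative \<Gamma>ts (s, t)) (at s)" if "s \<in> ?U" for s t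
    using smooth_on_strip_partials[OF \<epsilon> smooth that] smooth_on_strip_partials[OF \<epsilon> smooth_t that]
    by (simp_all add: \<Gamma>s_def \<Gamma>t_def \<Gamma>ts_def)
  have Dst: "((\<lambda>t. \<Gamma>s (0, t)) has_vector_derivative \<Gamma>ts (0, t)) (at t within {lo..hi})"
    if "t \<in> {lo..hi}" for t
    using mixed_partials_commute[OF \<epsilon> smooth s0 that] by (simp add: \<Gamma>s_def \<Gamma>t_def \<Gamma>ts_def)
  define \<rho> where "\<rho> = (\<lambda>p. p \<bullet> p - (p \<bullet> v)\<^sup>2)"
  define \<xi> where "\<xi> = (\<lambda>t. \<Gamma>s (0, t))"
  define \<gamma>' where "\<gamma>' = (\<lambda>t. \<Gamma>t (0, t))"
  have \<gamma>t: "\<Gamma> (0, t) = \<gamma> t" for t using \<Gamma>0 by auto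
  have \<gamma>'_eq: "vector_derivative \<gamma> (at t) = \<gamma>' t" for t
    using Dt[OF s0, of t] unfolding \<gamma>'_def \<Gamma>0 by (rule vector_derivative_at)
  have \<xi>_eq: "(\<lambda>t. vector_derivative (\<lambda>s. \<Gamma> (s, t)) (at 0)) = \<xi>"
    unfolding \<xi>_def by (rule ext) (rule vector_derivative_at[OF Ds[OF s0]])
  define F where "F = (\<lambda>s t. \<rho> (\<Gamma> (s, t)) * (\<Gamma>t (s, t) \<bullet> v))"
  define F' where "F' = (\<lambda>s t. 2 * (\<Gamma> (s, t) \<bullet> \<Gamma>s (s, t) - (\<Gamma> (s, t) \<bullet> v) * (\<Gamma>s (s, t) \<bullet> v)) * (\<Gamma>t (s, t) \<bullet> v)
      + \<rho> (\<Gamma> (s, t)) * (\<Gamma>ts (s, t) \<bullet> v))"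
  have E: "volume_functional I v (\<lambda>t. \<Gamma> (s, t)) = 1/2 * integral {lo..hi} (F s)" if "s \<in> ?U" for s
    using vector_derivative_at[OF Dt[OF that]]
    by (simp add: volume_functional_def integral_I norm_offset_square[OF norm_v] F_def[abs_def] \<rho>_def)
  have slice: "continuous_on T (\<lambda>t. f (s, t))" if "smooth_on ?S f" "s \<in> ?U"
    for f :: "real \<times> real \<Rightarrow> real^3" and s T
    by (rule continuous_on_compose2[OF smooth_on_continuous_on[OF that(1)]])
       (use that(2) in \<open>auto intro!: continuous_intros\<close>)
  have cont: "continuous_on (Sigma ?U (\<lambda>_. cbox lo hi)) f" if "smooth_on ?S f" for f :: "real \<times> real \<Rightarrow> real^3"
    by (rule continuous_on_subset[OF smooth_on_continuous_on[OF that]]) auto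
  have "((\<lambda>s. integral (cbox lo hi) (F s)) has_field_derivative integral (cbox lo hi) (F' 0)) (at 0 within ?U)"
  proof (rule leibniz_rule_field_derivative)
    fix s t assume s: "s \<in> ?U"
    note [derivative_intros] = has_vector_derivative_at_within[OF Ds[OF s]]
      has_vector_derivative_at_within[OF Dts[OF s]]
    have "((\<lambda>s. F s t) has_vector_derivative F' s t) (at s within ?U)"
      unfolding F_def F'_def \<rho>_def power2_eq_square
      by (rule has_vector_derivative_eq_rhs,
          (rule derivative_intros bounded_bilinear.has_vector_derivative[OF bounded_bilinear_inner]
            bounded_bilinear.has_vector_derivative[OF bounded_bilinear_mult])+)
         (simp add: algebra_simps inner_commute)
    then show "((\<lambda>s. F s t) has_field_derivative F' s t) (at s within ?U)"
      by (simp add: has_real_derivative_iff_has_vector_derivative)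
  next
    fix s assume s: "s \<in> ?U"
    show "F s integrable_on cbox lo hi"
      unfolding F_def \<rho>_def
      by (intro integrable_continuous continuous_intros slice[OF smooth s] slice[OF smooth_t s])
  next
    show "continuous_on (Sigma ?U (\<lambda>_. cbox lo hi)) (\<lambda>(s, t). F' s t)"
      unfolding F'_def \<rho>_def case_prod_unfold prod.collapse
      by (intro continuous_intros cont smooth smooth_s smooth_t smooth_ts)
  qed (use s0 in auto)
  then have "((\<lambda>s. 1/2 * integral {lo..hi} (F s)) has_field_derivative 1/2 * integral {lo..hi} (F' 0)) (at 0)"
    using s0 by (intro DERIV_cmult) (simp add: at_within_open[of 0 ?U])
  then have deriv: "((\<lambda>s. volume_functional I v (\<lambda>t. \<Gamma> (s, t))) has_field_derivative
      1/2 * integral {lo..hi} (F' 0)) (at 0)"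
    by (rule has_field_derivative_transform_within_open[where S="?U"]) (use s0 E in auto)
  (* The derivative of the boundary term; subtracting it removes the derivative of the velocity. *)
  define B' where "B' = (\<lambda>t. 2 * (\<gamma> t \<bullet> \<gamma>' t - (\<gamma> t \<bullet> v) * (\<gamma>' t \<bullet> v)) * (\<xi> t \<bullet> v) + \<rho> (\<gamma> t) * (\<Gamma>ts (0, t) \<bullet> v))"
  have "(B' has_integral (\<rho> (\<gamma> hi) * (\<xi> hi \<bullet> v) - \<rho> (\<gamma> lo) * (\<xi> lo \<bullet> v))) {lo..hi}"
  proof (rule fundamental_theorem_of_calculus)
    fix t assume t: "t \<in> {lo..hi}"
    have "(\<gamma> has_vector_derivative \<gamma>' t) (at t within {lo..hi})"
      using Dt[OF s0, of t] unfolding \<gamma>'_def \<Gamma>0 by (rule has_vector_derivative_at_within)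
    moreover have "(\<xi> has_vector_derivative \<Gamma>ts (0, t)) (at t within {lo..hi})"
      using Dst[OF t] by (simp add: \<xi>_def)
    ultimately show "((\<lambda>t. \<rho> (\<gamma> t) * (\<xi> t \<bullet> v)) has_vector_derivative B' t) (at t within {lo..hi})"
      unfolding B'_def \<rho>_def power2_eq_square
      by - (rule has_vector_derivative_eq_rhs,
          (assumption | rule derivative_intros bounded_bilinear.has_vector_derivative[OF bounded_bilinear_inner]
            bounded_bilinear.has_vector_derivative[OF bounded_bilinear_mult])+,
         simp add: algebra_simps inner_commute)
  qed (use lo_less_hi in simp)
  moreover have "\<rho> (\<gamma> hi) * (\<xi> hi \<bullet> v) = \<rho> (\<gamma> lo) * (\<xi> lo \<bullet> v)"
  proof -
    have \<rho>: "\<rho> (\<gamma> (\<tau> t)) = \<rho> (\<gamma> t)" for t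
      using offset_motion[of "\<gamma> t"] by (simp add: curve_motion[OF \<gamma>] norm_offset_square[OF norm_v] \<rho>_def)
    have "\<xi> (\<tau> t) = A *v \<xi> t" for t
    proof -
      have "((\<lambda>s. A *v \<Gamma> (s, t) + a) has_vector_derivative A *v \<xi> t) (at 0)"
        using bounded_linear.has_vector_derivative[OF matrix_vector_mul_bounded_linear Ds[OF s0, of t]]
        by (auto intro!: derivative_eq_intros simp: \<xi>_def)
      then have "((\<lambda>s. \<Gamma> (s, \<tau> t)) has_vector_derivative A *v \<xi> t) (at 0)"
        by (rule has_vector_derivative_transform_within_open[where S="?U"])
           (use s0 curves in \<open>auto simp: curve_space_def\<close>)
      then show ?thesis
        using vector_derivative_unique_at[OF Ds[OF s0, of "\<tau> t"]] by (simp add: \<xi>_def)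
    qed
    then show ?thesis using ends \<rho> by auto
  qed
  ultimately have B': "(B' has_integral 0) {lo..hi}" by simp
  have "(F' 0 has_integral integral {lo..hi} (F' 0)) {lo..hi}"
    unfolding F'_def \<rho>_def
    by (intro integrable_integral integrable_continuous_real continuous_intros slice[OF smooth s0] slice[OF smooth_s s0]
        slice[OF smooth_t s0] slice[OF smooth_ts s0])
  from has_integral_diff[OF this B']
  have "((\<lambda>t. F' 0 t - B' t) has_integral integral {lo..hi} (F' 0)) {lo..hi}" by simp
  from has_integral_mult_right[OF this, of "1/2"]
  have "((\<lambda>t. 1/2 * (F' 0 t - B' t)) has_integral 1/2 * integral {lo..hi} (F' 0)) {lo..hi}" .
  moreover have "1/2 * (F' 0 t - B' t) = (- (unit_tangent \<gamma> t \<times> (v \<times> \<gamma> t)) \<bullet> \<xi> t) * speed \<gamma> t" for t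
  proof -
    have "1/2 * (F' 0 t - B' t) = (\<gamma> t \<bullet> \<xi> t) * (\<gamma>' t \<bullet> v) - (\<gamma> t \<bullet> \<gamma>' t) * (\<xi> t \<bullet> v)"
      by (simp add: F'_def B'_def \<gamma>t \<gamma>'_def[symmetric, THEN fun_cong] \<xi>_def[symmetric, THEN fun_cong] field_simps)
    also have "\<dots> = - (\<gamma>' t \<times> (v \<times> \<gamma> t)) \<bullet> \<xi> t"
      by (simp add: Lagrange inner_diff_left inner_commute algebra_simps)
    also have "\<gamma>' t = speed \<gamma> t *\<^sub>R unit_tangent \<gamma> t"
      using unit_tangent_scale[OF \<gamma>] \<gamma>'_eq by simp
    finally show ?thesis by (simp add: cross_mult_left)
  qed
  ultimately have "((\<lambda>t. (- (unit_tangent \<gamma> t \<times> (v \<times> \<gamma> t)) \<bullet> \<xi> t) * speed \<gamma> t) has_integral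
      1/2 * integral {lo..hi} (F' 0)) {lo..hi}"
    by (simp only:)
  then have "L2_product I \<gamma> (\<lambda>t. - (unit_tangent \<gamma> t \<times> (v \<times> \<gamma> t))) \<xi> = 1/2 * integral {lo..hi} (F' 0)"
    unfolding L2_product_def integral_I by (rule integral_unique)
  then show "((\<lambda>s. volume_functional I v (\<lambda>t. \<Gamma> (s, t))) has_real_derivative
     L2_product I \<gamma> (\<lambda>t. - (unit_tangent \<gamma> t \<times> (v \<times> \<gamma> t))) (\<lambda>t. vector_derivative (\<lambda>s. \<Gamma> (s, t)) (at 0))) (at 0)"
    unfolding \<xi>_eq using deriv by (simp only:)
qed

end

section \<open>Uniqueness of gradients\<close>

lemma has_differential_uminus:
  assumes "has_differential E L \<M> \<gamma>"
  shows "has_differential (\<lambda>\<gamma>. - E \<gamma>) (\<lambda>\<xi>. - L \<xi>) \<M> \<gamma>"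
  unfolding has_differential_def
proof (intro allI impI DERIV_minus)
  fix \<Gamma> :: "real \<times> real \<Rightarrow> real^3" and \<epsilon> :: real
  assume "\<epsilon> > 0" "smooth_on (fst -` {-\<epsilon><..<\<epsilon>}) \<Gamma> \<and>
    (\<forall>s\<in>{-\<epsilon><..<\<epsilon>}. (\<lambda>t. \<Gamma> (s, t)) \<in> \<M>) \<and> (\<lambda>t. \<Gamma> (0, t)) = \<gamma>"
  then show "((\<lambda>s. E (\<lambda>t. \<Gamma> (s, t))) has_real_derivative
      L (\<lambda>t. vector_derivative (\<lambda>s. \<Gamma> (s, t)) (at 0))) (at 0)"
    by (rule assms[unfolded has_differential_def, rule_format])
qed

context axial_motion
begin

text \<open>The quotient \<open>|\<xi>'| / |\<gamma>'|\<close> is \<open>\<tau>\<close>-invariant, because \<open>\<xi>'\<close> and \<open>\<gamma>'\<close> transform with the same factor, so a bound on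
the compact interval \<open>{lo..hi}\<close> is a bound on the line.\<close>
lemma tangent_derivative_bounded_by_speed:
  assumes \<gamma>: "\<gamma> \<in> curve_space \<tau> A a" and \<xi>: "\<xi> \<in> tangent_space \<tau> A"
  obtains C where "C \<ge> 0" "\<And>t. norm (vector_derivative \<xi> (at t)) \<le> C * norm (vector_derivative \<gamma> (at t))"
proof -
  note smooth = curve_smooth[OF \<gamma>] tangent_smooth[OF \<xi>]
  define q where "q = (\<lambda>t. norm (vector_derivative \<xi> (at t)) / norm (vector_derivative \<gamma> (at t)))"
  have "continuous_on {lo..hi} q"
    unfolding q_def using curve_immersed[OF \<gamma>]
    by (intro continuous_intros smooth_continuous_derivative smooth) auto
  then have "bounded (q ` {lo..hi})"
    by (intro compact_imp_bounded compact_continuous_image) auto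
  then obtain C where C: "\<And>t. t \<in> {lo..hi} \<Longrightarrow> norm (q t) \<le> C"
    unfolding bounded_iff by blast
  have "norm (q lo) \<le> C" using C lo_less_hi by simp
  then have "C \<ge> 0" using norm_ge_zero order_trans by blast
  moreover have "norm (vector_derivative \<xi> (at t)) \<le> C * norm (vector_derivative \<gamma> (at t))" for t
  proof (rule orbit_invariant_extends[where
        P="\<lambda>t. norm (vector_derivative \<xi> (at t)) \<le> C * norm (vector_derivative \<gamma> (at t))", OF fundamental_domain])
    fix t
    obtain d where d: "(\<tau> has_real_derivative d) (at t)" "d > 0"
      using translation_has_pos_derivative[OF translation] .
    have "d * norm (vector_derivative \<gamma> (at (\<tau> t))) = norm (vector_derivative \<gamma> (at t))"
      using equivariant_derivative[OF smooth(1) curve_motion[OF \<gamma>] d(1)] d(2)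
      by (metis abs_of_pos norm_A norm_scaleR)
    moreover have "d * norm (vector_derivative \<xi> (at (\<tau> t))) = norm (vector_derivative \<xi> (at t))"
      using equivariant_derivative[OF smooth(2), of 0] tangent_motion[OF \<xi>] d
      by (metis abs_of_pos add.right_neutral norm_A norm_scaleR)
    ultimately have "(norm (vector_derivative \<xi> (at t)) \<le> C * norm (vector_derivative \<gamma> (at t))) \<longleftrightarrow>
       d * norm (vector_derivative \<xi> (at (\<tau> t))) \<le> d * (C * norm (vector_derivative \<gamma> (at (\<tau> t))))"
      by (simp add: mult.left_commute)
    then show "(norm (vector_derivative \<xi> (at (\<tau> t))) \<le> C * norm (vector_derivative \<gamma> (at (\<tau> t)))) \<longleftrightarrow>
       (norm (vector_derivative \<xi> (at t)) \<le> C * norm (vector_derivative \<gamma> (at t)))"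
      using d(2) by simp
  next
    fix s assume "s \<in> I"
    then have "norm (q s) \<le> C" using C outer_interval by blast
    then show "norm (vector_derivative \<xi> (at s)) \<le> C * norm (vector_derivative \<gamma> (at s))"
      using curve_immersed[OF \<gamma>, of s] by (simp add: q_def field_simps)
  qed
  ultimately show ?thesis by (rule that)
qed

text \<open>The definition of a differential tests only velocities of variations; here every tangent field is
realised as the velocity of the straight variation \<open>\<gamma> + s \<xi>\<close>.\<close>
lemma differential_unique:
  assumes \<gamma>: "\<gamma> \<in> curve_space \<tau> A a" and \<xi>: "\<xi> \<in> tangent_space \<tau> A"
    and L: "has_differential E L (curve_space \<tau> A a) \<gamma>" "has_differential E L' (curve_space \<tau> A a) \<gamma>"
  shows "L \<xi> = L' \<xi>"
proof -
  note smooth = curve_smooth[OF \<gamma>] tangent_smooth[OF \<xi>]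
  obtain C where C: "C \<ge> 0"
    "\<And>t. norm (vector_derivative \<xi> (at t)) \<le> C * norm (vector_derivative \<gamma> (at t))"
    using tangent_derivative_bounded_by_speed[OF \<gamma> \<xi>] by metis
  (* For |s| < 1 / C the derivative \<gamma>' + s \<xi>' cannot vanish; the summand 1 allows C = 0. *)
  define \<epsilon> where "\<epsilon> = 1 / (C + 1)"
  have \<epsilon>: "\<epsilon> > 0" using C(1) by (simp add: \<epsilon>_def)
  define \<Gamma> where "\<Gamma> = (\<lambda>x::real \<times> real. \<gamma> (snd x) + fst x *\<^sub>R \<xi> (snd x))"
  let ?S = "fst -` {-\<epsilon><..<\<epsilon>} :: (real \<times> real) set"
  have "open ?S" by (rule open_vimage_fst) simp
  have fst: "smooth_on ?S (fst :: real \<times> real \<Rightarrow> real)"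
    by (rule smooth_on_compose_linear[OF bounded_linear_fst \<open>open ?S\<close> open_UNIV _
          smooth_on_linear[OF bounded_linear_ident]]) simp
  have "smooth_on ?S \<Gamma>"
    unfolding \<Gamma>_def
    by (intro smooth_on_add smooth_on_scaleR fst \<open>open ?S\<close>
        smooth_on_compose_linear[OF bounded_linear_snd \<open>open ?S\<close> open_UNIV] smooth) auto
  moreover have "(\<lambda>t. \<Gamma> (s, t)) \<in> curve_space \<tau> A a" if s: "s \<in> {-\<epsilon><..<\<epsilon>}" for s
  proof -
    have vd: "vector_derivative (\<lambda>t. \<Gamma> (s, t)) (at t) =
        vector_derivative \<gamma> (at t) + s *\<^sub>R vector_derivative \<xi> (at t)" for t
      unfolding \<Gamma>_def fst_conv snd_conv
      by (intro vector_derivative_at has_vector_derivative_add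
          bounded_linear.has_vector_derivative[OF bounded_linear_scaleR_right] smooth_has_vector_derivative smooth)
    have "vector_derivative (\<lambda>t. \<Gamma> (s, t)) (at t) \<noteq> 0" for t
    proof
      assume "vector_derivative (\<lambda>t. \<Gamma> (s, t)) (at t) = 0"
      then have "vector_derivative \<gamma> (at t) = - (s *\<^sub>R vector_derivative \<xi> (at t))"
        unfolding vd by (rule eq_neg_iff_add_eq_0[THEN iffD2])
      then have "norm (vector_derivative \<gamma> (at t)) = \<bar>s\<bar> * norm (vector_derivative \<xi> (at t))"
        by (metis norm_minus_cancel norm_scaleR)
      also have "\<dots> \<le> \<bar>s\<bar> * (C * norm (vector_derivative \<gamma> (at t)))"
        by (intro mult_left_mono C(2)) simp
      finally have "1 * norm (vector_derivative \<gamma> (at t)) \<le> (\<bar>s\<bar> * C) * norm (vector_derivative \<gamma> (at t))"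
        by simp
      then have "1 \<le> \<bar>s\<bar> * C" using curve_immersed[OF \<gamma>, of t] by (simp only: mult_le_cancel_right) auto
      moreover have "\<bar>s\<bar> < 1 / (C + 1)" using s by (auto simp: \<epsilon>_def)
      then have "\<bar>s\<bar> * (C + 1) < 1" using C(1) by (simp add: field_simps)
      ultimately show False by (simp add: algebra_simps)
    qed
    moreover have "smooth_on UNIV (\<lambda>t. \<Gamma> (s, t))"
      unfolding \<Gamma>_def fst_conv snd_conv
      by (intro smooth_on_add smooth_on_scaleR smooth_on_const open_UNIV smooth)
    moreover have "\<Gamma> (s, \<tau> t) = A *v \<Gamma> (s, t) + a" for t
      by (simp add: \<Gamma>_def curve_motion[OF \<gamma>] tangent_motion[OF \<xi>] matrix_vector_right_distrib matrix_vector_mult_scaleR)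
    ultimately show ?thesis by (simp add: curve_space_def)
  qed
  moreover have "(\<lambda>t. \<Gamma> (0, t)) = \<gamma>" by (simp add: \<Gamma>_def)
  moreover have "(\<lambda>t. vector_derivative (\<lambda>s. \<Gamma> (s, t)) (at 0)) = \<xi>"
  proof
    fix t
    have "((\<lambda>s. \<gamma> t + s *\<^sub>R \<xi> t) has_vector_derivative 0 + 1 *\<^sub>R \<xi> t) (at 0)"
      by (intro has_vector_derivative_add has_vector_derivative_const
          bounded_linear.has_vector_derivative[OF bounded_linear_scaleR_left] has_vector_derivative_id)
    then show "vector_derivative (\<lambda>s. \<Gamma> (s, t)) (at 0) = \<xi> t"
      by (simp add: \<Gamma>_def vector_derivative_at)
  qed
  ultimately have "((\<lambda>s. E (\<lambda>t. \<Gamma> (s, t))) has_real_derivative L \<xi>) (at 0)"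
    "((\<lambda>s. E (\<lambda>t. \<Gamma> (s, t))) has_real_derivative L' \<xi>) (at 0)"
    using L \<epsilon> unfolding has_differential_def by metis+
  then show ?thesis by (rule DERIV_unique)
qed

text \<open>The difference of the two fields is itself an admissible test field.\<close>
lemma L2_product_nondegenerate:
  assumes \<gamma>: "\<gamma> \<in> curve_space \<tau> A a" and G: "G \<in> tangent_space \<tau> A" "G' \<in> tangent_space \<tau> A"
    and eq: "\<And>\<xi>. \<xi> \<in> tangent_space \<tau> A \<Longrightarrow> L2_product I \<gamma> G \<xi> = L2_product I \<gamma> G' \<xi>"
  shows "G = G'"
proof -
  define \<xi> where "\<xi> = (\<lambda>t. G t - G' t)"
  have \<xi>: "\<xi> \<in> tangent_space \<tau> A" unfolding \<xi>_def by (rule tangent_diff[OF G])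
  have cont: "continuous_on {lo..hi} (\<lambda>t. (X t \<bullet> \<xi> t) * speed \<gamma> t)" if "X \<in> tangent_space \<tau> A" for X
    unfolding speed_def
    by (intro continuous_intros smooth_continuous_derivative tangent_smooth[OF that] tangent_smooth[OF \<xi>]
        curve_smooth[OF \<gamma>])
  have "integral {lo..hi} (\<lambda>t. (\<xi> t \<bullet> \<xi> t) * speed \<gamma> t) =
      integral {lo..hi} (\<lambda>t. (G t \<bullet> \<xi> t) * speed \<gamma> t - (G' t \<bullet> \<xi> t) * speed \<gamma> t)"
    by (simp add: \<xi>_def inner_diff_left algebra_simps)
  also have "\<dots> = L2_product I \<gamma> G \<xi> - L2_product I \<gamma> G' \<xi>"
    unfolding L2_product_def integral_I
    by (intro integral_diff integrable_continuous_real cont G)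
  also have "\<dots> = 0" using eq[OF \<xi>] by simp
  finally have "integral {lo..hi} (\<lambda>t. (\<xi> t \<bullet> \<xi> t) * speed \<gamma> t) = 0" .
  then have "((\<lambda>t. (\<xi> t \<bullet> \<xi> t) * speed \<gamma> t) has_integral 0) (cbox lo hi)"
    using integrable_integral[OF integrable_continuous_real[OF cont[OF \<xi>]]] by simp
  then have zero: "(\<xi> t \<bullet> \<xi> t) * speed \<gamma> t = 0" if "t \<in> {lo..hi}" for t
    using has_integral_0_cbox_imp_0[of lo hi "\<lambda>t. (\<xi> t \<bullet> \<xi> t) * speed \<gamma> t" t] cont[OF \<xi>] that
      speed_pos[OF \<gamma>] lo_less_hi
    by (simp add: less_imp_le)
  have "\<xi> t = 0" for t
  proof (rule orbit_invariant_extends[OF fundamental_domain])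
    show "\<xi> (\<tau> t) = 0 \<longleftrightarrow> \<xi> t = 0" for t using tangent_motion[OF \<xi>] by simp
    show "\<xi> s = 0" if "s \<in> I" for s
    proof -
      have "(\<xi> s \<bullet> \<xi> s) * speed \<gamma> s = 0" using zero outer_interval that by blast
      then show ?thesis using speed_pos[OF \<gamma>, of s] by simp
    qed
  qed
  then show ?thesis by (auto simp: \<xi>_def fun_eq_iff)
qed

lemma variational_gradient_iff:
  assumes \<gamma>: "\<gamma> \<in> curve_space \<tau> A a" and G\<^sub>0: "G\<^sub>0 \<in> tangent_space \<tau> A"
    and E: "has_differential E (\<lambda>\<xi>. L2_product I \<gamma> G\<^sub>0 \<xi>) (curve_space \<tau> A a) \<gamma>"
  shows "variational_gradient \<tau> I A a E \<gamma> G \<longleftrightarrow> G = G\<^sub>0"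
proof
  assume "variational_gradient \<tau> I A a E \<gamma> G"
  then show "G = G\<^sub>0"
    unfolding variational_gradient_def
    using L2_product_nondegenerate[OF \<gamma> _ G\<^sub>0] differential_unique[OF \<gamma> _ _ E] by metis
qed (use G\<^sub>0 E in \<open>simp add: variational_gradient_def\<close>)

lemma symplectic_form_eq_L2_product:
  "symplectic_form I \<gamma> Y \<xi> = L2_product I \<gamma> (\<lambda>t. unit_tangent \<gamma> t \<times> Y t) \<xi>"
proof -
  have "unit_tangent \<gamma> t \<bullet> (Y t \<times> \<xi> t) = (unit_tangent \<gamma> t \<times> Y t) \<bullet> \<xi> t" for t
    by (metis cross_triple inner_commute)
  then show ?thesis
    unfolding symplectic_form_def L2_product_def by (simp flip: dot_cross_det)
qed

text \<open>As \<open>\<sigma>(Y, -) = \<langle>T \<times> Y, -\<rangle>\<close>, the field \<open>Y\<close> is a symplectic gradient if and only if \<open>T \<times> Y\<close> is the variational one.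
Applying \<open>T \<times> -\<close> to \<open>T \<times> (Y - X) = 0\<close> shows that \<open>Y - X\<close> is \<open>(Y - X, T) T\<close>, and this coefficient is smooth and
\<open>\<tau>\<close>-invariant.\<close>
lemma symplectic_gradient_iff:
  assumes \<gamma>: "\<gamma> \<in> curve_space \<tau> A a" and X: "X \<in> tangent_space \<tau> A"
    and E: "has_differential E (\<lambda>\<xi>. L2_product I \<gamma> (\<lambda>t. unit_tangent \<gamma> t \<times> X t) \<xi>) (curve_space \<tau> A a) \<gamma>"
  shows "symplectic_gradient \<tau> I A a E \<gamma> Y \<longleftrightarrow> cong_mod_tangent \<tau> \<gamma> Y X"
proof -
  let ?T = "unit_tangent \<gamma>"
  have T: "?T \<in> tangent_space \<tau> A" by (rule unit_tangent_tangent[OF \<gamma>])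
  have "symplectic_gradient \<tau> I A a E \<gamma> Y \<longleftrightarrow>
      Y \<in> tangent_space \<tau> A \<and> variational_gradient \<tau> I A a E \<gamma> (\<lambda>t. ?T t \<times> Y t)"
    using tangent_cross[OF T]
    by (auto simp: symplectic_gradient_def variational_gradient_def symplectic_form_eq_L2_product)
  also have "\<dots> \<longleftrightarrow> Y \<in> tangent_space \<tau> A \<and> (\<forall>t. ?T t \<times> Y t = ?T t \<times> X t)"
    using variational_gradient_iff[OF \<gamma> tangent_cross[OF T X] E] by (simp add: fun_eq_iff)
  also have "\<dots> \<longleftrightarrow> cong_mod_tangent \<tau> \<gamma> Y X"
  proof
    assume Y: "Y \<in> tangent_space \<tau> A \<and> (\<forall>t. ?T t \<times> Y t = ?T t \<times> X t)"
    define f where "f = (\<lambda>t. (Y t - X t) \<bullet> ?T t)"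
    have D: "(\<lambda>t. Y t - X t) \<in> tangent_space \<tau> A" using Y tangent_diff X by blast
    have "smooth_on UNIV f"
      unfolding f_def by (intro smooth_on_inner open_UNIV tangent_smooth D T)
    moreover have "f (\<tau> t) = f t" for t
      using tangent_motion[OF D, of t] tangent_motion[OF T, of t] by (simp add: f_def)
    moreover have "Y t = X t + f t *\<^sub>R ?T t" for t
    proof -
      have "?T t \<times> (Y t - X t) = 0" using Y by (simp add: Cross3.right_diff_distrib)
      then have "?T t \<times> (?T t \<times> (Y t - X t)) = 0" by simp
      then have "f t *\<^sub>R ?T t = Y t - X t"
        by (simp add: Lagrange unit_tangent_unit[OF \<gamma>] f_def inner_commute)
      then show ?thesis by simp
    qed
    ultimately show "cong_mod_tangent \<tau> \<gamma> Y X" unfolding cong_mod_tangent_def by blast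
  next
    assume "cong_mod_tangent \<tau> \<gamma> Y X"
    then obtain f where f: "smooth_on UNIV f" "\<And>t. f (\<tau> t) = f t" "Y = (\<lambda>t. X t + f t *\<^sub>R ?T t)"
      unfolding cong_mod_tangent_def by blast
    then show "Y \<in> tangent_space \<tau> A \<and> (\<forall>t. ?T t \<times> Y t = ?T t \<times> X t)"
      using tangent_add[OF X tangent_scale[OF f(1,2) T]] by (simp add: cross_add_right cross_mult_right)
  qed
  finally show ?thesis .
qed

lemma volume_functional_gradients:
  assumes \<gamma>: "\<gamma> \<in> curve_space \<tau> A a"
  shows "variational_gradient \<tau> I A a (volume_functional I v) \<gamma> G \<longleftrightarrow>
        G = (\<lambda>t. - (unit_tangent \<gamma> t \<times> (v \<times> \<gamma> t)))"
    and "symplectic_gradient \<tau> I A a (volume_functional I v) \<gamma> Y \<longleftrightarrow>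
        cong_mod_tangent \<tau> \<gamma> Y (\<lambda>t. - (v \<times> \<gamma> t))"
proof -
  note R = rotation_field_tangent[OF \<gamma>]
  note T = unit_tangent_tangent[OF \<gamma>]
  show "variational_gradient \<tau> I A a (volume_functional I v) \<gamma> G \<longleftrightarrow>
        G = (\<lambda>t. - (unit_tangent \<gamma> t \<times> (v \<times> \<gamma> t)))"
    by (rule variational_gradient_iff[OF \<gamma> tangent_minus[OF tangent_cross[OF T R]] first_variation_volume[OF \<gamma>]])
  show "symplectic_gradient \<tau> I A a (volume_functional I v) \<gamma> Y \<longleftrightarrow>
        cong_mod_tangent \<tau> \<gamma> Y (\<lambda>t. - (v \<times> \<gamma> t))"
    using first_variation_volume[OF \<gamma>]
    by (intro symplectic_gradient_iff[OF \<gamma> tangent_minus[OF R]]) simp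
qed

lemma flux_functional_gradients:
  assumes \<gamma>: "\<gamma> \<in> curve_space \<tau> A a"
  shows "variational_gradient \<tau> I A a (flux_functional I (\<lambda>p X. - rotation_form v p X)) \<gamma> G \<longleftrightarrow>
        G = (\<lambda>t. unit_tangent \<gamma> t \<times> (v \<times> \<gamma> t))"
    and "symplectic_gradient \<tau> I A a (flux_functional I (\<lambda>p X. - rotation_form v p X)) \<gamma> Y \<longleftrightarrow>
        cong_mod_tangent \<tau> \<gamma> Y (\<lambda>t. v \<times> \<gamma> t)"
proof -
  note R = rotation_field_tangent[OF \<gamma>]
  note T = unit_tangent_tangent[OF \<gamma>]
  have "flux_functional I (\<lambda>p X. - rotation_form v p X) = (\<lambda>\<gamma>. - volume_functional I v \<gamma>)"
    by (simp add: fun_eq_iff flux_uminus_eq_volume_functional)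
  then have D: "has_differential (flux_functional I (\<lambda>p X. - rotation_form v p X))
      (\<lambda>\<xi>. L2_product I \<gamma> (\<lambda>t. unit_tangent \<gamma> t \<times> (v \<times> \<gamma> t)) \<xi>) (curve_space \<tau> A a) \<gamma>"
    using has_differential_uminus[OF first_variation_volume[OF \<gamma>]] by (simp add: L2_product_def)
  show "variational_gradient \<tau> I A a (flux_functional I (\<lambda>p X. - rotation_form v p X)) \<gamma> G \<longleftrightarrow>
        G = (\<lambda>t. unit_tangent \<gamma> t \<times> (v \<times> \<gamma> t))"
    by (rule variational_gradient_iff[OF \<gamma> tangent_cross[OF T R] D])
  show "symplectic_gradient \<tau> I A a (flux_functional I (\<lambda>p X. - rotation_form v p X)) \<gamma> Y \<longleftrightarrow>
        cong_mod_tangent \<tau> \<gamma> Y (\<lambda>t. v \<times> \<gamma> t)"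
    by (rule symplectic_gradient_iff[OF \<gamma> R D])
qed

end

section \<open>Lebesgue measure in polar and cylindrical coordinates\<close>

text \<open>Boxes are pulled back to boxes with the same edges.  This identifies the Lebesgue measures of
\<open>\<real>\<^sup>2\<close> and \<open>\<complex>\<close>, of \<open>\<real> \<times> \<real>\<close> and \<open>\<complex>\<close>, and of \<open>\<real>\<^sup>3\<close> and \<open>\<complex> \<times> \<real>\<close>.\<close>
lemma lborel_distr_basis_map:
  fixes T :: "'a::euclidean_space \<Rightarrow> 'b::euclidean_space"
  assumes T: "T \<in> borel_measurable borel" "bij_betw T Basis Basis"
    and inner: "\<And>x b. b \<in> Basis \<Longrightarrow> T x \<bullet> T b = x \<bullet> b"
  shows "distr lborel borel T = lborel"
proof (rule lborel_eqI[symmetric])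
  fix l u :: 'b assume lu: "\<And>b. b \<in> Basis \<Longrightarrow> l \<bullet> b \<le> u \<bullet> b"
  define pull where "pull = (\<lambda>y. \<Sum>b\<in>Basis. (y \<bullet> T b) *\<^sub>R b)"
  have pull: "pull y \<bullet> b = y \<bullet> T b" if "b \<in> Basis" for y b
    using that by (simp add: pull_def)
  have T_Basis: "T b \<in> Basis" if "b \<in> Basis" for b
    using T(2) that by (auto simp: bij_betw_def)
  have all: "(\<forall>b\<in>Basis. P b) \<longleftrightarrow> (\<forall>b\<in>Basis. P (T b))" for P
    using T(2) unfolding bij_betw_def by (metis (no_types, lifting) imageE image_eqI)
  have "T -` box l u = box (pull l) (pull u)"
  proof (rule set_eqI)
    fix x
    have "x \<in> T -` box l u \<longleftrightarrow> (\<forall>b\<in>Basis. l \<bullet> T b < T x \<bullet> T b \<and> T x \<bullet> T b < u \<bullet> T b)"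
      unfolding vimage_eq mem_box by (rule all)
    also have "\<dots> \<longleftrightarrow> x \<in> box (pull l) (pull u)"
      unfolding mem_box using pull inner by auto
    finally show "x \<in> T -` box l u \<longleftrightarrow> x \<in> box (pull l) (pull u)" .
  qed
  then have "emeasure (distr lborel borel T) (box l u) = emeasure lborel (box (pull l) (pull u))"
    using T by (simp add: emeasure_distr)
  also have "\<dots> = ennreal (\<Prod>b\<in>Basis. (pull u - pull l) \<bullet> b)"
    using lu T_Basis by (intro emeasure_lborel_box) (simp add: pull)
  also have "(\<Prod>b\<in>Basis. (pull u - pull l) \<bullet> b) = (\<Prod>b\<in>Basis. (u - l) \<bullet> T b)"
    by (intro prod.cong) (auto simp: inner_diff_left pull)
  also have "\<dots> = (\<Prod>b\<in>Basis. (u - l) \<bullet> b)"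
    by (rule prod.reindex_bij_betw[OF T(2), of "\<lambda>b. (u - l) \<bullet> b"])
  finally show "emeasure (distr lborel borel T) (box l u) = (\<Prod>b\<in>Basis. (u - l) \<bullet> b)" .
qed simp

lemma lborel_distr_orthogonal:
  fixes f :: "real^'n::{finite,wellorder} \<Rightarrow> real^'n::_"
  assumes f: "orthogonal_transformation f"
  shows "distr lborel borel f = lborel"
proof (rule lborel_eqI[symmetric])
  fix l u :: "real^'n::_" assume lu: "\<And>b. b \<in> Basis \<Longrightarrow> l \<bullet> b \<le> u \<bullet> b"
  have meas: "f \<in> borel_measurable borel"
    using orthogonal_transformation_linear[OF f]
    by (intro borel_measurable_continuous_onI linear_continuous_on) (simp add: linear_conv_bounded_linear)
  have bij: "bij f" by (rule orthogonal_transformation_bij[OF f])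
  have g: "orthogonal_transformation (inv f)" by (rule orthogonal_transformation_inv[OF f])
  have box: "box l u \<in> lmeasurable" by simp
  have vimage: "f -` box l u = inv f ` box l u" by (rule bij_vimage_eq_inv_image[OF bij])
  have "f -` box l u \<in> sets borel"
    using measurable_sets[OF meas, of "box l u"] by simp
  then have "emeasure (distr lborel borel f) (box l u) = emeasure lebesgue (f -` box l u)"
    using meas by (simp add: emeasure_distr)
  also have "\<dots> = measure lebesgue (inv f ` box l u)"
    unfolding vimage by (intro emeasure_eq_measure2 measurable_orthogonal_image[OF g box])
  also have "\<dots> = measure lebesgue (box l u)" by (simp add: measure_orthogonal_image[OF g box])
  also have "\<dots> = emeasure lebesgue (box l u)" by (rule emeasure_eq_measure2[OF box, symmetric])
  also have "\<dots> = (\<Prod>b\<in>Basis. (u - l) \<bullet> b)" using lu by simp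
  finally show "emeasure (distr lborel borel f) (box l u) = (\<Prod>b\<in>Basis. (u - l) \<bullet> b)" .
qed simp

lemma Basis_vec2: "Basis = {axis 1 1, axis 2 1 :: real^2}"
  by (auto simp: Basis_vec_def UNIV_2)

lemma Basis_vec3: "Basis = {axis 1 1, axis 2 1, axis 3 1 :: real^3}"
  by (auto simp: Basis_vec_def UNIV_3)

lemma lborel_distr_vec2_complex:
  "distr lborel borel (\<lambda>x::real^2. Complex (x $ 1) (x $ 2)) = lborel"
proof (rule lborel_distr_basis_map)
  let ?T = "\<lambda>x::real^2. Complex (x $ 1) (x $ 2)"
  have T: "?T (axis 1 1) = 1" "?T (axis 2 1) = \<i>" by (auto simp: complex_eq_iff axis_def)
  show "?T \<in> borel_measurable borel"
    unfolding Complex_eq by (intro borel_measurable_continuous_onI continuous_intros)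
  show "bij_betw ?T Basis Basis"
    unfolding Basis_vec2 Basis_complex_def bij_betw_def inj_on_def using T by (auto simp: complex_eq_iff)
  show "?T x \<bullet> ?T b = x \<bullet> b" if "b \<in> Basis" for x b
    using that by (auto simp: Basis_vec2 inner_vec_def sum_2 inner_complex_def axis_def)
qed

lemma lborel_distr_vec3_cylinder:
  "distr lborel borel (\<lambda>x::real^3. (Complex (x $ 1) (x $ 2), x $ 3)) = lborel"
proof (rule lborel_distr_basis_map)
  let ?T = "\<lambda>x::real^3. (Complex (x $ 1) (x $ 2), x $ 3)"
  have T: "?T (axis 1 1) = (1, 0)" "?T (axis 2 1) = (\<i>, 0)" "?T (axis 3 1) = (0, 1)"
    by (auto simp: complex_eq_iff axis_def)
  show "?T \<in> borel_measurable borel"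
    unfolding Complex_eq by (intro borel_measurable_continuous_onI continuous_intros)
  show "bij_betw ?T Basis Basis"
    unfolding Basis_vec3 Basis_prod_def Basis_complex_def bij_betw_def inj_on_def using T
    by (auto simp: complex_eq_iff)
  show "?T x \<bullet> ?T b = x \<bullet> b" if "b \<in> Basis" for x b
    using that by (auto simp: Basis_vec3 inner_vec_def sum_3 inner_complex_def axis_def)
qed

lemma lborel_distr_pair_complex:
  "distr lborel borel (\<lambda>x. Complex (fst x) (snd x)) = lborel"
proof (rule lborel_distr_basis_map)
  let ?T = "\<lambda>x. Complex (fst x) (snd x)"
  show "?T \<in> borel_measurable borel"
    unfolding Complex_eq by (intro borel_measurable_continuous_onI continuous_intros)
  show "bij_betw ?T Basis Basis"
    unfolding Basis_prod_def Basis_complex_def bij_betw_def inj_on_def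
    by (auto simp: complex_eq_iff)
  show "?T x \<bullet> ?T b = x \<bullet> b" if "b \<in> Basis" for x b
    using that by (auto simp: Basis_prod_def inner_complex_def inner_prod_def)
qed

lemma lborel_distr_rotation:
  assumes u: "norm (u::complex) = 1"
  shows "distr lborel borel (\<lambda>z. u * z) = lborel"
proof -
  let ?T = "\<lambda>x::real^2. Complex (x $ 1) (x $ 2)"
  define f :: "real^2 \<Rightarrow> real^2" where "f = (\<lambda>x. vector [Re (u * ?T x), Im (u * ?T x)])"
  have Tf: "?T (f x) = u * ?T x" for x by (simp add: f_def complex_eq_iff)
  have "linear f"
    by (rule linearI) (auto simp: f_def vec_eq_iff forall_2 algebra_simps)
  moreover have "norm (f x) = norm x" for x
  proof -
    have n: "norm y = norm (?T y)" for y :: "real^2"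
      by (simp add: norm_vec_def L2_set_def sum_2 cmod_def)
    show ?thesis unfolding n[of "f x"] Tf norm_mult u by (simp add: n)
  qed
  ultimately have "orthogonal_transformation f" by (simp add: orthogonal_transformation)
  note f = lborel_distr_orthogonal[OF this]
  have [measurable]: "?T \<in> borel_measurable borel" "f \<in> borel_measurable borel"
    unfolding Complex_eq using linear_continuous_on[of f UNIV] \<open>linear f\<close>
    by (auto intro!: borel_measurable_continuous_onI continuous_intros simp: linear_conv_bounded_linear)
  have "distr lborel borel (\<lambda>z. u * z) = distr (distr lborel borel ?T) borel (\<lambda>z. u * z)"
    by (simp only: lborel_distr_vec2_complex)
  also have "\<dots> = distr lborel borel (\<lambda>x. ?T (f x))"
    by (subst distr_distr) (auto simp: o_def Tf)
  also have "\<dots> = distr (distr lborel borel f) borel ?T"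
    by (subst distr_distr) (auto simp: o_def)
  also have "\<dots> = lborel" by (simp only: f lborel_distr_vec2_complex)
  finally show ?thesis .
qed

text \<open>Polar coordinates for radial functions need no parametrisation: both measures agree on the sets
\<open>{..x}\<close>, by the area \<open>\<pi> x\<^sup>2\<close> of the disc.\<close>
lemma lborel_distr_cmod:
  "distr lborel borel (norm :: complex \<Rightarrow> real) = density lborel (\<lambda>r. ennreal (2 * pi * max 0 r))"
proof (rule measure_eqI_generator_eq)
  let ?E = "range (\<lambda>a. {..a::real})"
  show "Int_stable ?E" by (auto simp: Int_stable_def)
  show "?E \<subseteq> Pow UNIV" "range (\<lambda>n. {..real n}) \<subseteq> ?E" by auto
  show "(\<Union>n. {..real n}) = UNIV" by (auto intro: real_arch_simple)
  have [simp]: "sets borel = sigma_sets UNIV ?E" by (subst borel_eq_atMost) simp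
  show "sets (distr lborel borel (norm :: complex \<Rightarrow> real)) = sigma_sets UNIV ?E"
    "sets (density lborel (\<lambda>r::real. ennreal (2 * pi * max 0 r))) = sigma_sets UNIV ?E" by simp_all
  have L: "emeasure (distr lborel borel (norm :: complex \<Rightarrow> real)) {..x} = ennreal (pi * (max 0 x)\<^sup>2)" for x
  proof -
    have "emeasure (distr lborel borel (norm :: complex \<Rightarrow> real)) {..x} = emeasure lborel (norm -` {..x} :: complex set)"
      by (subst emeasure_distr) auto
    also have "(norm -` {..x} :: complex set) = cball 0 x" by auto
    also have "emeasure lborel (cball 0 x :: complex set) = ennreal (pi * (max 0 x)\<^sup>2)"
    proof (cases "x \<ge> 0")
      case True
      then show ?thesis using emeasure_cball[of x "0::complex"] by (simp add: unit_ball_vol_2)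
    next
      case False
      then have "cball (0::complex) x = {}" by simp
      then show ?thesis using False by simp
    qed
    finally show ?thesis .
  qed
  then show "emeasure (distr lborel borel (norm :: complex \<Rightarrow> real)) {..real n} \<noteq> \<infinity>" for n by simp
  fix X assume "X \<in> ?E"
  then obtain x where X: "X = {..x}" by auto
  have "emeasure (density lborel (\<lambda>r. ennreal (2 * pi * max 0 r))) {..x} =
      (\<integral>\<^sup>+r. ennreal (2 * pi * max 0 r) * indicator {..x} r \<partial>lborel)"
    by (subst emeasure_density) auto
  also have "\<dots> = (\<integral>\<^sup>+r. ennreal (2 * pi * r) * indicator {0..max 0 x} r \<partial>lborel)"
    by (intro nn_integral_cong) (auto simp: indicator_def max_def)
  also have "\<dots> = ennreal (pi * (max 0 x)\<^sup>2 - pi * 0\<^sup>2)"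
    by (rule nn_integral_FTC_Icc) (auto intro!: derivative_eq_intros)
  finally show "emeasure (distr lborel borel (norm :: complex \<Rightarrow> real)) X =
      emeasure (density lborel (\<lambda>r. ennreal (2 * pi * max 0 r))) X"
    by (simp add: X L)
qed

lemma nn_integral_radial:
  assumes [measurable]: "f \<in> borel_measurable borel"
  shows "(\<integral>\<^sup>+z. f (norm (z::complex)) \<partial>lborel) = (\<integral>\<^sup>+r. ennreal (2 * pi * max 0 r) * f r \<partial>lborel)"
proof -
  have "(\<integral>\<^sup>+z. f (norm (z::complex)) \<partial>lborel) = (\<integral>\<^sup>+r. f r \<partial>distr lborel borel (norm :: complex \<Rightarrow> real))"
    by (subst nn_integral_distr) auto
  also have "\<dots> = (\<integral>\<^sup>+r. ennreal (2 * pi * max 0 r) * f r \<partial>lborel)"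
    unfolding lborel_distr_cmod by (subst nn_integral_density) auto
  finally show ?thesis .
qed

lemma integral_radial:
  fixes f :: "real \<Rightarrow> complex"
  assumes [measurable]: "f \<in> borel_measurable borel"
  shows "(\<integral>z. f (norm (z::complex)) \<partial>lborel) = (\<integral>r. (2 * pi * max 0 r) *\<^sub>R f r \<partial>lborel)"
proof -
  have "(\<integral>z. f (norm (z::complex)) \<partial>lborel) = (\<integral>r. f r \<partial>distr lborel borel (norm :: complex \<Rightarrow> real))"
    by (subst integral_distr) auto
  also have "\<dots> = (\<integral>r. (2 * pi * max 0 r) *\<^sub>R f r \<partial>lborel)"
    unfolding lborel_distr_cmod by (subst integral_density) auto
  finally show ?thesis .
qed

lemma continuous_on_meridian: "continuous_on S (meridian v)"
  unfolding meridian_def Complex_eq by (intro continuous_intros)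

text \<open>Cylindrical coordinates: after an orthogonal transformation that makes the axis vertical, the meridian
map is \<open>(w, h) \<mapsto> |w| + \<i> h\<close> on \<open>\<complex> \<times> \<real>\<close>, and the horizontal slices are integrated radially.\<close>
lemma emeasure_meridian_vimage:
  assumes v: "norm v = 1" and D [measurable]: "D \<in> sets borel"
  shows "emeasure lborel {p. meridian v p \<in> D} = (\<integral>\<^sup>+z. ennreal (2 * pi * max 0 (Re z)) * indicator D z \<partial>lborel)"
proof -
  obtain f :: "real^3 \<Rightarrow> real^3" where f: "orthogonal_transformation f" "f v = axis 3 1"
    using orthogonal_transformation_exists_1[OF v, of "axis 3 1"] by auto
  let ?T = "\<lambda>x::real^3. (Complex (x $ 1) (x $ 2), x $ 3)"
  let ?G = "\<lambda>q::complex \<times> real. Complex (norm (fst q)) (snd q)"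
  have meridian: "meridian v p = ?G (?T (f p))" for p
  proof -
    have h: "p \<bullet> v = f p $ 3"
      using f by (metis cart_eq_inner_axis orthogonal_transformation_def)
    have lin: "linear f" by (rule orthogonal_transformation_linear[OF f(1)])
    have "norm (p - (p \<bullet> v) *\<^sub>R v) = norm (f (p - (p \<bullet> v) *\<^sub>R v))"
      using f(1) by (simp add: orthogonal_transformation)
    also have "f (p - (p \<bullet> v) *\<^sub>R v) = f p - (f p $ 3) *\<^sub>R axis 3 1"
      using f(2) by (simp add: linear_diff[OF lin] linear_scale[OF lin] h)
    also have "norm \<dots> = norm (Complex (f p $ 1) (f p $ 2))"
      by (simp add: norm_vec_def L2_set_def sum_3 axis_def cmod_def)
    finally show ?thesis by (simp add: meridian_def h)
  qed
  have f_meas [measurable]: "f \<in> borel_measurable borel"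
    using orthogonal_transformation_linear[OF f(1)]
    by (intro borel_measurable_continuous_onI linear_continuous_on) (simp add: linear_conv_bounded_linear)
  have T_meas [measurable]: "?T \<in> borel_measurable borel"
    unfolding Complex_eq by (intro borel_measurable_continuous_onI continuous_intros)
  have G_meas [measurable]: "?G \<in> borel_measurable borel"
    unfolding Complex_eq by (intro borel_measurable_continuous_onI continuous_intros)
  have D': "{q. ?G q \<in> D} \<in> sets borel" using measurable_sets[OF G_meas D] by (simp add: vimage_def)
  have "emeasure lborel {p. meridian v p \<in> D} = emeasure lborel ((\<lambda>p. ?T (f p)) -` {q. ?G q \<in> D})"
    by (simp add: meridian vimage_def)
  also have "\<dots> = emeasure (distr (distr lborel borel f) borel ?T) {q. ?G q \<in> D}"
    using D' by (simp add: distr_distr emeasure_distr o_def)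
  also have "\<dots> = emeasure lborel {q. ?G q \<in> D}"
    unfolding lborel_distr_orthogonal[OF f(1)] lborel_distr_vec3_cylinder by (rule refl)
  also have "\<dots> = (\<integral>\<^sup>+q. indicator D (?G q) \<partial>lborel)"
  proof -
    have "emeasure lborel {q. ?G q \<in> D} = (\<integral>\<^sup>+q. indicator {q. ?G q \<in> D} q \<partial>lborel)"
      using D' by simp
    also have "\<dots> = (\<integral>\<^sup>+q. indicator D (?G q) \<partial>lborel)"
      by (intro nn_integral_cong) (simp add: indicator_def)
    finally show ?thesis .
  qed
  also have "\<dots> = (\<integral>\<^sup>+q. indicator D (?G q) \<partial>(lborel \<Otimes>\<^sub>M lborel))"
    by (simp only: lborel_prod)
  also have "\<dots> = (\<integral>\<^sup>+h. (\<integral>\<^sup>+w. indicator D (?G (w, h)) \<partial>lborel) \<partial>lborel)"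
    by (rule lborel_pair.nn_integral_snd[symmetric]) (simp add: lborel_prod measurable_lborel1)
  also have "\<dots> = (\<integral>\<^sup>+h. (\<integral>\<^sup>+r. ennreal (2 * pi * max 0 r) * indicator D (Complex r h) \<partial>lborel) \<partial>lborel)"
  proof (rule nn_integral_cong)
    fix h :: real
    have "(\<lambda>r. Complex r h) \<in> borel_measurable borel"
      unfolding Complex_eq by (intro borel_measurable_continuous_onI continuous_intros)
    then have "(\<lambda>r. indicator D (Complex r h) :: ennreal) \<in> borel_measurable borel" by measurable
    from nn_integral_radial[OF this]
    show "(\<integral>\<^sup>+w. indicator D (?G (w, h)) \<partial>lborel) =
      (\<integral>\<^sup>+r. ennreal (2 * pi * max 0 r) * indicator D (Complex r h) \<partial>lborel)" by simp
  qed
  also have "\<dots> = (\<integral>\<^sup>+q. ennreal (2 * pi * max 0 (fst q)) * indicator D (Complex (fst q) (snd q)) \<partial>(lborel \<Otimes>\<^sub>M lborel))"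
  proof -
    have "(\<lambda>q. Complex (fst q) (snd q)) \<in> borel_measurable borel" "(\<lambda>q::real \<times> real. max 0 (fst q)) \<in> borel_measurable borel"
      unfolding Complex_eq by (intro borel_measurable_continuous_onI continuous_intros)+
    then have "(\<lambda>q. ennreal (2 * pi * max 0 (fst q)) * indicator D (Complex (fst q) (snd q))) \<in> borel_measurable borel"
      by measurable
    then show ?thesis
      by (subst lborel_pair.nn_integral_snd[symmetric]) (simp_all add: lborel_prod measurable_lborel1)
  qed
  also have "\<dots> = (\<integral>\<^sup>+z. ennreal (2 * pi * max 0 (Re z)) * indicator D z \<partial>distr lborel borel (\<lambda>q. Complex (fst q) (snd q)))"
  proof -
    have [measurable]: "(\<lambda>q. Complex (fst q) (snd q)) \<in> borel_measurable borel" "Re \<in> borel_measurable borel"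
      unfolding Complex_eq by (intro borel_measurable_continuous_onI continuous_intros)+
    show ?thesis by (subst nn_integral_distr) (auto simp: lborel_prod)
  qed
  also have "\<dots> = (\<integral>\<^sup>+z. ennreal (2 * pi * max 0 (Re z)) * indicator D z \<partial>lborel)"
    by (simp only: lborel_distr_pair_complex)
  finally show ?thesis .
qed

section \<open>The Cauchy transform of the distance from the axis\<close>

lemma nn_integral_inverse_distance:
  fixes \<zeta> :: complex
  assumes "0 \<le> r"
  shows "(\<integral>\<^sup>+z. ennreal (1 / norm (\<zeta> - z)) * indicator (cball \<zeta> r) z \<partial>lborel) \<le> ennreal (2 * pi * r)"
proof -
  have "(\<integral>\<^sup>+z. ennreal (1 / norm (\<zeta> - z)) * indicator (cball \<zeta> r) z \<partial>lborel) =
      (\<integral>\<^sup>+z. ennreal (1 / norm (\<zeta> - z)) * indicator (cball \<zeta> r) z \<partial>distr lborel borel ((+) \<zeta>))"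
    by (simp only: lborel_distr_plus)
  also have "\<dots> = (\<integral>\<^sup>+z. ennreal (1 / norm (z::complex)) * indicator {..r} (norm z) \<partial>lborel)"
    by (subst nn_integral_distr) (auto intro!: nn_integral_cong simp: indicator_def dist_norm)
  also have "\<dots> = (\<integral>\<^sup>+x. ennreal (2 * pi * max 0 x) * (ennreal (1 / x) * indicator {..r} x) \<partial>lborel)"
    by (rule nn_integral_radial) measurable
  also have "\<dots> \<le> (\<integral>\<^sup>+x. ennreal (2 * pi) * indicator {0..r} x \<partial>lborel)"
  proof (rule nn_integral_mono)
    fix x :: real
    have "ennreal (2 * pi * x) * ennreal (1 / x) = ennreal (2 * pi)" if "x > 0"
      using that by (subst ennreal_mult'[symmetric]) auto
    then show "ennreal (2 * pi * max 0 x) * (ennreal (1 / x) * indicator {..r} x) \<le>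
        ennreal (2 * pi) * indicator {0..r} x"
      by (cases "x > 0") (auto simp: indicator_def max_def)
  qed
  also have "\<dots> = ennreal (2 * pi * r)"
    using assms by (subst nn_integral_cmult_indicator) (auto simp: ennreal_mult')
  finally show ?thesis .
qed

text \<open>The bound is uniform in \<open>\<zeta>\<close>, as Fubini's theorem along a curve requires.\<close>
lemma integrable_Cauchy_kernel:
  fixes \<zeta> :: complex
  assumes "norm \<zeta> \<le> R"
  shows "integrable lborel (\<lambda>z. indicator (cball 0 R) z *\<^sub>R (of_real (Re z) / (\<zeta> - z)))"
    and "(\<integral>z. norm (indicator (cball 0 R) z *\<^sub>R (of_real (Re z) / (\<zeta> - z))) \<partial>lborel) \<le> R * (4 * pi * R)"
proof -
  let ?f = "\<lambda>z. indicator (cball 0 R) z *\<^sub>R (of_real (Re z) / (\<zeta> - z))"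
  have "0 \<le> R" using assms norm_ge_zero order_trans by blast
  have [measurable]: "(\<lambda>z. complex_of_real (Re z)) \<in> borel_measurable borel"
    by (intro borel_measurable_continuous_onI continuous_intros)
  have meas: "?f \<in> borel_measurable lborel"
    by (intro borel_measurable_scaleR borel_measurable_indicator borel_measurable_divide) auto
  have le: "(\<integral>\<^sup>+z. ennreal (norm (?f z)) \<partial>lborel) \<le> ennreal (R * (4 * pi * R))"
  proof -
    have "(\<integral>\<^sup>+z. ennreal (norm (?f z)) \<partial>lborel) \<le>
        (\<integral>\<^sup>+z. ennreal R * (ennreal (1 / norm (\<zeta> - z)) * indicator (cball \<zeta> (2 * R)) z) \<partial>lborel)"
    proof (rule nn_integral_mono)
      fix z
      have "\<bar>Re z\<bar> \<le> R" if "norm z \<le> R" using abs_Re_le_cmod[of z] that by linarith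
      moreover have "norm (\<zeta> - z) \<le> 2 * R" if "norm z \<le> R"
        using norm_triangle_ineq4[of \<zeta> z] assms that by linarith
      ultimately show "ennreal (norm (?f z)) \<le>
          ennreal R * (ennreal (1 / norm (\<zeta> - z)) * indicator (cball \<zeta> (2 * R)) z)"
        using \<open>0 \<le> R\<close> by (auto simp: indicator_def dist_norm norm_divide divide_right_mono ennreal_mult'[symmetric] intro!: ennreal_leI)
    qed
    also have "\<dots> \<le> ennreal R * ennreal (2 * pi * (2 * R))"
    proof (subst nn_integral_cmult)
      have "cball \<zeta> (2 * R) \<in> sets borel" by simp
      then show "(\<lambda>z. ennreal (1 / norm (\<zeta> - z)) * indicator (cball \<zeta> (2 * R)) z) \<in> borel_measurable lborel"
        by measurable
    qed (use \<open>0 \<le> R\<close> in \<open>intro mult_left_mono nn_integral_inverse_distance, auto\<close>)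
    also have "\<dots> = ennreal (R * (4 * pi * R))"
      using \<open>0 \<le> R\<close> by (subst ennreal_mult'[symmetric]) (auto simp: mult_ac)
    finally show ?thesis .
  qed
  then show "integrable lborel ?f"
    by (intro integrableI_bounded meas) (auto intro: order.strict_trans1)
  have "(\<integral>z. norm (?f z) \<partial>lborel) = enn2real (\<integral>\<^sup>+z. ennreal (norm (?f z)) \<partial>lborel)"
    by (rule integral_eq_nn_integral[OF measurable_compose[OF meas borel_measurable_norm]]) simp
  also have "\<dots> \<le> R * (4 * pi * R)"
    using le \<open>0 \<le> R\<close> by (intro enn2real_leI) auto
  finally show "(\<integral>z. norm (?f z) \<partial>lborel) \<le> R * (4 * pi * R)" .
qed

text \<open>On the circle \<open>|w| = \<rho>\<close> one has \<open>2 Re w = w + \<rho>\<^sup>2 / w\<close>, so the mean value is the contour integral of a rational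
function.  Its partial fractions have poles at \<open>0\<close> and at \<open>\<zeta>\<close>, the latter inside the circle or not.\<close>
lemma circle_mean_Cauchy_kernel:
  fixes z \<zeta> :: complex
  defines "u \<equiv> \<lambda>\<theta>. exp (2 * of_real pi * \<i> * of_real \<theta>)"
  assumes "\<zeta> \<noteq> 0" "z \<noteq> 0" "norm z \<noteq> norm \<zeta>"
  shows "((\<lambda>\<theta>. of_real (Re (u \<theta> * z)) / (\<zeta> - u \<theta> * z)) has_integral
    (if norm z < norm \<zeta> then of_real ((norm z)\<^sup>2) / (2 * \<zeta>\<^sup>2) else - 1 / 2)) {0..1}"
proof -
  define \<rho> where "\<rho> = norm z"
  have \<rho>: "\<rho> > 0" "\<rho> \<noteq> norm \<zeta>" using assms by (auto simp: \<rho>_def)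
  let ?C = "circlepath 0 \<rho>"
  have img: "path_image ?C = sphere 0 \<rho>" using \<rho> by simp
  (* The partial fraction expansion of Re w / (w (\<zeta> - w)) for |w| = \<rho>. *)
  define \<phi> where "\<phi> = (\<lambda>w. 1/2 * (of_real (\<rho>\<^sup>2) / \<zeta>\<^sup>2 * (1 / (w - 0)) + of_real (\<rho>\<^sup>2) / \<zeta> * (1 / w\<^sup>2)
      - (1 + of_real (\<rho>\<^sup>2) / \<zeta>\<^sup>2) * (1 / (w - \<zeta>))))"
  define W :: complex where "W = (if \<rho> < norm \<zeta> then 0 else 1)"
  have "winding_number ?C \<zeta> = W"
  proof (cases "\<rho> < norm \<zeta>")
    case True
    then show ?thesis
      using winding_number_zero_outside[of ?C "cball 0 \<rho>" \<zeta>] \<rho> img by (simp add: W_def)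
  next
    case False
    then show ?thesis
      using winding_number_circlepath[of \<zeta> 0 \<rho>] \<rho> by (simp add: W_def)
  qed
  then have c: "((\<lambda>w. 1 / (w - \<zeta>)) has_contour_integral 2 * pi * \<i> * W) ?C"
    using has_contour_integral_winding_number[of ?C \<zeta>] \<rho> img by auto
  have a: "((\<lambda>w. 1 / (w - 0)) has_contour_integral 2 * pi * \<i> * 1) ?C"
    using has_contour_integral_winding_number[of ?C 0] winding_number_circlepath_centre[of \<rho> 0] \<rho> img by auto
  have "((\<lambda>w. 1 / w\<^sup>2) has_contour_integral (- 1 / pathfinish ?C - (- 1 / pathstart ?C))) ?C"
  proof (rule contour_integral_primitive[where S="- {0}"])
    show "((\<lambda>w. - 1 / w) has_field_derivative 1 / w\<^sup>2) (at w within - {0})" if "w \<in> - {0}" for w :: complex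
      using that by (auto intro!: derivative_eq_intros simp: power2_eq_square)
  qed (use \<rho> img in auto)
  then have b: "((\<lambda>w. 1 / w\<^sup>2) has_contour_integral 0) ?C" by simp
  have "(\<phi> has_contour_integral 1/2 * (of_real (\<rho>\<^sup>2) / \<zeta>\<^sup>2 * (2 * pi * \<i> * 1) + of_real (\<rho>\<^sup>2) / \<zeta> * 0
      - (1 + of_real (\<rho>\<^sup>2) / \<zeta>\<^sup>2) * (2 * pi * \<i> * W))) ?C"
    unfolding \<phi>_def
    by (intro has_contour_integral_lmul has_contour_integral_add has_contour_integral_diff a b c)
  moreover define g where "g = (if \<rho> < norm \<zeta> then of_real (\<rho>\<^sup>2) / (2 * \<zeta>\<^sup>2) else - 1 / 2)"
  have "1/2 * (of_real (\<rho>\<^sup>2) / \<zeta>\<^sup>2 * (2 * pi * \<i> * 1) + of_real (\<rho>\<^sup>2) / \<zeta> * 0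
      - (1 + of_real (\<rho>\<^sup>2) / \<zeta>\<^sup>2) * (2 * pi * \<i> * W)) = 2 * pi * \<i> * g"
    by (simp add: g_def W_def algebra_simps)
  ultimately have "(\<phi> has_contour_integral 2 * pi * \<i> * g) ?C" by (simp only:)
  (* The loop through z is the standard circle, started at the argument of z. *)
  moreover define a where "a = Arg2pi z / (2 * pi)"
  have a01: "a \<in> {0..1}" using Arg2pi[of z] by (auto simp: a_def field_simps)
  ultimately have int: "(\<phi> has_contour_integral 2 * pi * \<i> * g) (shiftpath a ?C)"
    by (intro has_contour_integral_shiftpath) auto
  have u_add: "u (x + y) = u x * u y" for x y
    by (simp add: u_def exp_add[symmetric] algebra_simps)
  have u_minus: "u (x - 1) = u x" for x
    by (simp add: u_def algebra_simps exp_diff)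
  have z: "z = of_real \<rho> * u a"
    using Arg2pi_eq[of z] assms by (simp add: a_def u_def \<rho>_def mult_ac)
  have C: "?C \<theta> = of_real \<rho> * u \<theta>" for \<theta> by (simp add: circlepath u_def)
  have shift: "shiftpath a ?C = (\<lambda>\<theta>. u \<theta> * z)"
    by (auto simp: shiftpath_def C fun_eq_iff u_minus u_add z)
  have vd: "vector_derivative (\<lambda>\<theta>. u \<theta> * z) (at \<theta> within {0..1}) = 2 * pi * \<i> * (u \<theta> * z)"
    if "\<theta> \<in> {0..1}" for \<theta>
  proof (rule vector_derivative_at_within_ivl[of _ _ _ 0 1])
    have "((\<lambda>\<theta>. exp (2 * of_real pi * \<i> * of_real \<theta>)) has_vector_derivative
      (2 * of_real pi * \<i>) * exp (2 * of_real pi * \<i> * of_real \<theta>)) (at \<theta>)"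
      by (rule has_vector_derivative_real_field) (auto intro!: derivative_eq_intros)
    then have "((\<lambda>\<theta>. u \<theta> * z) has_vector_derivative ((2 * of_real pi * \<i>) * u \<theta>) * z) (at \<theta>)"
      unfolding u_def by (rule has_vector_derivative_mult_left)
    then show "((\<lambda>\<theta>. u \<theta> * z) has_vector_derivative 2 * pi * \<i> * (u \<theta> * z)) (at \<theta>)"
      by (simp add: mult_ac)
  qed (use that in auto)
  have \<phi>: "\<phi> w * w = of_real (Re w) / (\<zeta> - w)" if w: "norm w = \<rho>" for w
  proof -
    have "w \<noteq> 0" "w \<noteq> \<zeta>" using w \<rho> by auto
    have "w * cnj w = of_real (\<rho>\<^sup>2)" using w by (simp add: complex_norm_square[symmetric])
    then have "w\<^sup>2 + of_real (\<rho>\<^sup>2) = w * (w + cnj w)"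
      by (simp add: power2_eq_square distrib_left)
    then have Re: "of_real (Re w) = (w\<^sup>2 + of_real (\<rho>\<^sup>2)) / (2 * w)"
      using \<open>w \<noteq> 0\<close> by (simp add: complex_add_cnj)
    have "\<phi> w * w = (w\<^sup>2 + of_real (\<rho>\<^sup>2)) / (2 * w * (\<zeta> - w))"
      unfolding \<phi>_def using \<open>w \<noteq> 0\<close> \<open>w \<noteq> \<zeta>\<close> assms(2)
      by (simp add: divide_simps) (simp add: algebra_simps power2_eq_square)
    then show ?thesis unfolding Re by simp
  qed
  have "((\<lambda>\<theta>. \<phi> (u \<theta> * z) * (2 * pi * \<i> * (u \<theta> * z))) has_integral 2 * pi * \<i> * g) {0..1}"
    using int unfolding shift has_contour_integral_def
    by (rule has_integral_cong[THEN iffD1, rotated]) (simp add: vd)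
  from has_integral_mult_right[OF this, of "1 / (2 * pi * \<i>)"]
  have mean: "((\<lambda>\<theta>. \<phi> (u \<theta> * z) * (u \<theta> * z)) has_integral g) {0..1}" by (simp add: mult_ac)
  have norm_u: "norm (u \<theta> * z) = \<rho>" for \<theta>
    by (simp add: u_def norm_mult norm_exp_eq_Re \<rho>_def)
  show ?thesis using mean unfolding \<phi>[OF norm_u] g_def \<rho>_def .
qed

text \<open>Replaces polar coordinates for functions that are not radial: by rotation invariance and Fubini's
theorem a function may be replaced by its means over circles.\<close>
lemma integral_rotation_average:
  fixes f :: "complex \<Rightarrow> complex"
  defines "u \<equiv> \<lambda>\<theta>. exp (2 * of_real pi * \<i> * of_real \<theta>)"
  assumes f: "integrable lborel f"
  shows "(\<integral>z. f z \<partial>lborel) = (\<integral>z. (\<integral>\<theta>. indicator {0..1::real} \<theta> *\<^sub>R f (u \<theta> * z) \<partial>lborel) \<partial>lborel)"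
proof -
  have [measurable]: "f \<in> borel_measurable borel" using f by simp
  have [measurable]: "u \<in> borel_measurable borel"
    unfolding u_def by (intro borel_measurable_continuous_onI continuous_intros)
  have u: "norm (u \<theta>) = 1" for \<theta> by (simp add: u_def norm_exp_eq_Re)
  have rot: "integrable lborel (\<lambda>z. g (u \<theta> * z))" "(\<integral>z. g (u \<theta> * z) \<partial>lborel) = (\<integral>z. g z \<partial>lborel)"
    if g: "integrable lborel g" for g :: "complex \<Rightarrow> 'b::{banach, second_countable_topology}" and \<theta>
  proof -
    have [measurable]: "g \<in> borel_measurable borel" using g by simp
    have "integrable (distr lborel borel (\<lambda>z. u \<theta> * z)) g"
      using g by (simp only: lborel_distr_rotation[OF u])
    then show "integrable lborel (\<lambda>z. g (u \<theta> * z))" by (subst (asm) integrable_distr_eq) auto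
    have "(\<integral>z. g z \<partial>lborel) = (\<integral>z. g z \<partial>distr lborel borel (\<lambda>z. u \<theta> * z))"
      by (simp only: lborel_distr_rotation[OF u])
    also have "\<dots> = (\<integral>z. g (u \<theta> * z) \<partial>lborel)" by (subst integral_distr) auto
    finally show "(\<integral>z. g (u \<theta> * z) \<partial>lborel) = (\<integral>z. g z \<partial>lborel)" by simp
  qed
  have norm_f: "integrable lborel (\<lambda>z. norm (f z))" using f by (rule integrable_norm)
  have "integrable (lborel \<Otimes>\<^sub>M lborel) (\<lambda>(\<theta>, z). indicator {0..1::real} \<theta> *\<^sub>R f (u \<theta> * z))"
  proof (rule lborel_pair.Fubini_integrable)
    show "integrable lborel (\<lambda>\<theta>. \<integral>z. norm (case (\<theta>, z) of (\<theta>, z) \<Rightarrow> indicator {0..1::real} \<theta> *\<^sub>R f (u \<theta> * z)) \<partial>lborel)"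
      by (simp add: rot(2)[OF norm_f] integrable_real_mult_indicator)
    show "AE \<theta> in lborel. integrable lborel (\<lambda>z. case (\<theta>, z) of (\<theta>, z) \<Rightarrow> indicator {0..1::real} \<theta> *\<^sub>R f (u \<theta> * z))"
      using rot(1)[OF f] by simp
  qed measurable
  from lborel_pair.Fubini_integral[OF this]
  have "(\<integral>z. (\<integral>\<theta>. indicator {0..1::real} \<theta> *\<^sub>R f (u \<theta> * z) \<partial>lborel) \<partial>lborel) =
    (\<integral>\<theta>. (\<integral>z. indicator {0..1::real} \<theta> *\<^sub>R f (u \<theta> * z) \<partial>lborel) \<partial>lborel)" .
  also have "\<dots> = (\<integral>\<theta>. indicator {0..1::real} \<theta> *\<^sub>R (\<integral>z. f z \<partial>lborel) \<partial>lborel)"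
    by (simp add: rot(2)[OF f])
  also have "\<dots> = (\<integral>z. f z \<partial>lborel)" by simp
  finally show ?thesis by simp
qed

lemma integral_FTC_indicator:
  fixes F :: "real \<Rightarrow> complex"
  assumes "a \<le> b" "\<And>x. (F has_vector_derivative f x) (at x)" "continuous_on UNIV f"
  shows "(\<integral>x. indicator {a..b} x *\<^sub>R f x \<partial>lborel) = F b - F a"
    and "integrable lborel (\<lambda>x. indicator {a..b} x *\<^sub>R f x)"
proof -
  have c: "continuous_on {a..b} f" by (rule continuous_on_subset[OF assms(3)]) simp
  show "(\<integral>x. indicator {a..b} x *\<^sub>R f x \<partial>lborel) = F b - F a"
    using assms(1,2) c by (intro integral_FTC_atLeastAtMost) (auto intro: has_vector_derivative_at_within)
  show "integrable lborel (\<lambda>x. indicator {a..b} x *\<^sub>R f x)"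
    using borel_integrable_atLeastAtMost'[OF c] by (simp add: set_integrable_def)
qed

text \<open>The formula equals \<open>\<pi> ((Re \<zeta>)\<^sup>2 - \<zeta>\<^sup>2 / 4 - R\<^sup>2 / 2)\<close>.  It is found by integrating the circle means over the
radius, separately over \<open>r < |\<zeta>|\<close> and \<open>r > |\<zeta>|\<close>.\<close>
lemma Cauchy_transform_Re:
  fixes \<zeta> :: complex
  assumes "\<zeta> \<noteq> 0" "norm \<zeta> \<le> R"
  shows "(\<integral>z. indicator (cball 0 R) z *\<^sub>R (of_real (Re z) / (\<zeta> - z)) \<partial>lborel) =
    of_real pi * ((cnj \<zeta>)\<^sup>2 / 4 + of_real ((norm \<zeta>)\<^sup>2) / 2 - of_real (R\<^sup>2) / 2)"
proof -
  let ?f = "\<lambda>z. indicator (cball 0 R) z *\<^sub>R (of_real (Re z) / (\<zeta> - z))"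
  define u where "u = (\<lambda>\<theta>::real. exp (2 * of_real pi * \<i> * of_real \<theta>))"
  define s where "s = norm \<zeta>"
  have s: "s > 0" "s \<le> R" using assms by (auto simp: s_def)
  define g where "g = (\<lambda>r::real. if r < s then of_real (r\<^sup>2) / (2 * \<zeta>\<^sup>2) else - (1 / 2 :: complex))"
  have [measurable]: "g \<in> borel_measurable borel"
    unfolding g_def by (intro measurable_If borel_measurable_continuous_onI continuous_intros) (use assms in auto)
  have [measurable]: "(\<lambda>z. complex_of_real (Re z)) \<in> borel_measurable borel" "u \<in> borel_measurable borel"
    unfolding u_def by (intro borel_measurable_continuous_onI continuous_intros)+
  have norm_u: "norm (u \<theta> * z) = norm z" for \<theta> z by (simp add: u_def norm_mult norm_exp_eq_Re)
  have inner: "(\<integral>\<theta>. indicator {0..1::real} \<theta> *\<^sub>R ?f (u \<theta> * z) \<partial>lborel) = indicator {..R} (norm z) *\<^sub>R g (norm z)"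
    if "norm z \<noteq> s" for z
  proof (cases "z = 0")
    case True
    then show ?thesis using s by (simp add: g_def)
  next
    case False
    let ?k = "\<lambda>\<theta>. of_real (Re (u \<theta> * z)) / (\<zeta> - u \<theta> * z)"
    have I: "(?k has_integral g (norm z)) {0..1}"
    proof -
      have "g (norm z) = (if norm z < norm \<zeta> then of_real ((norm z)\<^sup>2) / (2 * \<zeta>\<^sup>2) else - 1 / 2)"
        by (simp add: g_def s_def)
      then show ?thesis
        using circle_mean_Cauchy_kernel[OF assms(1), of z] False that unfolding u_def s_def by (simp only: simp_thms)
    qed
    have "continuous_on {0..1} ?k"
      unfolding u_def
      by (intro continuous_intros) (use norm_u[of _ z] that in \<open>auto simp: u_def s_def\<close>)
    then have "set_integrable lborel {0..1} ?k" by (rule borel_integrable_atLeastAtMost')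
    then have "(LINT \<theta>:{0..1}|lborel. ?k \<theta>) = g (norm z)"
      using set_borel_integral_eq_integral(2) integral_unique[OF I] by metis
    then have "(\<integral>\<theta>. indicator {0..1::real} \<theta> *\<^sub>R ?k \<theta> \<partial>lborel) = g (norm z)"
      by (simp add: set_lebesgue_integral_def)
    moreover have "indicator {0..1::real} \<theta> *\<^sub>R ?f (u \<theta> * z) =
       indicator {..R} (norm z) *\<^sub>R (indicator {0..1::real} \<theta> *\<^sub>R ?k \<theta>)" for \<theta>
      using norm_u[of \<theta> z] by (simp add: indicator_def)
    ultimately show ?thesis by (simp only: integral_scaleR_right)
  qed
  have meas_f: "?f \<in> borel_measurable borel"
    by (intro borel_measurable_scaleR borel_measurable_indicator borel_measurable_divide) auto
  have "(\<integral>z. ?f z \<partial>lborel) = (\<integral>z. (\<integral>\<theta>. indicator {0..1::real} \<theta> *\<^sub>R ?f (u \<theta> * z) \<partial>lborel) \<partial>lborel)"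
    unfolding u_def by (rule integral_rotation_average[OF integrable_Cauchy_kernel(1)[OF assms(2)]])
  also have "\<dots> = (\<integral>z. indicator {..R} (norm z) *\<^sub>R g (norm (z::complex)) \<partial>lborel)"
  proof (rule integral_cong_AE)
    have "sphere 0 s \<in> null_sets (lborel :: complex measure)"
      using negligible_sphere[of "0::complex" s] by (simp add: negligible_iff_null_sets null_sets_completion_iff)
    from AE_not_in[OF this]
    show "AE z in lborel. (\<integral>\<theta>. indicator {0..1::real} \<theta> *\<^sub>R ?f (u \<theta> * z) \<partial>lborel) = indicator {..R} (norm z) *\<^sub>R g (norm z)"
      by eventually_elim (rule inner, simp)
    have [measurable]: "(\<lambda>(z, \<theta>). ?f (u \<theta> * z)) \<in> borel_measurable (borel \<Otimes>\<^sub>M borel)"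
      using measurable_compose[OF _ meas_f, of "\<lambda>(z, \<theta>). u \<theta> * z" "borel \<Otimes>\<^sub>M borel"] by (simp add: case_prod_unfold)
    show "(\<lambda>z. \<integral>\<theta>. indicator {0..1::real} \<theta> *\<^sub>R ?f (u \<theta> * z) \<partial>lborel) \<in> borel_measurable lborel"
      by measurable
    show "(\<lambda>z::complex. indicator {..R} (norm z) *\<^sub>R g (norm z)) \<in> borel_measurable lborel"
      by measurable
  qed
  also have "\<dots> = (\<integral>r. (2 * pi * max 0 r) *\<^sub>R (indicator {..R} r *\<^sub>R g r) \<partial>lborel)"
    by (rule integral_radial) measurable
  also have "\<dots> = (\<integral>r. indicator {0..s} r *\<^sub>R (of_real (pi * r ^ 3) / \<zeta>\<^sup>2) + indicator {s..R} r *\<^sub>R (of_real (- pi * r)) \<partial>lborel)"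
  proof (rule integral_cong_AE)
    show "AE r in lborel. (2 * pi * max 0 r) *\<^sub>R (indicator {..R} r *\<^sub>R g r) =
       indicator {0..s} r *\<^sub>R (of_real (pi * r ^ 3) / \<zeta>\<^sup>2) + indicator {s..R} r *\<^sub>R (of_real (- pi * r))"
      using AE_lborel_singleton[of s]
    proof eventually_elim
      fix r assume "r \<noteq> s"
      then consider "r < 0" | "0 \<le> r" "r < s" | "s < r" by linarith
      then show "(2 * pi * max 0 r) *\<^sub>R (indicator {..R} r *\<^sub>R g r) =
         indicator {0..s} r *\<^sub>R (of_real (pi * r ^ 3) / \<zeta>\<^sup>2) + indicator {s..R} r *\<^sub>R (of_real (- pi * r))"
        using s by cases (auto simp: indicator_def g_def scaleR_conv_of_real power3_eq_cube power2_eq_square)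
    qed
    show "(\<lambda>r. indicator {0..s} r *\<^sub>R (of_real (pi * r ^ 3) / \<zeta>\<^sup>2) + indicator {s..R} r *\<^sub>R complex_of_real (- pi * r))
        \<in> borel_measurable lborel"
      using assms by (intro borel_measurable_add borel_measurable_scaleR borel_measurable_indicator
         borel_measurable_divide borel_measurable_of_real) (auto simp: )
  qed measurable
  also have "\<dots> = (of_real (pi * s ^ 4 / 4) / \<zeta>\<^sup>2 - of_real (pi * 0 ^ 4 / 4) / \<zeta>\<^sup>2) +
      (of_real (- pi * R\<^sup>2 / 2) - of_real (- pi * s\<^sup>2 / 2))"
  proof -
    have d1: "((\<lambda>r. of_real (pi * r ^ 4 / 4) / \<zeta>\<^sup>2) has_vector_derivative of_real (pi * r ^ 3) / \<zeta>\<^sup>2) (at r)" for r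
    proof -
      have "((\<lambda>r. pi * r ^ 4 / 4) has_real_derivative pi * r ^ 3) (at r)"
        by (auto intro!: derivative_eq_intros)
      then have "((\<lambda>r. of_real (pi * r ^ 4 / 4)) has_vector_derivative complex_of_real (pi * r ^ 3)) (at r)"
        by (rule has_vector_derivative_of_real)
      then show ?thesis by (rule has_vector_derivative_divide)
    qed
    have d2: "((\<lambda>r. of_real (- pi * r\<^sup>2 / 2)) has_vector_derivative complex_of_real (- pi * r)) (at r)" for r
      by (rule has_vector_derivative_of_real) (auto intro!: derivative_eq_intros)
    have c: "continuous_on UNIV (\<lambda>r. of_real (pi * r ^ 3) / \<zeta>\<^sup>2)" "continuous_on UNIV (\<lambda>r. complex_of_real (- pi * r))"
      using assms by (intro continuous_intros; simp)+
    show ?thesis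
      using integral_FTC_indicator[OF less_imp_le[OF s(1)] d1 c(1)] integral_FTC_indicator[OF s(2) d2 c(2)]
      by (subst Bochner_Integration.integral_add) auto
  qed
  also have "\<dots> = of_real pi * ((cnj \<zeta>)\<^sup>2 / 4 + of_real ((norm \<zeta>)\<^sup>2) / 2 - of_real (R\<^sup>2) / 2)"
  proof -
    have "complex_of_real (s ^ 4) = \<zeta>\<^sup>2 * (cnj \<zeta>)\<^sup>2"
      using complex_norm_square[of \<zeta>] by (simp add: s_def power_mult_distrib[symmetric] power_mult[symmetric] flip: of_real_power)
         (metis (no_types, lifting) of_real_power power2_eq_square power4_eq_xxxx power_mult_distrib mult.assoc)
    then have "of_real (pi * s ^ 4 / 4) / \<zeta>\<^sup>2 = of_real pi * (cnj \<zeta>)\<^sup>2 / 4"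
      using assms(1) by simp
    then show ?thesis by (simp add: s_def algebra_simps)
  qed
  finally show ?thesis .
qed

section \<open>Green's formula for a closed curve\<close>

lemma has_integral_complex_parts:
  assumes "(f has_integral x) S" "(g has_integral y) S"
  shows "((\<lambda>t. of_real (f t) + \<i> * of_real (g t)) has_integral (of_real x + \<i> * of_real y)) S"
proof -
  have "((complex_of_real \<circ> f) has_integral of_real x) S" "((complex_of_real \<circ> g) has_integral of_real y) S"
    by (rule has_integral_linear[OF _ bounded_linear_of_real], fact)+
  then show ?thesis
    unfolding o_def by (intro has_integral_add has_integral_mult_right)
qed

lemma path_image_null_set:
  fixes m m' :: "real \<Rightarrow> complex"
  assumes deriv: "\<And>t. (m has_vector_derivative m' t) (at t)"
  shows "path_image m \<in> null_sets lborel"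
proof -
  have "m differentiable_on {0..1}"
    using deriv by (auto simp: differentiable_on_def intro: differentiableI_vector differentiable_at_withinI)
  then have "negligible (path_image m)"
    unfolding path_image_def by (intro negligible_differentiable_image_lowdim) auto
  moreover have "path m"
    unfolding path_def
    by (intro continuous_at_imp_continuous_on ballI has_vector_derivative_continuous[OF deriv])
  then have "path_image m \<in> sets borel"
    by (intro borel_closed compact_imp_closed compact_path_image)
  ultimately show ?thesis by (simp add: negligible_iff_null_sets null_sets_completion_iff)
qed

text \<open>The curve has to be closed, continuously differentiable and off the centre of the disc, but it may have
self-intersections and singular points.  The function \<open>W\<close> is a measurable choice of the winding number on the curve itself,
which is a null set.\<close>
lemma weighted_area_of_winding_number:
  fixes m m' :: "real \<Rightarrow> complex" and W :: "complex \<Rightarrow> complex"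
  assumes deriv: "\<And>t. (m has_vector_derivative m' t) (at t)" and cont': "continuous_on UNIV m'"
    and W: "W \<in> borel_measurable borel" "\<And>z. z \<notin> path_image m \<Longrightarrow> W z = winding_number m z"
    and closed: "m 0 = m 1" and range: "\<And>t. t \<in> {0..1} \<Longrightarrow> m t \<noteq> 0 \<and> norm (m t) \<le> R"
  shows "(\<integral>z. indicator (cball 0 R) z *\<^sub>R (of_real (Re z) * W z) \<partial>lborel) =
    of_real (1/2 * integral {0..1} (\<lambda>t. (Re (m t))\<^sup>2 * Im (m' t)))"
proof -
  have cont: "continuous_on UNIV m"
    by (intro continuous_at_imp_continuous_on ballI has_vector_derivative_continuous[OF deriv])
  have sub: "continuous_on {0..1} m" "continuous_on {0..1} m'"
    by (rule continuous_on_subset[OF cont], simp, rule continuous_on_subset[OF cont'], simp)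
  have meas: "m \<in> borel_measurable borel" "m' \<in> borel_measurable borel"
    "(\<lambda>z. complex_of_real (Re z)) \<in> borel_measurable borel"
    using cont cont' by (auto intro!: borel_measurable_continuous_onI continuous_intros)
  have valid: "valid_path m"
    unfolding valid_path_def
    by (rule C1_differentiable_imp_piecewise) (use deriv sub in \<open>auto simp: C1_differentiable_on_def\<close>)
  have ends: "pathfinish m = pathstart m" using closed by (simp add: pathstart_def pathfinish_def)
  have null: "path_image m \<in> null_sets lborel" by (rule path_image_null_set[OF deriv])
  define h where "h = (\<lambda>t z. indicator {0..1::real} t *\<^sub>R
     (m' t * (indicator (cball 0 R) z *\<^sub>R (of_real (Re z) / (m t - z)))))"
  have R: "R \<ge> 0" using range[of 0] norm_ge_zero[of "m 0"] by (meson atLeastAtMost_iff order_refl order_trans zero_le_one)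
  have meas_h: "case_prod h \<in> borel_measurable (lborel \<Otimes>\<^sub>M lborel)"
  proof -
    have "(\<lambda>p. h (fst p) (snd p)) \<in> borel_measurable (borel \<Otimes>\<^sub>M borel)"
      unfolding h_def
      by (intro borel_measurable_scaleR borel_measurable_times borel_measurable_divide borel_measurable_diff
        measurable_compose[OF measurable_fst meas(1)] measurable_compose[OF measurable_fst meas(2)]
        measurable_compose[OF measurable_snd meas(3)] measurable_snd
        measurable_compose[OF measurable_fst borel_measurable_indicator]
        measurable_compose[OF measurable_snd borel_measurable_indicator]) auto
    then show ?thesis by (simp add: case_prod_unfold cong: measurable_cong_sets)
  qed
  obtain C where C: "\<And>t. t \<in> {0..1} \<Longrightarrow> norm (m' t) \<le> C"
    using compact_imp_bounded[OF compact_continuous_image[OF sub(2)]] unfolding bounded_iff by blast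
  have "C \<ge> 0" using C[of 0] norm_ge_zero[of "m' 0"] by (meson atLeastAtMost_iff order_refl order_trans zero_le_one)
  have int_h: "integrable (lborel \<Otimes>\<^sub>M lborel) (case_prod h)"
  proof (rule lborel_pair.Fubini_integrable)
    have 1: "norm (\<integral>z. norm (h t z) \<partial>lborel) \<le> norm (indicator {0..1::real} t *\<^sub>R (C * (R * (4 * pi * R))))" for t
    proof (cases "t \<in> {0..1}")
      case True
      have "(\<integral>z. norm (h t z) \<partial>lborel) =
          (\<integral>z. norm (m' t) * norm (indicator (cball 0 R) z *\<^sub>R (of_real (Re z) / (m t - z))) \<partial>lborel)"
        using True by (simp only: h_def norm_mult indicator_simps scaleR_one)
      also have "\<dots> = norm (m' t) * (\<integral>z. norm (indicator (cball 0 R) z *\<^sub>R (of_real (Re z) / (m t - z))) \<partial>lborel)"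
        by (rule integral_mult_right_zero)
      also have "\<dots> \<le> C * (R * (4 * pi * R))"
        using range[OF True] C[OF True] \<open>C \<ge> 0\<close>
        by (intro mult_mono integrable_Cauchy_kernel(2)) auto
      finally show ?thesis using True by (simp add: abs_of_nonneg)
    qed (simp add: h_def)
    have norm_meas: "(\<lambda>t. \<integral>z. norm (h t z) \<partial>lborel) \<in> borel_measurable lborel"
      using measurable_compose[OF meas_h borel_measurable_norm]
      by (intro lborel.borel_measurable_lebesgue_integral) (simp add: case_prod_unfold)
    have bound: "integrable lborel (\<lambda>t. indicator {0..1::real} t *\<^sub>R (C * (R * (4 * pi * R))))"
      by (rule integrable_scaleR_left) simp
    show "integrable lborel (\<lambda>t. \<integral>z. norm (case (t, z) of (t, z) \<Rightarrow> h t z) \<partial>lborel)"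
      unfolding prod.case by (rule Bochner_Integration.integrable_bound[OF bound norm_meas]) (rule AE_I2, rule 1)
    show "AE t in lborel. integrable lborel (\<lambda>z. case (t, z) of (t, z) \<Rightarrow> h t z)"
    proof (rule AE_I2)
      fix t
      show "integrable lborel (\<lambda>z. case (t, z) of (t, z) \<Rightarrow> h t z)"
      proof (cases "t \<in> {0..1}")
        case True
        then show ?thesis
          unfolding prod.case h_def using range[OF True]
          by (intro integrable_scaleR_right integrable_mult_right integrable_Cauchy_kernel(1)) auto
      qed (simp add: h_def)
    qed
  qed (rule meas_h)
  define J where "J = integral {0..1} (\<lambda>t. (Re (m t))\<^sup>2 * Im (m' t))"
  have Re': "((\<lambda>t. Re (m t)) has_vector_derivative Re (m' t)) (at t)"
    and Im': "((\<lambda>t. Im (m t)) has_vector_derivative Im (m' t)) (at t)" for t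
    by (rule bounded_linear.has_vector_derivative[OF bounded_linear_Re deriv]
         bounded_linear.has_vector_derivative[OF bounded_linear_Im deriv])+
  have "((\<lambda>t. (Re (m t))\<^sup>2 * Re (m' t)) has_integral ((Re (m 1)) ^ 3 / 3 - (Re (m 0)) ^ 3 / 3)) {0..1}"
  proof (rule fundamental_theorem_of_calculus)
    fix t :: real
    have "((\<lambda>t. (Re (m t)) ^ 3 / 3) has_real_derivative (Re (m t))\<^sup>2 * Re (m' t)) (at t)"
      using DERIV_cdivide[OF DERIV_power[OF Re'[of t, folded has_real_derivative_iff_has_vector_derivative], of 3], of 3]
      by (simp add: mult.commute)
    then show "((\<lambda>t. (Re (m t)) ^ 3 / 3) has_vector_derivative (Re (m t))\<^sup>2 * Re (m' t)) (at t within {0..1})"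
      by (simp add: has_real_derivative_iff_has_vector_derivative has_vector_derivative_at_within)
  qed simp
  then have "((\<lambda>t. (Re (m t))\<^sup>2 * Re (m' t)) has_integral 0) {0..1}" using closed by simp
  moreover have "((\<lambda>t. (Re (m t))\<^sup>2 * Im (m' t)) has_integral J) {0..1}"
    unfolding J_def by (intro integrable_integral integrable_continuous_real continuous_intros sub)
  ultimately have J: "((\<lambda>t. of_real ((Re (m t))\<^sup>2 * Re (m' t)) + \<i> * of_real ((Re (m t))\<^sup>2 * Im (m' t)))
      has_integral (of_real 0 + \<i> * of_real J)) {0..1}"
    by (rule has_integral_complex_parts)
  have "((\<lambda>t. m' t * ((m t)\<^sup>2 / 4 + of_real (R\<^sup>2) / 2)) has_integral
      ((m 1) ^ 3 / 12 + of_real (R\<^sup>2) / 2 * m 1 - ((m 0) ^ 3 / 12 + of_real (R\<^sup>2) / 2 * m 0))) {0..1}"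
  proof (rule fundamental_theorem_of_calculus)
    fix t :: real
    have "((\<lambda>w. w ^ 3 / 12 + of_real (R\<^sup>2) / 2 * w) has_field_derivative ((m t)\<^sup>2 / 4 + of_real (R\<^sup>2) / 2)) (at (m t))"
      by (auto intro!: derivative_eq_intros)
    from field_vector_diff_chain_at[OF deriv[of t] this]
    show "((\<lambda>t. (m t) ^ 3 / 12 + of_real (R\<^sup>2) / 2 * m t) has_vector_derivative
        m' t * ((m t)\<^sup>2 / 4 + of_real (R\<^sup>2) / 2)) (at t within {0..1})"
      unfolding o_def by (rule has_vector_derivative_at_within)
  qed simp
  then have hol: "((\<lambda>t. m' t * ((m t)\<^sup>2 / 4 + of_real (R\<^sup>2) / 2)) has_integral 0) {0..1}" using closed by simp
  define K where "K = (\<lambda>\<zeta>. of_real pi * ((cnj \<zeta>)\<^sup>2 / 4 + of_real ((norm \<zeta>)\<^sup>2) / 2 - of_real (R\<^sup>2) / 2))"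
  have K: "m' t * K (m t) = of_real pi * ((of_real ((Re (m t))\<^sup>2 * Re (m' t)) + \<i> * of_real ((Re (m t))\<^sup>2 * Im (m' t)))
      - m' t * ((m t)\<^sup>2 / 4 + of_real (R\<^sup>2) / 2))" for t
  proof -
    let ?w = "m t"
    have "complex_of_real ((Re ?w)\<^sup>2) = (?w\<^sup>2 + 2 * of_real ((norm ?w)\<^sup>2) + (cnj ?w)\<^sup>2) / 4"
      using cmod_power2[of ?w] by (simp add: complex_eq_iff power2_eq_square)
    moreover have "of_real ((Re ?w)\<^sup>2 * Re (m' t)) + \<i> * of_real ((Re ?w)\<^sup>2 * Im (m' t)) =
        m' t * complex_of_real ((Re ?w)\<^sup>2)"
      by (simp add: complex_eq_iff)
    ultimately show ?thesis by (simp add: K_def algebra_simps add_divide_distrib)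
  qed
  have "((\<lambda>t. m' t * K (m t)) has_integral of_real pi * ((of_real 0 + \<i> * of_real J) - 0)) {0..1}"
    unfolding K by (intro has_integral_mult_right has_integral_diff J hol)
  then have K_int: "((\<lambda>t. m' t * K (m t)) has_integral of_real pi * \<i> * of_real J) {0..1}"
    by (simp only: of_real_0 add_0_left diff_0_right mult.assoc)
  have "(\<integral>z. (\<integral>t. h t z \<partial>lborel) \<partial>lborel) = (\<integral>t. (\<integral>z. h t z \<partial>lborel) \<partial>lborel)"
    by (rule lborel_pair.Fubini_integral[OF int_h])
  also have "\<dots> = (\<integral>t. indicator {0..1::real} t *\<^sub>R (m' t * K (m t)) \<partial>lborel)"
  proof (rule Bochner_Integration.integral_cong[OF refl])
    fix t
    show "(\<integral>z. h t z \<partial>lborel) = indicator {0..1::real} t *\<^sub>R (m' t * K (m t))"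
    proof (cases "t \<in> {0..1}")
      case True
      then have "(\<integral>z. h t z \<partial>lborel) = (\<integral>z. m' t * (indicator (cball 0 R) z *\<^sub>R (of_real (Re z) / (m t - z))) \<partial>lborel)"
        by (simp add: h_def)
      also have "\<dots> = m' t * K (m t)"
        unfolding integral_mult_right_zero K_def using Cauchy_transform_Re range[OF True] by simp
      finally show ?thesis using True by simp
    qed (simp add: h_def)
  qed
  also have "\<dots> = of_real pi * \<i> * of_real J"
  proof -
    have "set_integrable lborel {0..1} (\<lambda>t. m' t * K (m t))"
      unfolding K_def by (intro borel_integrable_atLeastAtMost' continuous_intros sub) auto
    from set_borel_integral_eq_integral(2)[OF this] show ?thesis
      using integral_unique[OF K_int] by (simp add: set_lebesgue_integral_def)
  qed
  finally have total: "(\<integral>z. (\<integral>t. h t z \<partial>lborel) \<partial>lborel) = of_real pi * \<i> * of_real J" .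
  have inner: "(\<integral>t. h t z \<partial>lborel) =
      (2 * pi * \<i>) * (indicator (cball 0 R) z *\<^sub>R (of_real (Re z) * winding_number m z))" if z: "z \<notin> path_image m" for z
  proof -
    let ?q = "\<lambda>t. 1 / (m t - z) * m' t"
    have ne: "m t - z \<noteq> 0" if "t \<in> {0..1}" for t using z that by (auto simp: path_image_def)
    have vd: "vector_derivative m (at t within {0..1}) = m' t" if "t \<in> {0..1}" for t
      by (rule vector_derivative_at_within_ivl[OF deriv]) (use that in auto)
    have q: "(?q has_integral 2 * pi * \<i> * winding_number m z) {0..1}"
    proof (rule has_integral_eq)
      show "((\<lambda>t. 1 / (m t - z) * vector_derivative m (at t within {0..1})) has_integral
          2 * pi * \<i> * winding_number m z) {0..1}"
        using has_contour_integral_winding_number[OF valid z] by (simp only: has_contour_integral_def)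
    qed (simp add: vd)
    have "set_integrable lborel {0..1} ?q"
      by (intro borel_integrable_atLeastAtMost' continuous_intros sub) (use ne in auto)
    from set_borel_integral_eq_integral(2)[OF this]
    have q': "(\<integral>t. indicator {0..1} t *\<^sub>R ?q t \<partial>lborel) = 2 * pi * \<i> * winding_number m z"
      using integral_unique[OF q] by (simp add: set_lebesgue_integral_def)
    have "h t z = (indicator (cball 0 R) z *\<^sub>R of_real (Re z)) * (indicator {0..1} t *\<^sub>R ?q t)" for t
      by (simp add: h_def indicator_def)
    then have "(\<integral>t. h t z \<partial>lborel) = (indicator (cball 0 R) z *\<^sub>R of_real (Re z)) * (2 * pi * \<i> * winding_number m z)"
      unfolding q'[symmetric] by (simp only: integral_mult_right_zero)
    then show ?thesis by (simp add: indicator_def)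
  qed
  let ?W = "\<lambda>z. indicator (cball 0 R) z *\<^sub>R (of_real (Re z) * W z)"
  have fst_meas: "(\<lambda>z. \<integral>t. h t z \<partial>lborel) \<in> borel_measurable lborel"
    using measurable_compose[OF measurable_pair_swap'[of lborel lborel] meas_h]
    by (intro lborel.borel_measurable_lebesgue_integral) (simp add: case_prod_unfold)
  have "(\<integral>z. (\<integral>t. h t z \<partial>lborel) \<partial>lborel) = (\<integral>z. (2 * pi * \<i>) * ?W z \<partial>lborel)"
  proof (rule integral_cong_AE[OF fst_meas])
    show "(\<lambda>z. (2 * pi * \<i>) * ?W z) \<in> borel_measurable lborel"
      using W(1) meas(3) by (intro borel_measurable_times borel_measurable_scaleR borel_measurable_indicator) auto
    show "AE z in lborel. (\<integral>t. h t z \<partial>lborel) = (2 * pi * \<i>) * ?W z"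
      using AE_not_in[OF null]
    proof eventually_elim
      fix z assume "z \<notin> path_image m"
      then show "(\<integral>t. h t z \<partial>lborel) = (2 * pi * \<i>) * ?W z"
        using inner W(2) by metis
    qed
  qed
  then have "(2 * pi * \<i>) * (\<integral>z. ?W z \<partial>lborel) = of_real pi * \<i> * of_real J"
    unfolding total integral_mult_right_zero by (rule sym)
  then show ?thesis by (simp add: J_def field_simps)
qed

lemma inside_subset_of_convex:
  fixes C S :: "'a::{real_normed_vector, perfect_space} set"
  assumes "convex C" "S \<subseteq> C"
  shows "inside S \<subseteq> C"
  using convex_in_outside[OF assms(1)] outside_mono[OF assms(2)] inside_Int_outside[of S] by blast

text \<open>Inside the curve the winding number is constantly 1 or constantly -1, and outside it is 0.
The absolute value absorbs the orientation.\<close>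
lemma weighted_area_inside_simple_closed_curve:
  fixes m m' :: "real \<Rightarrow> complex"
  assumes deriv: "\<And>t. (m has_vector_derivative m' t) (at t)" and cont': "continuous_on UNIV m'"
    and simple: "simple_path m" and closed: "m 0 = m 1"
    and pos: "\<And>t. t \<in> {0..1} \<Longrightarrow> 0 < Re (m t)"
  defines "D \<equiv> path_image m \<union> inside (path_image m)"
  shows "compact D"
    and "(\<integral>\<^sup>+z. ennreal (2 * pi * max 0 (Re z)) * indicator D z \<partial>lborel) =
      ennreal (2 * pi * (1/2 * \<bar>integral {0..1} (\<lambda>t. (Re (m t))\<^sup>2 * Im (m' t))\<bar>))"
proof -
  let ?P = "path_image m"
  define J where "J = integral {0..1} (\<lambda>t. (Re (m t))\<^sup>2 * Im (m' t))"
  have path: "path m" and ends: "pathfinish m = pathstart m"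
    using simple closed by (auto simp: simple_path_imp_path pathstart_def pathfinish_def)
  have "compact ?P" by (rule compact_path_image[OF path])
  then obtain R where R: "?P \<subseteq> cball 0 R"
    by (meson compact_imp_bounded bounded_iff mem_cball_0 subsetI)
  have D_cball: "D \<subseteq> cball 0 R"
    unfolding D_def using R inside_subset_of_convex[OF convex_cball R] by blast
  have P_pos: "?P \<subseteq> {z. Re z > 0}" using pos by (auto simp: path_image_def)
  have D_pos: "D \<subseteq> {z. Re z > 0}"
    unfolding D_def using P_pos inside_subset_of_convex[OF convex_halfspace_Re_gt P_pos] by blast
  have "closed D" unfolding D_def by (rule closed_path_image_Un_inside[OF path])
  then show "compact D" using D_cball compact_cball closed_subset bounded_subset bounded_cball
    by (metis compact_eq_bounded_closed)
  have "open (inside ?P)" using \<open>compact ?P\<close> by (intro open_inside compact_imp_closed)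
  obtain k :: real where k: "\<bar>k\<bar> = 1" "\<And>z. z \<in> inside ?P \<Longrightarrow> winding_number m z = of_real k"
    using simple_closed_path_winding_number_inside[OF simple]
    by (metis abs_minus_cancel abs_one of_real_1 of_real_minus)
  define W where "W = (\<lambda>z. of_real k * indicator (inside ?P) z :: complex)"
  have W: "W z = winding_number m z" if "z \<notin> ?P" for z
  proof (cases "z \<in> inside ?P")
    case False
    then have "z \<in> outside ?P" using that inside_Un_outside by blast
    then show ?thesis using winding_number_zero_in_outside[OF path ends] False by (simp add: W_def)
  qed (simp add: W_def k)
  have "W \<in> borel_measurable borel"
    unfolding W_def using \<open>open (inside ?P)\<close> by (intro borel_measurable_times borel_measurable_indicator) auto
  then have J: "(\<integral>z. indicator (cball 0 R) z *\<^sub>R (of_real (Re z) * W z) \<partial>lborel) = of_real (1/2 * J)"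
    unfolding J_def using W pos R
    by (intro weighted_area_of_winding_number[OF deriv cont' _ _ closed]) (force simp: path_image_def)+
  have null: "?P \<in> null_sets lborel" by (rule path_image_null_set[OF deriv])
  have D_borel: "D \<in> sets borel" using \<open>closed D\<close> by (rule borel_closed)
  have Re_meas: "(\<lambda>z. complex_of_real (Re z)) \<in> borel_measurable borel"
    by (intro borel_measurable_continuous_onI continuous_intros)
  have "(\<integral>z. indicator (cball 0 R) z *\<^sub>R (of_real (Re z) * W z) \<partial>lborel) =
      (\<integral>z. of_real k * (indicator D z *\<^sub>R of_real (Re z)) \<partial>lborel)"
  proof (rule integral_cong_AE)
    show "(\<lambda>z. indicator (cball 0 R) z *\<^sub>R (of_real (Re z) * W z)) \<in> borel_measurable lborel"
      using \<open>W \<in> borel_measurable borel\<close> Re_meas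
      by (intro borel_measurable_times borel_measurable_scaleR borel_measurable_indicator) auto
    show "(\<lambda>z. complex_of_real k * (indicator D z *\<^sub>R complex_of_real (Re z))) \<in> borel_measurable lborel"
      using D_borel Re_meas
      by (intro borel_measurable_times borel_measurable_scaleR borel_measurable_indicator) auto
    show "AE z in lborel. indicator (cball 0 R) z *\<^sub>R (of_real (Re z) * W z) = complex_of_real k * (indicator D z *\<^sub>R complex_of_real (Re z))"
      using AE_not_in[OF null]
    proof eventually_elim
      fix z assume "z \<notin> ?P"
      then show "indicator (cball 0 R) z *\<^sub>R (of_real (Re z) * W z) = complex_of_real k * (indicator D z *\<^sub>R complex_of_real (Re z))"
        using D_cball by (auto simp: W_def D_def indicator_def)
    qed
  qed
  also have "\<dots> = of_real (k * (\<integral>z. indicator D z * Re z \<partial>lborel))"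
  proof -
    have "indicator D z *\<^sub>R complex_of_real (Re z) = of_real (indicator D z * Re z)" for z
      by (simp add: scaleR_conv_of_real)
    then show ?thesis
      unfolding integral_mult_right_zero of_real_mult[of k] by (simp only: integral_complex_of_real)
  qed
  finally have "k * (\<integral>z. indicator D z * Re z \<partial>lborel) = 1/2 * J"
    using J by (metis of_real_eq_iff)
  moreover have nonneg: "0 \<le> indicator D z * Re z" for z
    using D_pos by (auto simp: indicator_def)
  then have "0 \<le> (\<integral>z. indicator D z * Re z \<partial>lborel)"
    by (rule Bochner_Integration.integral_nonneg)
  ultimately have area: "(\<integral>z. indicator D z * Re z \<partial>lborel) = 1/2 * \<bar>J\<bar>"
    using k(1) by (cases "k = 1") (auto simp: abs_if split: if_splits)
  have "integrable lborel (\<lambda>z. indicator D z *\<^sub>R Re z)"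
    by (rule borel_integrable_compact[OF \<open>compact D\<close>]) (intro continuous_intros)
  then have int: "integrable lborel (\<lambda>z. 2 * pi * (indicator D z * Re z))" by simp
  have "(\<integral>\<^sup>+z. ennreal (2 * pi * max 0 (Re z)) * indicator D z \<partial>lborel) =
      (\<integral>\<^sup>+z. ennreal (2 * pi * (indicator D z * Re z)) \<partial>lborel)"
    using D_pos by (intro nn_integral_cong) (auto simp: indicator_def max_def)
  also have "\<dots> = ennreal (\<integral>z. 2 * pi * (indicator D z * Re z) \<partial>lborel)"
    by (rule nn_integral_eq_integral[OF int], rule AE_I2, rule mult_nonneg_nonneg[OF _ nonneg]) simp
  also have "(\<integral>z. 2 * pi * (indicator D z * Re z) \<partial>lborel) = 2 * pi * (1/2 * \<bar>J\<bar>)"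
    unfolding area[symmetric] by simp
  finally show "(\<integral>\<^sup>+z. ennreal (2 * pi * max 0 (Re z)) * indicator D z \<partial>lborel) =
      ennreal (2 * pi * (1/2 * \<bar>integral {0..1} (\<lambda>t. (Re (m t))\<^sup>2 * Im (m' t))\<bar>))"
    unfolding J_def .
qed

section \<open>Solids of revolution\<close>

lemma same_orbit_invariant:
  assumes "\<And>t. f (\<tau> t) = f t" "same_orbit \<tau> s t"
  shows "f s = f t"
proof -
  have "f ((\<tau> ^^ n) t) = f t" for n t by (induction n) (auto simp: assms(1))
  then show ?thesis using assms(2) by (auto simp: same_orbit_def)
qed

context axial_motion
begin

text \<open>The meridian curve has a smooth radius because \<open>\<gamma>\<close> does not meet the axis, and it is traversed once
on \<open>{lo..hi}\<close>, which is rescaled to \<open>{0..1}\<close>.\<close>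
lemma volume_of_revolution:
  assumes \<gamma>: "\<gamma> \<in> curve_space \<tau> A a" and trivial: "A = mat 1" "a = 0" and sweeps: "sweeps_torus \<tau> v \<gamma>"
    and orbits: "\<And>s t. s \<in> {lo..<hi} \<Longrightarrow> t \<in> {lo..<hi} \<Longrightarrow> same_orbit \<tau> s t \<Longrightarrow> s = t"
  shows "solid_of_revolution v \<gamma> \<in> lmeasurable"
    and "measure lebesgue (solid_of_revolution v \<gamma>) = 2 * pi * \<bar>volume_functional I v \<gamma>\<bar>"
proof -
  note smooth = curve_smooth[OF \<gamma>]
  have \<gamma>\<tau>: "\<gamma> (\<tau> t) = \<gamma> t" for t using curve_motion[OF \<gamma>] by (simp add: trivial)
  define \<rho> where "\<rho> = (\<lambda>t. \<gamma> t \<bullet> \<gamma> t - (\<gamma> t \<bullet> v)\<^sup>2)"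
  have meridian: "meridian v (\<gamma> t) = Complex (sqrt (\<rho> t)) (\<gamma> t \<bullet> v)" for t
    unfolding meridian_def \<rho>_def norm_offset_square[OF norm_v, symmetric] by simp
  have \<rho>_pos: "\<rho> t > 0" for t
  proof -
    have "Re (meridian v (\<gamma> t)) > 0" using sweeps by (simp add: sweeps_torus_def)
    then show ?thesis by (simp add: meridian)
  qed
  have v_smooth: "smooth_on UNIV (\<lambda>t. \<gamma> t \<bullet> v)"
    by (intro smooth_on_inner open_UNIV smooth smooth_on_const)
  have "smooth_on UNIV \<rho>"
    unfolding \<rho>_def power2_eq_square
    by (intro smooth_on_diff smooth_on_inner smooth_on_mult open_UNIV smooth v_smooth)
  then have r_smooth: "smooth_on UNIV (\<lambda>t. sqrt (\<rho> t))"
    using \<rho>_pos by (intro smooth_on_sqrt open_UNIV) auto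
  define r' where "r' = (\<lambda>t. vector_derivative (\<lambda>t. sqrt (\<rho> t)) (at t))"
  define z' where "z' = (\<lambda>t. vector_derivative \<gamma> (at t) \<bullet> v)"
  have z': "((\<lambda>t. \<gamma> t \<bullet> v) has_vector_derivative z' t) (at t)" for t
    unfolding z'_def
    by (rule bounded_linear.has_vector_derivative[OF bounded_linear_inner_left smooth_has_vector_derivative[OF smooth]])
  have cont_r': "continuous_on UNIV r'" and cont_z': "continuous_on UNIV z'"
    unfolding r'_def z'_def
    by (intro smooth_continuous_derivative r_smooth) (intro continuous_intros smooth_continuous_derivative smooth)
  define l where "l = (\<lambda>t::real. lo + (hi - lo) * t)"
  define m where "m = (\<lambda>t. meridian v (\<gamma> (l t)))"
  define m' where "m' = (\<lambda>t. (hi - lo) *\<^sub>R Complex (r' (l t)) (z' (l t)))"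
  have l_deriv: "(l has_vector_derivative (hi - lo)) (at t within S)" for t S
    unfolding l_def by (auto intro!: derivative_eq_intros)
  have l_Icc: "l t \<in> {lo..hi} \<longleftrightarrow> t \<in> {0..1}" and l_Ico: "l t \<in> {lo..<hi} \<longleftrightarrow> t \<in> {0..<1}" for t
  proof -
    have "lo \<le> l t \<longleftrightarrow> (hi - lo) * 0 \<le> (hi - lo) * t" "l t \<le> hi \<longleftrightarrow> (hi - lo) * t \<le> (hi - lo) * 1"
      "l t < hi \<longleftrightarrow> (hi - lo) * t < (hi - lo) * 1" by (auto simp: l_def)
    then have "lo \<le> l t \<longleftrightarrow> 0 \<le> t" "l t \<le> hi \<longleftrightarrow> t \<le> 1" "l t < hi \<longleftrightarrow> t < 1"
      using lo_less_hi by (simp_all only: mult_le_cancel_left_pos mult_less_cancel_left_pos diff_gt_0_iff_gt)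
    then show "l t \<in> {lo..hi} \<longleftrightarrow> t \<in> {0..1}" "l t \<in> {lo..<hi} \<longleftrightarrow> t \<in> {0..<1}" by auto
  qed
  have l_onto: "\<exists>t\<in>{0..1}. l t = s" if "s \<in> {lo..hi}" for s
  proof -
    have s: "l ((s - lo) / (hi - lo)) = s" using lo_less_hi by (simp add: l_def)
    then show ?thesis using l_Icc[of "(s - lo) / (hi - lo)"] that by auto
  qed
  have l01: "l 0 = lo" "l 1 = hi" by (auto simp: l_def)
  have deriv: "(m has_vector_derivative m' t) (at t)" for t
  proof -
    have "((\<lambda>t. of_real (sqrt (\<rho> t)) + \<i> * of_real (\<gamma> t \<bullet> v)) has_vector_derivative
        of_real (r' s) + \<i> * of_real (z' s)) (at s)" for s
      unfolding r'_def
      by (intro has_vector_derivative_add has_vector_derivative_of_real has_vector_derivative_mult_right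
          smooth_has_vector_derivative[OF r_smooth, folded has_real_derivative_iff_has_vector_derivative]
          z'[folded has_real_derivative_iff_has_vector_derivative])
    from vector_diff_chain_at[OF l_deriv[of t UNIV] this[of "l t"]]
    show ?thesis unfolding m_def m'_def meridian Complex_eq o_def .
  qed
  have cont_l: "continuous_on S l" for S unfolding l_def by (intro continuous_intros)
  have cont_m': "continuous_on UNIV m'"
    unfolding m'_def Complex_eq
    by (intro continuous_intros continuous_on_compose2[OF cont_r' cont_l] continuous_on_compose2[OF cont_z' cont_l]) auto
  have "\<gamma> hi = \<gamma> lo" using ends \<gamma>\<tau> by metis
  then have closed: "m 0 = m 1" by (simp add: m_def l01)
  have orbit: "same_orbit \<tau> s t" if "meridian v (\<gamma> s) = meridian v (\<gamma> t)" for s t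
    using sweeps that by (simp add: sweeps_torus_def)
  have simple: "simple_path m"
  proof (rule simple_pathI)
    show "path m"
      unfolding path_def
      by (intro continuous_at_imp_continuous_on ballI has_vector_derivative_continuous[OF deriv])
    fix x y :: real assume xy: "0 \<le> x" "x < y" "y \<le> 1" "m x = m y"
    have inj: "l s = l t \<longleftrightarrow> s = t" for s t using lo_less_hi by (simp add: l_def)
    have x: "l x \<in> {lo..<hi}" using xy by (subst l_Ico) simp
    have "y = 1"
    proof (rule ccontr)
      assume "y \<noteq> 1"
      then have "l y \<in> {lo..<hi}" using xy by (subst l_Ico) simp
      then have "l x = l y" using orbits[OF x] orbit xy(4) by (simp add: m_def)
      then show False using inj xy(2) by simp
    qed
    moreover from this have "m x = m 0" using xy(4) closed by simp
    then have "l x = l 0" using orbits[OF x, of "l 0"] orbit lo_less_hi by (simp add: m_def l01)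
    then have "x = 0" using inj by simp
    ultimately show "x = 0 \<and> y = 1" by simp
  qed
  have pos: "0 < Re (m t)" for t using sweeps by (simp add: m_def sweeps_torus_def)
  have image: "range (meridian v \<circ> \<gamma>) = path_image m"
  proof
    show "path_image m \<subseteq> range (meridian v \<circ> \<gamma>)" by (auto simp: path_image_def m_def)
    show "range (meridian v \<circ> \<gamma>) \<subseteq> path_image m"
    proof
      fix w assume "w \<in> range (meridian v \<circ> \<gamma>)"
      then obtain t where w: "w = meridian v (\<gamma> t)" by auto
      obtain s where s: "s \<in> I" "same_orbit \<tau> s t"
        using fundamental_domain unfolding fundamental_domain_def by blast
      have "\<gamma> s = \<gamma> t" by (rule same_orbit_invariant[of \<gamma>, OF \<gamma>\<tau> s(2)])
      moreover obtain u where "u \<in> {0..1}" "l u = s" using l_onto outer_interval s(1) by blast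
      ultimately show "w \<in> path_image m" unfolding w path_image_def m_def by (metis image_eqI)
    qed
  qed
  define D where "D = path_image m \<union> inside (path_image m)"
  have solid: "solid_of_revolution v \<gamma> = {p. meridian v p \<in> D}"
    unfolding solid_of_revolution_def image D_def ..
  note area = weighted_area_inside_simple_closed_curve[OF deriv cont_m' simple closed pos, folded D_def]
  have D: "D \<in> sets borel" using area(1) by (intro borel_closed compact_imp_closed)
  have "integral {0..1} (\<lambda>t. (Re (m t))\<^sup>2 * Im (m' t)) = 2 * volume_functional I v \<gamma>"
  proof -
    have "((\<lambda>t. (hi - lo) *\<^sub>R (\<rho> (l t) * z' (l t))) has_integral integral {l 0..l 1} (\<lambda>t. \<rho> t * z' t)) {0..1}"
    proof (rule has_integral_substitution)
      show "continuous_on {lo..hi} (\<lambda>t. \<rho> t * z' t)"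
        unfolding \<rho>_def z'_def by (intro continuous_intros smooth_continuous_derivative smooth)
      show "l ` {0..1} \<subseteq> {lo..hi}" using l_Icc by auto
      show "(l has_field_derivative hi - lo) (at t within {0..1})" for t
        using l_deriv by (simp add: has_real_derivative_iff_has_vector_derivative)
    qed (use l01 lo_less_hi in auto)
    moreover have "(Re (m t))\<^sup>2 * Im (m' t) = (hi - lo) *\<^sub>R (\<rho> (l t) * z' (l t))" for t
      using \<rho>_pos[of "l t"] by (simp add: m_def m'_def meridian less_imp_le)
    ultimately have "integral {0..1} (\<lambda>t. (Re (m t))\<^sup>2 * Im (m' t)) = integral {lo..hi} (\<lambda>t. \<rho> t * z' t)"
      unfolding l01 by (simp only: integral_unique)
    then show ?thesis
      by (simp add: volume_functional_def integral_I norm_offset_square[OF norm_v] \<rho>_def z'_def)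
  qed
  then have em: "emeasure lborel (solid_of_revolution v \<gamma>) = ennreal (2 * pi * \<bar>volume_functional I v \<gamma>\<bar>)"
    unfolding solid emeasure_meridian_vimage[OF norm_v D] area(2) by (simp add: abs_mult)
  have borel: "solid_of_revolution v \<gamma> \<in> sets borel"
  proof -
    have "meridian v \<in> borel_measurable borel"
      by (rule borel_measurable_continuous_onI[OF continuous_on_meridian])
    from measurable_sets[OF this D] show ?thesis by (simp add: solid vimage_def)
  qed
  then have em': "emeasure lebesgue (solid_of_revolution v \<gamma>) = ennreal (2 * pi * \<bar>volume_functional I v \<gamma>\<bar>)"
    using em by simp
  show "solid_of_revolution v \<gamma> \<in> lmeasurable"
    using borel em' by (intro fmeasurableI) auto
  show "measure lebesgue (solid_of_revolution v \<gamma>) = 2 * pi * \<bar>volume_functional I v \<gamma>\<bar>"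
    using em' by (simp add: measure_def)
qed

end

section \<open>The flux of an infinitesimal rotation\<close>

theorem theorem6:
  fixes \<tau> :: "real \<Rightarrow> real" and I :: "real set"
    and A :: "real^3^3" and a v :: "real^3"
  assumes "translation \<tau>" and "fundamental_domain \<tau> I"
    and "rotation_matrix A"
    and "norm v = 1" and "\<exists>c. A *v v = c *\<^sub>R v"
    and "\<forall>p. A *v (v \<times> p) = v \<times> (A *v p + a)"
  shows
    "invariant_primitive A a (\<lambda>p. v \<times> p) (\<lambda>p X. - rotation_form v p X) \<and>
     (\<forall>\<gamma>\<in>curve_space \<tau> A a.
        flux_functional I (rotation_form v) \<gamma> = volume_functional I v \<gamma> \<and>
        flux_functional I (\<lambda>p X. - rotation_form v p X) \<gamma> = - volume_functional I v \<gamma> \<and>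
        volume_functional I v \<gamma> = volume_vector I v \<gamma> \<bullet> v \<and>
        (A = mat 1 \<and> a = 0 \<and> sweeps_torus \<tau> v \<gamma> \<longrightarrow>
           solid_of_revolution v \<gamma> \<in> lmeasurable \<and>
           measure lebesgue (solid_of_revolution v \<gamma>) = 2 * pi * \<bar>volume_functional I v \<gamma>\<bar>) \<and>
        (\<forall>G. variational_gradient \<tau> I A a (flux_functional I (\<lambda>p X. - rotation_form v p X)) \<gamma> G \<longleftrightarrow>
           G = (\<lambda>t. unit_tangent \<gamma> t \<times> (v \<times> \<gamma> t))) \<and>
        (\<forall>Y. symplectic_gradient \<tau> I A a (flux_functional I (\<lambda>p X. - rotation_form v p X)) \<gamma> Y \<longleftrightarrow>
           cong_mod_tangent \<tau> \<gamma> Y (\<lambda>t. v \<times> \<gamma> t)) \<and>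
        (\<forall>G. variational_gradient \<tau> I A a (volume_functional I v) \<gamma> G \<longleftrightarrow>
           G = (\<lambda>t. - (unit_tangent \<gamma> t \<times> (v \<times> \<gamma> t)))) \<and>
        (\<forall>Y. symplectic_gradient \<tau> I A a (volume_functional I v) \<gamma> Y \<longleftrightarrow>
           cong_mod_tangent \<tau> \<gamma> Y (\<lambda>t. - (v \<times> \<gamma> t))))"
proof -
  note axis = commuting_motion_fixes_axis[OF assms(3-5) assms(6)[rule_format]]
  obtain lo hi where interval: "lo < hi" "hi = \<tau> lo \<or> lo = \<tau> hi" "{lo<..<hi} \<subseteq> I" "I \<subseteq> {lo..hi}"
    and orbits: "\<And>s t. s \<in> {lo..<hi} \<Longrightarrow> t \<in> {lo..<hi} \<Longrightarrow> same_orbit \<tau> s t \<Longrightarrow> s = t"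
    using fundamental_domain_interval[OF assms(1,2)] by metis
  interpret axial_motion \<tau> I A a v lo hi
    by unfold_locales (fact assms axis interval)+
  show ?thesis
    using volume_of_revolution[OF _ _ _ _ orbits]
    by (intro conjI ballI allI impI invariant_primitive_rotation_form flux_eq_volume_functional
        flux_uminus_eq_volume_functional volume_functional_eq_volume_vector
        flux_functional_gradients volume_functional_gradients) auto
qed

end
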